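(* Let $n\ge 1$ and let $X\sim N(\mu,\sigma^2)$, $S^2\sim\sigma^2\chi^2_n$ be independent, with unknown $\mu\ge 0$, $\sigma>0$. Consider estimating $\mu$ under loss $\rho\left(\frac{d-\mu}{\sigma}\right)$ with $\rho$ convex. Then: (a) if $\rho$ satisfies $|\rho'(-u)|\le\rho'(u)$ for all $u\ge 0$, the condition $g\le g_{\pi_0}$ suffices for an estimator $\delta_g\in C$ to be minimax; (b) such minimax estimators include the generalized Bayes estimator $\delta_{\pi_0}$ whenever $\rho$ satisfies $|\rho'(-u)|\le\rho'(u)$ for all $u\ge0$, and all generalized Bayes estimators $\delta_{\pi_l}$ with $l>0$ when $\rho$ is even.
   Context: The joint density of $(X,S)$ is $\frac{s^{n-1}}{\sigma^{n+1}}f\left(\frac{(x-\mu)^2+s^2}{\sigma^2}\right)$ with $f(t)\propto e^{-t/2}$. Parameter space $\Theta=\{\theta=(\mu,\sigma):\mu\ge0,\sigma>0\}$. Loss: $\rho$ is absolutely continuous and strictly bowl-shaped: $\rho(t)\ge\rho(0)=0$, $\rho'<0$ on $(-\infty,0)$, $\rho'>0$ on $(0,\infty)$. Risk: $R(\theta,\delta)=E_\theta[\rho((\delta(X,S)-\mu)/\sigma)]$. MRE estimator: it is assumed that a unique minimum risk equivariant estimator with finite risk exists for the unconstrained problem; it is $\delta_0(X,S)=X+c_0S$, $c_0=\mathrm{argmin}_c E_{0,1}[\rho(X+cS)]$, uniquely determined by $E_{0,1}[S\rho'(X+c_0S)]=0$ (subscript $0,1$ means $\mu=0,\sigma=1$);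 $c_0=0$ for even $\rho$. Its risk is constant, and it is known that $\delta_0$ is minimax over $\Theta$; hence "an estimator $\delta$ is minimax" means $R(\theta,\delta)\le R(\theta,\delta_0)$ for all $\theta\in\Theta$. Bayes estimators: for $l\ge-(n-1)$, $\delta_{\pi_l}$ is the generalized Bayes estimator for the prior $\pi_l(\mu,\sigma)=\sigma^{-(l+1)}1_{[0,\infty)}(\mu)1_{(0,\infty)}(\sigma)$, assumed to exist; it has the form $X+c_0S+g_{\pi_l}(X/S)S$, where $g_{\pi_l}(y)$ is the (unique) minimizer in $g$ of $\int_0^\infty\int_{-\infty}^{vy}\rho(u+c_0v+gv)f(u^2+v^2)v^{n+l-1}\,du\,dv$, and satisfies $\int_0^\infty\int_{-\infty}^{vy}\rho'(u+c_0v+g_{\pi_l}(y)v)\,v^{n+l}f(u^2+v^2)\,du\,dv=0$ for all $y\in\mathbb{R}$. Class $C$: the estimators $\delta_g(X,S)=\delta_0(X,S)+g(X/S)S$ with $g:\mathbb{R}\to\mathbb{R}$ absolutely continuous, nonincreasing, non-constant, and $\lim_{t\to\infty}g(t)=0$. *)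

theory Defs
  imports "HOL-Probability.Probability"
begin

section \<open>Absolute continuity\<close>

definition absolutely_continuous_fun_on :: "real set \<Rightarrow> (real \<Rightarrow> real) \<Rightarrow> bool" where
  "absolutely_continuous_fun_on I f \<longleftrightarrow>
     (\<forall>\<epsilon>>0. \<exists>\<eta>>0. \<forall>(m::nat) a b.
        (\<forall>i<m. a i \<in> I \<and> b i \<in> I \<and> a i \<le> b i) \<and>
        (\<forall>i<m. \<forall>j<m. i \<noteq> j \<longrightarrow> {a i<..<b i} \<inter> {a j<..<b j} = {}) \<and>
        (\<Sum>i<m. b i - a i) < \<eta>
        \<longrightarrow> (\<Sum>i<m. \<bar>f (b i) - f (a i)\<bar>) < \<epsilon>)"

text \<open>A function on the whole line is called absolutely continuous when it is so on every
  compact interval (equivalently: it is an indefinite integral). The \<open>\<epsilon>\<close>-\<open>\<eta>\<close> condition on the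
  whole line at once would already exclude the squared error loss.\<close>

definition absolutely_continuous_fun :: "(real \<Rightarrow> real) \<Rightarrow> bool" where
  "absolutely_continuous_fun f \<longleftrightarrow> (\<forall>a b. absolutely_continuous_fun_on {a..b} f)"


section \<open>The model\<close>

definition radial_density :: "nat \<Rightarrow> real \<Rightarrow> real" where
  "radial_density n t = 2 / (sqrt (2 * pi) * 2 powr (real n / 2) * Gamma (real n / 2)) * exp (- t / 2)"

definition joint_density :: "nat \<Rightarrow> real \<Rightarrow> real \<Rightarrow> real \<Rightarrow> real \<Rightarrow> real" where
  "joint_density n \<mu> \<sigma> x s =
     (if s > 0 then s ^ (n - 1) / \<sigma> ^ (n + 1) * radial_density n (((x - \<mu>)\<^sup>2 + s\<^sup>2) / \<sigma>\<^sup>2) else 0)"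

definition chi_square_density :: "nat \<Rightarrow> real \<Rightarrow> real" where
  "chi_square_density n z =
     (if z > 0 then z powr (real n / 2 - 1) * exp (- z / 2) / (2 powr (real n / 2) * Gamma (real n / 2)) else 0)"

text \<open>This fixes the normalising constant: \<open>joint_density\<close> is the density of independent
  \<open>X \<sim> N(\<mu>,\<sigma>\<^sup>2)\<close> and \<open>S > 0\<close> with \<open>S\<^sup>2 / \<sigma>\<^sup>2 \<sim> \<chi>\<^sup>2\<^sub>n\<close>; the factor \<open>2 s / \<sigma>\<^sup>2\<close> is the derivative of
  \<open>s\<^sup>2 / \<sigma>\<^sup>2\<close>.\<close>

lemma joint_density_factor:
  assumes "n \<ge> 1" "\<sigma> > 0" "s > 0"
  shows "joint_density n \<mu> \<sigma> x s =
           normal_density \<mu> \<sigma> x * (2 * s / \<sigma>\<^sup>2 * chi_square_density n (s\<^sup>2 / \<sigma>\<^sup>2))"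
proof -
  have r: "s / \<sigma> > 0" using assms by simp
  have "(s\<^sup>2 / \<sigma>\<^sup>2) powr (real n / 2 - 1) = ((s / \<sigma>) powr 2) powr (real n / 2 - 1)"
    using r by (simp add: power_divide)
  also have "\<dots> = (s / \<sigma>) powr (real n - 2)"
    by (simp add: powr_powr algebra_simps)
  also have "\<dots> = (s / \<sigma>) powr real (n - 1) / (s / \<sigma>)"
    using r assms by (simp add: powr_diff of_nat_diff power2_eq_square)
  also have "\<dots> = (s / \<sigma>) ^ (n - 1) / (s / \<sigma>)"
    using r by (simp only: powr_realpow)
  finally have p: "(s\<^sup>2 / \<sigma>\<^sup>2) powr (real n / 2 - 1) = (s / \<sigma>) ^ (n - 1) / (s / \<sigma>)" .
  have e: "exp (- (((x - \<mu>)\<^sup>2 + s\<^sup>2) / \<sigma>\<^sup>2) / 2)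
           = exp (- (x - \<mu>)\<^sup>2 / (2 * \<sigma>\<^sup>2)) * exp (- (s\<^sup>2 / \<sigma>\<^sup>2) / 2)"
    using assms by (simp add: exp_add[symmetric] field_simps)
  have q: "sqrt (2 * pi * \<sigma>\<^sup>2) = sqrt (2 * pi) * \<sigma>"
    using assms by (simp add: real_sqrt_mult)
  obtain m where m: "n = Suc m" using assms(1) by (cases n) auto
  have G: "Gamma (real n / 2) > 0" using assms(1) by (intro Gamma_real_pos) simp
  have S: "sqrt (2 * pi) > 0" by simp
  show ?thesis
    unfolding joint_density_def radial_density_def normal_density_def chi_square_density_def e p q
    using assms G S by (simp add: m field_simps power2_eq_square)
qed

definition joint_law :: "nat \<Rightarrow> real \<Rightarrow> real \<Rightarrow> (real \<times> real) measure" where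
  "joint_law n \<mu> \<sigma> = density lborel (\<lambda>(x, s). ennreal (joint_density n \<mu> \<sigma> x s))"


section \<open>Loss and risk\<close>

text \<open>\<open>\<rho>\<close> is only differentiable almost everywhere, so conditions on \<open>\<rho>'\<close> are imposed wherever
  the derivative exists; this admits for instance absolute error loss.\<close>

definition strictly_bowl_shaped :: "(real \<Rightarrow> real) \<Rightarrow> bool" where
  "strictly_bowl_shaped \<rho> \<longleftrightarrow>
     \<rho> 0 = 0 \<and> (\<forall>t. \<rho> t \<ge> 0) \<and>
     (\<forall>t<0. \<rho> differentiable (at t) \<longrightarrow> deriv \<rho> t < 0) \<and>
     (\<forall>t>0. \<rho> differentiable (at t) \<longrightarrow> deriv \<rho> t > 0)"

definition steeper_on_right :: "(real \<Rightarrow> real) \<Rightarrow> bool" where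
  "steeper_on_right \<rho> \<longleftrightarrow>
     (\<forall>u\<ge>0. \<rho> differentiable (at u) \<longrightarrow> \<rho> differentiable (at (- u)) \<longrightarrow>
        \<bar>deriv \<rho> (- u)\<bar> \<le> deriv \<rho> u)"

definition risk :: "nat \<Rightarrow> (real \<Rightarrow> real) \<Rightarrow> real \<Rightarrow> real \<Rightarrow> (real \<Rightarrow> real \<Rightarrow> real) \<Rightarrow> ennreal" where
  "risk n \<rho> \<mu> \<sigma> \<delta> = (\<integral>\<^sup>+(x, s). ennreal (\<rho> ((\<delta> x s - \<mu>) / \<sigma>)) \<partial>joint_law n \<mu> \<sigma>)"

definition unique_minimizer :: "(real \<Rightarrow> ennreal) \<Rightarrow> real \<Rightarrow> bool" where
  "unique_minimizer J a \<longleftrightarrow> J a < \<infinity> \<and> (\<forall>b. b \<noteq> a \<longrightarrow> J a < J b)"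

definition shifted_estimator :: "real \<Rightarrow> (real \<Rightarrow> real) \<Rightarrow> real \<Rightarrow> real \<Rightarrow> real" where
  "shifted_estimator c g x s = x + c * s + g (x / s) * s"

text \<open>The equivariant estimators are \<open>X + c S\<close>. The loss may grow so fast that the risk is finite
  at the minimiser only, in which case differentiation under the integral is not available; hence
  the first order condition is part of the definition. The Bayes correction below is treated in
  the same way.\<close>

definition mre_constant :: "nat \<Rightarrow> (real \<Rightarrow> real) \<Rightarrow> real \<Rightarrow> bool" where
  "mre_constant n \<rho> c0 \<longleftrightarrow>
     unique_minimizer (\<lambda>c. risk n \<rho> 0 1 (\<lambda>x s. x + c * s)) c0 \<and>
     integrable (joint_law n 0 1) (\<lambda>(x, s). s * deriv \<rho> (x + c0 * s)) \<and>
     (\<integral>(x, s). s * deriv \<rho> (x + c0 * s) \<partial>joint_law n 0 1) = 0"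

text \<open>The estimator \<open>X + c0 S\<close> is minimax with constant risk, so that an estimator is minimax
  exactly when its risk nowhere exceeds that of \<open>X + c0 S\<close>.\<close>

definition minimax :: "nat \<Rightarrow> (real \<Rightarrow> real) \<Rightarrow> real \<Rightarrow> (real \<Rightarrow> real \<Rightarrow> real) \<Rightarrow> bool" where
  "minimax n \<rho> c0 \<delta> \<longleftrightarrow>
     (\<forall>\<mu>\<ge>0. \<forall>\<sigma>>0. risk n \<rho> \<mu> \<sigma> \<delta> \<le> risk n \<rho> \<mu> \<sigma> (\<lambda>x s. x + c0 * s))"

definition class_C_correction :: "(real \<Rightarrow> real) \<Rightarrow> bool" where
  "class_C_correction g \<longleftrightarrow>
     absolutely_continuous_fun g \<and> antimono g \<and> \<not> (\<exists>k. \<forall>t. g t = k) \<and> (g \<longlongrightarrow> 0) at_top"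


section \<open>Generalized Bayes estimators\<close>

definition prior_density :: "real \<Rightarrow> real \<Rightarrow> real \<Rightarrow> real" where
  "prior_density l \<mu> \<sigma> = (if \<mu> \<ge> 0 \<and> \<sigma> > 0 then \<sigma> powr (- (l + 1)) else 0)"

definition posterior_loss :: "nat \<Rightarrow> (real \<Rightarrow> real) \<Rightarrow> real \<Rightarrow> real \<Rightarrow> real \<Rightarrow> real \<Rightarrow> ennreal" where
  "posterior_loss n \<rho> l x s d =
     (\<integral>\<^sup>+(\<mu>, \<sigma>). ennreal (\<rho> ((d - \<mu>) / \<sigma>) * joint_density n \<mu> \<sigma> x s * prior_density l \<mu> \<sigma>) \<partial>lborel)"

definition generalized_bayes :: "nat \<Rightarrow> (real \<Rightarrow> real) \<Rightarrow> real \<Rightarrow> (real \<Rightarrow> real \<Rightarrow> real) \<Rightarrow> bool" where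
  "generalized_bayes n \<rho> l \<delta> \<longleftrightarrow> (\<forall>x. \<forall>s>0. unique_minimizer (posterior_loss n \<rho> l x s) (\<delta> x s))"

definition cone :: "real \<Rightarrow> (real \<times> real) set" where
  "cone y = {(u, v). v > 0 \<and> u < v * y}"

text \<open>Substituting \<open>u = (x - \<mu>) / \<sigma>\<close>, \<open>v = s / \<sigma>\<close> and \<open>d = x + c0 s + g s\<close>, the posterior loss at
  \<open>(x, s)\<close> with \<open>s > 0\<close> becomes a positive multiple of the following at \<open>y = x / s\<close>.\<close>

definition reduced_posterior_loss ::
  "nat \<Rightarrow> (real \<Rightarrow> real) \<Rightarrow> real \<Rightarrow> real \<Rightarrow> real \<Rightarrow> real \<Rightarrow> ennreal" where
  "reduced_posterior_loss n \<rho> c0 l y g =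
     (\<integral>\<^sup>+(u, v) \<in> cone y.
        ennreal (\<rho> (u + c0 * v + g * v) * radial_density n (u\<^sup>2 + v\<^sup>2) * v powr (real n + l - 1)) \<partial>lborel)"

definition bayes_correction :: "nat \<Rightarrow> (real \<Rightarrow> real) \<Rightarrow> real \<Rightarrow> real \<Rightarrow> (real \<Rightarrow> real) \<Rightarrow> bool" where
  "bayes_correction n \<rho> c0 l g \<longleftrightarrow>
     (\<forall>y. unique_minimizer (reduced_posterior_loss n \<rho> c0 l y) (g y) \<and>
          (let h = (\<lambda>(u, v). deriv \<rho> (u + c0 * v + g y * v) * v powr (real n + l)
                              * radial_density n (u\<^sup>2 + v\<^sup>2))
           in set_integrable lborel (cone y) h \<and> (LINT z:cone y|lborel. h z) = 0))"

end

theory Submission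
  imports Defs
begin

text \<open>Let \<open>D\<close> be the right slope of \<open>\<rho>\<close> and \<open>a(t) = c0 + g(t)\<close>, where \<open>g\<close> is the Bayes correction, so that the
  integral of \<open>D (u + a v) v\<^sup>n exp (- (u\<^sup>2 + v\<^sup>2) / 2)\<close> over the cone \<open>u < t v\<close> vanishes. The key point is
  that the integral over the smaller region \<open>u < t v - \<mu>\<close> is then nonpositive for every \<open>\<mu> \<ge> 0\<close>: in
  the coordinates \<open>w = u + a v\<close>, \<open>m = t v - u\<close> the weight is a monotone likelihood ratio family in \<open>m\<close>
  as soon as \<open>a t \<le> 1\<close>, and steepness of \<open>\<rho>\<close> gives even \<open>a t < 1 / 2\<close> by a reflection in the line
  \<open>u + a v = 0\<close>. A correction below the Bayes correction is built up from \<open>0\<close> by staircase functions;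
  by convexity, raising one step changes the risk by at most a multiple of such an integral, and
  Fatou's lemma passes to the limit. The Bayes corrections themselves lie in the class: they are
  nonincreasing by sign comparison, and locally Lipschitz because \<open>(t + a) / sqrt (1 + a\<^sup>2)\<close> is
  monotone in \<open>t\<close>.\<close>

section \<open>Convex functions on the line\<close>

text \<open>The loss may have kinks, and its risk may be finite at the minimiser alone. So the
  derivative gives way to the right slope, which for a convex function exists everywhere, is
  monotone and is a subgradient, and the risk is never differentiated: an increase of the estimator
  is bounded by the score at the Bayes correction, whose integrability belongs to the first order
  condition. The staircase grows from right to left, so that each stage alters the correction on a
  half line y < tau where it is still constant; in the variables u = (x - mu) / sigma, v = s / sigma
  this half line becomes the cone shifted by mu / sigma, the region of the key inequality. Besides
  fixing the sign of the cross term there, the bound a t < 1 / 2 keeps 1 - a t away from zero in the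
  slope bound for the Bayes correction. For l > 0 it remains to place the correction below the one
  for l = 0. An even loss has c0 = 0; over the half plane the score is then a product, and its
  balance does not involve the power of v. Over a cone, a higher power of v gives more weight to
  positive scores, by a correlation argument, and so lowers the balance point.\<close>

definition right_slope :: "(real \<Rightarrow> real) \<Rightarrow> real \<Rightarrow> real" where
  "right_slope \<rho> x = Inf ((\<lambda>t. (\<rho> x - \<rho> t) / (x - t)) ` {x<..})"

lemma right_slope_subgradient:
  assumes "convex_on UNIV \<rho>"
  shows "\<rho> y \<ge> \<rho> x + right_slope \<rho> x * (y - x)"
  using convex_le_Inf_differential[OF assms, of x y] by (simp add: right_slope_def)

lemma mono_right_slope:
  assumes "convex_on UNIV \<rho>"
  shows "mono (right_slope \<rho>)"
proof (rule monoI)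
  fix x y :: real assume "x \<le> y"
  have "(right_slope \<rho> y - right_slope \<rho> x) * (y - x) \<ge> 0"
    using right_slope_subgradient[OF assms, where x=x and y=y]
      right_slope_subgradient[OF assms, where x=y and y=x]
    by (simp add: algebra_simps)
  then show "right_slope \<rho> x \<le> right_slope \<rho> y"
    using \<open>x \<le> y\<close> by (cases "x = y") (auto simp: zero_le_mult_iff)
qed

lemma right_slope_eq_deriv:
  assumes "convex_on UNIV \<rho>" "\<rho> differentiable (at x)"
  shows "right_slope \<rho> x = deriv \<rho> x"
proof -
  have "DERIV \<rho> x :> deriv \<rho> x"
    using assms(2) DERIV_deriv_iff_real_differentiable by blast
  then have "DERIV (\<lambda>y. \<rho> y - right_slope \<rho> x * (y - x)) x :> deriv \<rho> x - right_slope \<rho> x"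
    by (auto intro!: derivative_eq_intros)
  then have "deriv \<rho> x - right_slope \<rho> x = 0"
    by (rule DERIV_local_min[where d=1]) (use right_slope_subgradient[OF assms(1), of x] in \<open>auto simp: algebra_simps\<close>)
  then show ?thesis by simp
qed

text \<open>The subgradient inequalities at x and at y trap the difference quotient between the
  right slopes at these two points, in whichever order they lie.\<close>

lemma convex_differentiable_isCont_right_slope:
  assumes cv: "convex_on UNIV \<rho>" and ct: "isCont (right_slope \<rho>) x"
  shows "\<rho> differentiable (at x)"
proof -
  let ?D = "right_slope \<rho>"
  have "((\<lambda>y. (\<rho> y - \<rho> x) / (y - x)) \<longlongrightarrow> ?D x) (at x)"
  proof (rule tendsto_sandwich)
    show "\<forall>\<^sub>F y in at x. min (?D x) (?D y) \<le> (\<rho> y - \<rho> x) / (y - x)"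
    proof (unfold eventually_at_filter, intro always_eventually allI impI)
      fix y assume "y \<noteq> x"
      then consider "y > x" | "y < x" by linarith
      then show "min (?D x) (?D y) \<le> (\<rho> y - \<rho> x) / (y - x)"
      proof cases
        case 1 then show ?thesis
          using right_slope_subgradient[OF cv, where x=x and y=y]
          by (intro min.coboundedI1) (simp add: pos_le_divide_eq)
      next
        case 2 then show ?thesis
          using right_slope_subgradient[OF cv, where x=y and y=x]
          by (intro min.coboundedI2) (simp add: neg_le_divide_eq algebra_simps)
      qed
    qed
    show "\<forall>\<^sub>F y in at x. (\<rho> y - \<rho> x) / (y - x) \<le> max (?D x) (?D y)"
    proof (unfold eventually_at_filter, intro always_eventually allI impI)
      fix y assume "y \<noteq> x"
      then consider "y > x" | "y < x" by linarith
      then show "(\<rho> y - \<rho> x) / (y - x) \<le> max (?D x) (?D y)"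
      proof cases
        case 1 then show ?thesis
          using right_slope_subgradient[OF cv, where x=y and y=x]
          by (intro max.coboundedI2) (simp add: pos_divide_le_eq algebra_simps)
      next
        case 2 then show ?thesis
          using right_slope_subgradient[OF cv, where x=x and y=y]
          by (intro max.coboundedI1) (simp add: neg_divide_le_eq)
      qed
    qed
    have t: "(?D \<longlongrightarrow> ?D x) (at x)" using ct by (simp add: isCont_def)
    show "((\<lambda>y. min (?D x) (?D y)) \<longlongrightarrow> ?D x) (at x)"
      using tendsto_min[OF tendsto_const t, of "?D x"] by simp
    show "((\<lambda>y. max (?D x) (?D y)) \<longlongrightarrow> ?D x) (at x)"
      using tendsto_max[OF tendsto_const t, of "?D x"] by simp
  qed
  then show ?thesis
    using has_field_derivative_iff real_differentiable_def by blast
qed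

lemma convex_countable_not_differentiable:
  assumes "convex_on UNIV \<rho>"
  shows "countable {x::real. \<not> \<rho> differentiable (at x)}"
  by (rule countable_subset[OF _ mono_ctble_discont[OF mono_right_slope[OF assms]]])
     (use convex_differentiable_isCont_right_slope[OF assms] in auto)

section \<open>Shears of the plane and Lebesgue measure\<close>

text \<open>By Tonelli the claim is an affine substitution in each fibre. As an identity of measures
  it serves Bochner integrals, nonnegative integrals and null sets alike.\<close>

lemma lborel_shear_snd:
  fixes h :: "real \<Rightarrow> real"
  assumes [measurable]: "h \<in> borel_measurable borel" and c: "c \<noteq> 0"
  shows "(lborel :: (real \<times> real) measure) =
    density (distr lborel borel (\<lambda>(x, y). (x, h x + c * y))) (\<lambda>_. ennreal \<bar>c\<bar>)" (is "_ = ?R")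
proof (rule measure_eqI)
  fix A :: "(real \<times> real) set" assume "A \<in> sets lborel"
  then have A[measurable]: "A \<in> sets borel" by simp
  have T[measurable]: "(\<lambda>(x, y). (x, h x + c * y)) \<in> borel \<rightarrow>\<^sub>M (borel :: (real \<times> real) measure)"
    unfolding borel_prod[symmetric] by measurable
  have A2[measurable]: "A \<in> sets (lborel \<Otimes>\<^sub>M lborel)"
    using A unfolding sets_lborel[symmetric] lborel_prod[symmetric] .
  have [measurable]: "(\<lambda>y. indicator A (x, y) :: ennreal) \<in> borel_measurable borel" for x
    by (rule measurable_compose[OF _ borel_measurable_indicator[OF A2]]) measurable
  have "emeasure lborel A = (\<integral>\<^sup>+p. indicator A p \<partial>(lborel \<Otimes>\<^sub>M lborel))"
    by (simp add: lborel_prod)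
  also have "\<dots> = (\<integral>\<^sup>+x. \<integral>\<^sup>+y. indicator A (x, y) \<partial>lborel \<partial>lborel)"
    by (rule lborel.nn_integral_fst[symmetric]) (simp add: lborel_prod)
  also have "\<dots> = (\<integral>\<^sup>+x. \<bar>c\<bar> * (\<integral>\<^sup>+y. indicator A (x, h x + c * y) \<partial>lborel) \<partial>lborel)"
    
    by (intro nn_integral_cong nn_integral_real_affine[OF _ c]) auto
  also have "\<dots> = \<bar>c\<bar> * (\<integral>\<^sup>+x. \<integral>\<^sup>+y. indicator A ((\<lambda>(x, y). (x, h x + c * y)) (x, y)) \<partial>lborel \<partial>lborel)"
    by (simp add: nn_integral_cmult)
  also have "\<dots> = \<bar>c\<bar> * (\<integral>\<^sup>+p. indicator A ((\<lambda>(x, y). (x, h x + c * y)) p) \<partial>(lborel \<Otimes>\<^sub>M lborel))"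
    by (subst lborel.nn_integral_fst) (simp_all add: lborel_prod)
  also have "\<dots> = emeasure ?R A"
    by (simp add: emeasure_density nn_integral_cmult nn_integral_distr lborel_prod del: nn_integral_indicator)
  finally show "emeasure lborel A = emeasure ?R A" .
qed simp

lemma lborel_shear_fst:
  fixes h :: "real \<Rightarrow> real"
  assumes [measurable]: "h \<in> borel_measurable borel" and c: "c \<noteq> 0"
  shows "(lborel :: (real \<times> real) measure) =
    density (distr lborel borel (\<lambda>(x, y). (h y + c * x, y))) (\<lambda>_. ennreal \<bar>c\<bar>)" (is "_ = ?R")
proof (rule measure_eqI)
  fix A :: "(real \<times> real) set" assume "A \<in> sets lborel"
  then have A[measurable]: "A \<in> sets borel" by simp
  have T[measurable]: "(\<lambda>(x, y). (h y + c * x, y)) \<in> borel \<rightarrow>\<^sub>M (borel :: (real \<times> real) measure)"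
    unfolding borel_prod[symmetric] by measurable
  have A2[measurable]: "A \<in> sets (lborel \<Otimes>\<^sub>M lborel)"
    using A unfolding sets_lborel[symmetric] lborel_prod[symmetric] .
  have [measurable]: "(\<lambda>x. indicator A (x, y) :: ennreal) \<in> borel_measurable borel" for y
    by (rule measurable_compose[OF _ borel_measurable_indicator[OF A2]]) measurable
  have "emeasure lborel A = (\<integral>\<^sup>+p. indicator A p \<partial>(lborel \<Otimes>\<^sub>M lborel))"
    by (simp add: lborel_prod)
  also have "\<dots> = (\<integral>\<^sup>+y. \<integral>\<^sup>+x. indicator A (x, y) \<partial>lborel \<partial>lborel)"
    by (rule lborel_pair.nn_integral_snd[symmetric, simplified]) (simp add: lborel_prod)
  also have "\<dots> = (\<integral>\<^sup>+y. \<bar>c\<bar> * (\<integral>\<^sup>+x. indicator A (h y + c * x, y) \<partial>lborel) \<partial>lborel)"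
    
    by (intro nn_integral_cong nn_integral_real_affine[OF _ c]) auto
  also have "\<dots> = \<bar>c\<bar> * (\<integral>\<^sup>+y. \<integral>\<^sup>+x. indicator A ((\<lambda>(x, y). (h y + c * x, y)) (x, y)) \<partial>lborel \<partial>lborel)"
    by (simp add: nn_integral_cmult)
  also have "\<dots> = \<bar>c\<bar> * (\<integral>\<^sup>+p. indicator A ((\<lambda>(x, y). (h y + c * x, y)) p) \<partial>(lborel \<Otimes>\<^sub>M lborel))"
    by (subst lborel_pair.nn_integral_snd[simplified]) (simp_all add: lborel_prod)
  also have "\<dots> = emeasure ?R A"
    by (simp add: emeasure_density nn_integral_cmult nn_integral_distr lborel_prod del: nn_integral_indicator)
  finally show "emeasure lborel A = emeasure ?R A" .
qed simp

lemma
  fixes T :: "real \<times> real \<Rightarrow> real \<times> real" and F :: "real \<times> real \<Rightarrow> real"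
  assumes T: "T \<in> borel \<rightarrow>\<^sub>M borel"
    and lb: "lborel = density (distr lborel borel T) (\<lambda>_. ennreal \<bar>c\<bar>)"
    and c: "c \<noteq> 0" and F: "integrable lborel F"
  shows integrable_lborel_transform: "integrable lborel (\<lambda>p. F (T p))"
    and integral_lborel_transform: "(\<integral>p. F p \<partial>lborel) = \<bar>c\<bar> * (\<integral>p. F (T p) \<partial>lborel)"
proof -
  note [measurable] = T
  have [measurable]: "F \<in> borel_measurable borel" using F by auto
  have "integrable (density (distr lborel borel T) (\<lambda>_. ennreal \<bar>c\<bar>)) F"
    using F lb by metis
  then have "integrable (distr lborel borel T) (\<lambda>x. \<bar>c\<bar> * F x)"
    by (subst (asm) integrable_real_density) auto
  then have "integrable lborel (\<lambda>x. \<bar>c\<bar> * F (T x))"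
    by (subst (asm) integrable_distr_eq) auto
  then show "integrable lborel (\<lambda>p. F (T p))" using c by simp
  have "(\<integral>p. F p \<partial>lborel) = (\<integral>p. F p \<partial>density (distr lborel borel T) (\<lambda>_. ennreal \<bar>c\<bar>))"
    using lb by metis
  also have "\<dots> = (\<integral>p. \<bar>c\<bar> * F p \<partial>distr lborel borel T)"
    by (subst integral_real_density) auto
  also have "\<dots> = (\<integral>p. \<bar>c\<bar> * F (T p) \<partial>lborel)"
    by (subst integral_distr) auto
  finally show "(\<integral>p. F p \<partial>lborel) = \<bar>c\<bar> * (\<integral>p. F (T p) \<partial>lborel)" by simp
qed

lemma vanishing_lborel_transform:
  fixes F :: "real \<times> real \<Rightarrow> real" and T :: "real \<times> real \<Rightarrow> real \<times> real"
  assumes "T \<in> borel \<rightarrow>\<^sub>M borel"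
    and "lborel = density (distr lborel borel T) (\<lambda>_. ennreal \<bar>c\<bar>)" and "c \<noteq> 0"
    and "integrable lborel F \<and> (\<integral>p. F p \<partial>lborel) = 0"
  shows "integrable lborel (\<lambda>p. F (T p)) \<and> (\<integral>p. F (T p) \<partial>lborel) = 0"
  using integrable_lborel_transform[OF assms(1-3)] integral_lborel_transform[OF assms(1-3)] assms(3,4)
  by auto

lemma nn_integral_lborel_transform:
  fixes T :: "real \<times> real \<Rightarrow> real \<times> real"
  assumes T: "T \<in> borel \<rightarrow>\<^sub>M borel"
    and lb: "lborel = density (distr lborel borel T) (\<lambda>_. ennreal \<bar>c\<bar>)"
    and [measurable]: "F \<in> borel_measurable borel"
  shows "(\<integral>\<^sup>+p. F p \<partial>lborel) = ennreal \<bar>c\<bar> * (\<integral>\<^sup>+p. F (T p) \<partial>lborel)"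
proof -
  note [measurable] = T
  have "(\<integral>\<^sup>+p. F p \<partial>lborel) = (\<integral>\<^sup>+p. F p \<partial>density (distr lborel borel T) (\<lambda>_. ennreal \<bar>c\<bar>))"
    using lb by metis
  then show ?thesis
    by (simp add: nn_integral_density nn_integral_distr nn_integral_cmult)
qed

lemma AE_lborel_transform:
  fixes T :: "real \<times> real \<Rightarrow> real \<times> real"
  assumes T[measurable]: "T \<in> borel \<rightarrow>\<^sub>M borel"
    and lb: "lborel = density (distr lborel borel T) (\<lambda>_. ennreal \<bar>c\<bar>)" and c: "c \<noteq> 0"
    and [measurable]: "Measurable.pred borel P" and P: "AE p in lborel. P p"
  shows "AE p in lborel. P (T p)"
proof -
  have "AE p in density (distr lborel borel T) (\<lambda>_. ennreal \<bar>c\<bar>). P p"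
    using P lb by metis
  then show ?thesis
    using c by (simp add: AE_density AE_distr_iff)
qed

lemma AE_lborel_fst_notin_countable:
  assumes "countable (N :: real set)"
  shows "AE p in (lborel :: (real \<times> real) measure). fst p \<notin> N"
proof -
  have N[measurable]: "N \<in> sets borel"
    by (simp add: assms sets.countable)
  have "AE x in (lborel :: real measure). x \<notin> N"
    using assms by (intro AE_not_in countable_imp_null_set_lborel)
  moreover have "Measurable.pred (lborel \<Otimes>\<^sub>M (lborel :: real measure)) (\<lambda>p. fst p \<notin> N)"
    by measurable
  ultimately have "AE p in lborel \<Otimes>\<^sub>M (lborel :: real measure). fst p \<notin> N"
    by (intro lborel_pair.AE_pair_measure) (auto simp: pred_def)
  then show ?thesis unfolding lborel_prod .
qed

lemma shear_snd_measurable: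
  assumes [measurable]: "h \<in> borel_measurable borel"
  shows "(\<lambda>(x, y). (x, h x + c * y)) \<in> borel \<rightarrow>\<^sub>M (borel :: (real \<times> real) measure)"
    "(\<lambda>(x, y). (h y + c * x, y)) \<in> borel \<rightarrow>\<^sub>M (borel :: (real \<times> real) measure)"
  unfolding borel_prod[symmetric] by measurable

text \<open>For use with the kinks of the loss: they are countable, so u + a v hits them only on
  countably many lines.\<close>

lemma AE_lborel_line_notin_countable:
  assumes "countable (N :: real set)"
  shows "AE p in (lborel :: (real \<times> real) measure). fst p + a * snd p \<notin> N"
proof -
  have N[measurable]: "N \<in> sets borel"
    by (simp add: assms sets.countable)
  have "AE p in lborel. fst ((\<lambda>(x, y). (a * y + 1 * x, y)) p) \<notin> N"
    by (rule AE_lborel_transform[OF shear_snd_measurable(2) lborel_shear_fst _ _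
          AE_lborel_fst_notin_countable[OF assms]]) (auto simp: borel_prod[symmetric])
  then show ?thesis
    by (simp add: split_beta add.commute)
qed

text \<open>Source of the strict inequalities below: a nonnegative function with integral zero
  vanishes almost everywhere, and a nonempty open set is not null.\<close>

lemma integral_pos_if_pos_on_open:
  fixes F :: "'a::euclidean_space \<Rightarrow> real"
  assumes F: "integrable lborel F" and nn: "AE p in lborel. F p \<ge> 0"
    and U: "open U" "U \<noteq> {}" "AE p in lborel. p \<in> U \<longrightarrow> F p > 0"
  shows "(\<integral>p. F p \<partial>lborel) > 0"
proof -
  have "(\<integral>p. F p \<partial>lborel) \<noteq> 0"
  proof
    assume "(\<integral>p. F p \<partial>lborel) = 0"
    then have "AE p in lborel. F p = 0"
      using integral_nonneg_eq_0_iff_AE[OF F nn] by simp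
    with U(3) have "AE p in lborel. p \<notin> U" by eventually_elim auto
    then have "U \<in> null_sets lborel"
      using U(1) by (subst (asm) AE_iff_null_sets[symmetric]) auto
    then have "negligible U"
      by (simp add: negligible_iff_null_sets null_sets_completionI)
    then show False using open_not_negligible U by blast
  qed
  moreover have "(\<integral>p. F p \<partial>lborel) \<ge> 0" by (rule integral_nonneg_AE[OF nn])
  ultimately show ?thesis by linarith
qed

section \<open>Sign-changing scores balanced on cones\<close>

definition half_plane :: "(real \<times> real) set" where
  "half_plane = {(u, v). v > 0}"

text \<open>Integrand of the first order conditions without the normalising constant. For the Bayes
  correction k = n + l and a = c0 + g(y); the exponent is real because l is.\<close>

definition score :: "(real \<Rightarrow> real) \<Rightarrow> real \<Rightarrow> real \<Rightarrow> real \<times> real \<Rightarrow> real" where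
  "score D k a = (\<lambda>(u, v). D (u + a * v) * v powr k * exp (- (u\<^sup>2 + v\<^sup>2) / 2))"

text \<open>With a cone for \<open>A\<close> this is the first order condition of the Bayes
  correction, with \<open>half_plane\<close> and k = n that of the equivariant constant.\<close>

definition balanced :: "(real \<Rightarrow> real) \<Rightarrow> real \<Rightarrow> real \<Rightarrow> (real \<times> real) set \<Rightarrow> bool" where
  "balanced D k a A \<longleftrightarrow> set_integrable lborel A (score D k a) \<and> (LINT p:A|lborel. score D k a p) = 0"

lemma open_half_plane: "open half_plane"
  and open_cone: "open (cone t)"
proof -
  have h: "half_plane = {p. 0 < snd p}" and c: "cone t = {p. 0 < snd p} \<inter> {p. fst p < snd p * t}"
    by (auto simp: half_plane_def cone_def)
  show "open half_plane" unfolding h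
    by (intro open_Collect_less continuous_intros)
  show "open (cone t)" unfolding c
    by (intro open_Int open_Collect_less continuous_intros)
qed

lemma half_plane_borel [measurable]: "half_plane \<in> sets borel"
  and cone_borel [measurable]: "cone t \<in> sets borel"
  by (simp_all add: open_half_plane open_cone borel_open)

lemma cone_subset_half_plane: "cone t \<subseteq> half_plane"
  and cone_mono: "t1 \<le> t2 \<Longrightarrow> cone t1 \<subseteq> cone t2"
  by (auto simp: cone_def half_plane_def elim!: less_le_trans)

lemma open_wedge: "open {(u, v). v > 0 \<and> - a2 * v < u \<and> u < - a1 * (v :: real)}"
proof -
  have "{(u, v). v > 0 \<and> - a2 * v < u \<and> u < - a1 * (v :: real)}
    = {p. 0 < snd p} \<inter> {p. - a2 * snd p < fst p} \<inter> {p. fst p < - a1 * snd p}"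
    by auto
  then show ?thesis
    by (auto intro!: open_Int open_Collect_less continuous_intros)
qed

text \<open>\<open>D\<close> is the abstract right slope. The sign of \<open>D 0\<close> stays open,
  since the loss may have a kink at 0; some pointwise comparisons below therefore leave out the null
  set z = 0.\<close>

locale monotone_score =
  fixes D :: "real \<Rightarrow> real"
  assumes mono_D: "mono D" and D_neg: "z < 0 \<Longrightarrow> D z < 0" and D_pos: "z > 0 \<Longrightarrow> D z > 0"
begin

lemma D_measurable [measurable]: "D \<in> borel_measurable borel"
  by (rule borel_measurable_mono[OF mono_D])

lemma score_measurable [measurable]: "score D k a \<in> borel_measurable borel"
  unfolding score_def borel_prod[symmetric] by measurable

section \<open>Balance points on nested regions\<close>

lemma score_mono:
  assumes "a1 \<le> a2" "p \<in> half_plane"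
  shows "score D k a1 p \<le> score D k a2 p"
proof (cases p)
  case (Pair u v)
  then have "v > 0" using assms by (simp add: half_plane_def)
  then have "D (u + a1 * v) \<le> D (u + a2 * v)"
    using assms by (intro monoD[OF mono_D]) simp
  then show ?thesis
    by (simp add: score_def Pair mult_right_mono)
qed

text \<open>\<open>D\<close> may have flat pieces. Strictness comes from the wedge between the lines
  u = - a1 v and u = - a2 v, where the two scores have opposite signs.\<close>

lemma score_integral_strict_mono:
  assumes a: "a1 < a2" and A[measurable]: "A \<in> sets borel" and Ah: "A \<subseteq> half_plane"
    and i1: "set_integrable lborel A (score D k a1)"
    and i2: "set_integrable lborel A (score D k a2)"
    and wedge: "{(u, v). v > 0 \<and> - a2 * v < u \<and> u < - a1 * v} \<subseteq> A"
  shows "(LINT p:A|lborel. score D k a1 p) < (LINT p:A|lborel. score D k a2 p)"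
proof -
  let ?W = "{(u, v). v > 0 \<and> - a2 * v < u \<and> u < - a1 * (v :: real)}"
  have i: "set_integrable lborel A (\<lambda>p. score D k a2 p - score D k a1 p)"
    using i1 i2 by auto
  have "0 < (\<integral>p. indicator A p *\<^sub>R (score D k a2 p - score D k a1 p) \<partial>lborel)"
  proof (rule integral_pos_if_pos_on_open[where U="?W"])
    show "integrable lborel (\<lambda>p. indicator A p *\<^sub>R (score D k a2 p - score D k a1 p))"
      using i by (simp add: set_integrable_def)
    show "AE p in lborel. 0 \<le> indicator A p *\<^sub>R (score D k a2 p - score D k a1 p)"
      using score_mono[of a1 a2 _ k] a Ah by (intro always_eventually allI) (auto simp: indicator_def)
    show "open ?W" by (rule open_wedge)
    have "(- (a1 + a2) / 2, 1) \<in> ?W" using a by auto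
    then show "?W \<noteq> {}" by blast
    show "AE p in lborel. p \<in> ?W \<longrightarrow> 0 < indicator A p *\<^sub>R (score D k a2 p - score D k a1 p)"
    proof (intro always_eventually allI impI)
      fix p assume p: "p \<in> ?W"
      obtain u v where uv: "p = (u, v)" by (cases p)
      have "D (u + a1 * v) < 0" "D (u + a2 * v) > 0" "v > 0"
        using p by (auto simp: uv intro!: D_neg D_pos)
      then have "score D k a1 p < 0" "score D k a2 p > 0"
        by (auto simp: score_def uv mult_less_0_iff)
      then show "0 < indicator A p *\<^sub>R (score D k a2 p - score D k a1 p)"
        using p wedge by (auto simp: indicator_def)
    qed
  qed
  also have "\<dots> = (LINT p:A|lborel. score D k a2 p) - (LINT p:A|lborel. score D k a1 p)"
    using set_integral_diff(2)[OF i2 i1] by (simp add: set_lebesgue_integral_def)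
  finally show ?thesis by simp
qed

lemma score_integrable_between:
  assumes a: "a1 \<le> a" "a \<le> a2" and A[measurable]: "A \<in> sets borel" and Ah: "A \<subseteq> half_plane"
    and i1: "set_integrable lborel A (score D k a1)"
    and i2: "set_integrable lborel A (score D k a2)"
  shows "set_integrable lborel A (score D k a)"
  unfolding set_integrable_def
proof (rule Bochner_Integration.integrable_bound)
  show "integrable lborel (\<lambda>p. norm (indicator A p *\<^sub>R score D k a1 p) + norm (indicator A p *\<^sub>R score D k a2 p))"
    using i1 i2 unfolding set_integrable_def by (intro Bochner_Integration.integrable_add integrable_norm)
  show "AE p in lborel. norm (indicator A p *\<^sub>R score D k a p) \<le>
    norm (norm (indicator A p *\<^sub>R score D k a1 p) + norm (indicator A p *\<^sub>R score D k a2 p))"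
  proof (intro always_eventually allI)
    fix p
    show "norm (indicator A p *\<^sub>R score D k a p) \<le>
      norm (norm (indicator A p *\<^sub>R score D k a1 p) + norm (indicator A p *\<^sub>R score D k a2 p))"
      using score_mono[OF a(1), of p k] score_mono[OF a(2), of p k] Ah
      by (cases "p \<in> A") auto
  qed
qed simp

text \<open>If a1 < a2, the score at a2 has positive integral over \<open>A\<close>, because the one
  at a1 has integral zero there, and it is positive on the rest of \<open>B\<close>; so it cannot
  balance on \<open>B\<close>.\<close>

lemma balanced_antimono:
  assumes AB: "A \<subseteq> B" "B \<subseteq> half_plane" and A[measurable]: "A \<in> sets borel"
    and B[measurable]: "B \<in> sets borel"
    and b1: "balanced D k a1 A" and b2: "balanced D k a2 B"
    and wedge: "{(u, v). v > 0 \<and> u < - a1 * v} \<subseteq> A"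
    and diff: "\<And>u v. (u, v) \<in> B - A \<Longrightarrow> u + a1 * v \<ge> 0"
  shows "a2 \<le> a1"
proof (rule ccontr)
  assume "\<not> a2 \<le> a1"
  then have a: "a1 < a2" by simp
  have iA1: "set_integrable lborel A (score D k a1)" and z1: "(LINT p:A|lborel. score D k a1 p) = 0"
    and iB: "set_integrable lborel B (score D k a2)" and z2: "(LINT p:B|lborel. score D k a2 p) = 0"
    using b1 b2 by (auto simp: balanced_def)
  have iA2: "set_integrable lborel A (score D k a2)"
    by (rule set_integrable_subset[OF iB]) (use AB in auto)
  have iD: "set_integrable lborel (B - A) (score D k a2)"
    by (rule set_integrable_subset[OF iB]) auto
  have "(LINT p:A|lborel. score D k a1 p) < (LINT p:A|lborel. score D k a2 p)"
    by (rule score_integral_strict_mono[OF a A _ iA1 iA2]) (use AB wedge in auto)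
  moreover have "(LINT p:(B - A)|lborel. score D k a2 p) \<ge> 0"
    unfolding set_lebesgue_integral_def
  proof (intro Bochner_Integration.integral_nonneg)
    fix p :: "real \<times> real"
    obtain u v where uv: "p = (u, v)" by (cases p)
    show "0 \<le> indicator (B - A) p *\<^sub>R score D k a2 p"
    proof (cases "p \<in> B - A")
      case True
      then have v: "v > 0" using AB by (auto simp: uv half_plane_def)
      then have "u + a2 * v > u + a1 * v" using a by simp
      then have "D (u + a2 * v) > 0" using diff[of u v] True by (intro D_pos) (auto simp: uv)
      then show ?thesis using True by (simp add: score_def uv)
    qed simp
  qed
  moreover have "(LINT p:B|lborel. score D k a2 p) =
      (LINT p:A|lborel. score D k a2 p) + (LINT p:(B - A)|lborel. score D k a2 p)"
    using set_integral_Un[OF _ iA2 iD] AB(1) by (simp add: Un_absorb1)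
  ultimately show False using z1 z2 by simp
qed

text \<open>Otherwise u + a v < v (t + a) <= 0 on the whole cone, and a negative score has no zero
  integral.\<close>

lemma balanced_cone_pos:
  assumes b: "balanced D k a (cone t)"
  shows "t + a > 0"
proof (rule ccontr)
  assume "\<not> t + a > 0"
  then have ta: "t + a \<le> 0" by simp
  have neg: "score D k a p < 0" if "p \<in> cone t" for p
  proof -
    obtain u v where uv: "p = (u, v)" by (cases p)
    have v: "v > 0" "u < v * t" using that by (auto simp: cone_def uv)
    have "u + a * v < v * (t + a)" using v by (simp add: algebra_simps)
    also have "\<dots> \<le> 0" using v ta by (simp add: mult_nonneg_nonpos)
    finally have "D (u + a * v) < 0" by (rule D_neg)
    then show ?thesis using v by (auto simp: score_def uv mult_less_0_iff)
  qed
  have "0 < (\<integral>p. - (indicator (cone t) p *\<^sub>R score D k a p) \<partial>lborel)"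
  proof (rule integral_pos_if_pos_on_open[where U="cone t"])
    show "integrable lborel (\<lambda>p. - (indicator (cone t) p *\<^sub>R score D k a p))"
      using b by (auto simp: balanced_def set_integrable_def)
    have "(t - 1, 1) \<in> cone t" by (simp add: cone_def)
    then show "cone t \<noteq> {}" by blast
  qed (use neg in \<open>auto simp: open_cone indicator_def less_imp_le\<close>)
  then show False using b by (simp add: balanced_def set_lebesgue_integral_def)
qed

text \<open>Since t1 + a1 > 0, the line u = - a1 v runs inside the smaller cone: the larger cone
  adds only points with a positive score.\<close>

lemma balanced_cone_antimono:
  assumes t: "t1 \<le> t2" and b1: "balanced D k a1 (cone t1)" and b2: "balanced D k a2 (cone t2)"
  shows "a2 \<le> a1"
proof (rule balanced_antimono[OF cone_mono[OF t] cone_subset_half_plane cone_borel cone_borel b1 b2])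
  have p: "t1 + a1 > 0" by (rule balanced_cone_pos[OF b1])
  show "{(u, v). v > 0 \<and> u < - a1 * v} \<subseteq> cone t1"
  proof
    fix p :: "real \<times> real" assume "p \<in> {(u, v). v > 0 \<and> u < - a1 * v}"
    then obtain u v where uv: "p = (u, v)" "v > 0" "u < - a1 * v" by auto
    have "v * (t1 + a1) > 0" using p uv by simp
    then show "p \<in> cone t1" using uv by (simp add: cone_def algebra_simps)
  qed
  fix u v assume "(u, v) \<in> cone t2 - cone t1"
  then have "v > 0" "v * t1 \<le> u" by (auto simp: cone_def)
  moreover have "v * (t1 + a1) > 0" using p \<open>v > 0\<close> by simp
  ultimately show "0 \<le> u + a1 * v" by (simp add: algebra_simps)
qed

lemma balanced_cone_ge:
  assumes b1: "balanced D k a (cone t)" and b2: "balanced D k c half_plane"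
  shows "c \<le> a"
proof (rule balanced_antimono[OF cone_subset_half_plane order_refl cone_borel half_plane_borel b1 b2])
  have p: "t + a > 0" by (rule balanced_cone_pos[OF b1])
  show "{(u, v). v > 0 \<and> u < - a * v} \<subseteq> cone t"
  proof
    fix p :: "real \<times> real" assume "p \<in> {(u, v). v > 0 \<and> u < - a * v}"
    then obtain u v where uv: "p = (u, v)" "v > 0" "u < - a * v" by auto
    have "v * (t + a) > 0" using p uv by simp
    then show "p \<in> cone t" using uv by (simp add: cone_def algebra_simps)
  qed
  fix u v assume "(u, v) \<in> half_plane - cone t"
  then have "v > 0" "v * t \<le> u" by (auto simp: cone_def half_plane_def)
  moreover have "v * (t + a) > 0" using p \<open>v > 0\<close> by simp
  ultimately show "0 \<le> u + a * v" by (simp add: algebra_simps)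
qed

text \<open>If the balance points stayed above c + e, the score at c + e would have nonpositive
  integral over every cone. But it exceeds the score at c by an amount whose integral grows with the
  cone and is positive from some cone on, while the integral of the score at c tends to
  zero.\<close>

lemma balanced_limit:
  assumes bal: "\<And>t. balanced D k (a t) (cone t)" and c: "balanced D k c half_plane"
  shows "(a \<longlongrightarrow> c) at_top"
proof -
  have anti: "a t2 \<le> a t1" if "t1 \<le> t2" for t1 t2
    using balanced_cone_antimono[OF that bal bal] .
  have ge: "c \<le> a t" for t using balanced_cone_ge[OF bal c] .
  have "\<exists>t. a t < c + e" if e: "e > 0" for e
  proof (rule ccontr)
    assume "\<not> (\<exists>t. a t < c + e)"
    then have big: "c + e \<le> a t" for t by (auto simp: not_less)
    define G where "G t = (LINT p:cone t|lborel. score D k (c + e) p) - (LINT p:cone t|lborel. score D k c p)" for t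
    have ih: "set_integrable lborel half_plane (score D k c)"
      and zh: "(LINT p:half_plane|lborel. score D k c p) = 0"
      using c by (auto simp: balanced_def)
    have ic: "set_integrable lborel (cone t) (score D k c)" for t
      by (rule set_integrable_subset[OF ih]) (auto simp: cone_subset_half_plane)
    have iat: "set_integrable lborel (cone t) (score D k (a t))"
      and zt: "(LINT p:cone t|lborel. score D k (a t) p) = 0" for t
      using bal[of t] by (auto simp: balanced_def)
    \<comment> \<open>Here c + e lies between c and \<open>a t\<close>, and the score at both of
      these is integrable over the cone.\<close>
    have ie: "set_integrable lborel (cone t) (score D k (c + e))" for t
      by (rule score_integrable_between[OF _ _ _ _ ic iat[of t]])
        (use e big cone_subset_half_plane in auto)
    have le0: "(LINT p:cone t|lborel. score D k (c + e) p) \<le> 0" for t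
    proof -
      have "(LINT p:cone t|lborel. score D k (c + e) p) \<le> (LINT p:cone t|lborel. score D k (a t) p)"
        by (rule set_integral_mono[OF ie iat])
          (use score_mono[OF big] subsetD[OF cone_subset_half_plane] in blast)
      then show ?thesis using zt by simp
    qed
    \<comment> \<open>The cone with slope - c is the smallest one that contains the wedge where the
      scores at c and c + e differ in sign.\<close>
    have pos: "G (- c) > 0"
      unfolding G_def
      using score_integral_strict_mono[OF _ cone_borel cone_subset_half_plane ic[of "- c"] ie] e
      by (force simp: cone_def algebra_simps)
    have mono: "G (- c) \<le> G t" if t: "- c \<le> t" for t
    proof -
      have G: "G s = (LINT p:cone s|lborel. score D k (c + e) p - score D k c p)" for s
        unfolding G_def by (rule set_integral_diff(2)[OF ie ic, symmetric])
      show ?thesis unfolding G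
        unfolding set_lebesgue_integral_def
      proof (rule integral_mono)
        have i: "integrable lborel (\<lambda>p. indicator (cone s) p *\<^sub>R (score D k (c + e) p - score D k c p))" for s
          using set_integral_diff(1)[OF ie[of s] ic] by (simp add: set_integrable_def)
        show "integrable lborel (\<lambda>p. indicator (cone (- c)) p *\<^sub>R (score D k (c + e) p - score D k c p))"
          "integrable lborel (\<lambda>p. indicator (cone t) p *\<^sub>R (score D k (c + e) p - score D k c p))"
          by (rule i)+
        fix p
        show "indicator (cone (- c)) p *\<^sub>R (score D k (c + e) p - score D k c p)
          \<le> indicator (cone t) p *\<^sub>R (score D k (c + e) p - score D k c p)"
          using cone_mono[OF t] score_mono[of c "c + e" p k] e cone_subset_half_plane[of t]
          by (cases "p \<in> cone t") (auto simp: indicator_def)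
      qed
    qed
    have "(\<lambda>n. \<integral>p. indicator (cone (real n)) p *\<^sub>R score D k c p \<partial>lborel)
      \<longlonglongrightarrow> (\<integral>p. indicator half_plane p *\<^sub>R score D k c p \<partial>lborel)"
    proof (rule integral_dominated_convergence[where w="\<lambda>p. norm (indicator half_plane p *\<^sub>R score D k c p)"])
      show "integrable lborel (\<lambda>p. norm (indicator half_plane p *\<^sub>R score D k c p))"
        using ih unfolding set_integrable_def by (rule integrable_norm)
      show "AE p in lborel. (\<lambda>n. indicator (cone (real n)) p *\<^sub>R score D k c p)
        \<longlonglongrightarrow> indicator half_plane p *\<^sub>R score D k c p"
      proof (intro always_eventually allI)
        fix p :: "real \<times> real"
        obtain u v where uv: "p = (u, v)" by (cases p)
        have "eventually (\<lambda>n. indicator (cone (real n)) p = (indicator half_plane p :: real)) sequentially"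
        proof (cases "v > 0")
          case True
          have "eventually (\<lambda>n. u / v < real n) sequentially"
            using filterlim_real_sequentially by (simp add: filterlim_at_top_dense)
          then show ?thesis
            by eventually_elim (use True in \<open>auto simp: uv cone_def half_plane_def indicator_def field_simps\<close>)
        qed (auto simp: uv cone_def half_plane_def)
        then show "(\<lambda>n. indicator (cone (real n)) p *\<^sub>R score D k c p)
            \<longlonglongrightarrow> indicator half_plane p *\<^sub>R score D k c p"
          by (intro tendsto_eventually) (auto elim: eventually_mono)
      qed
      show "AE p in lborel. norm (indicator (cone (real n)) p *\<^sub>R score D k c p)
          \<le> norm (indicator half_plane p *\<^sub>R score D k c p)" for n
        using cone_subset_half_plane by (intro always_eventually allI) (auto simp: indicator_def)
    qed auto
    then have "(\<lambda>n. LINT p:cone (real n)|lborel. score D k c p) \<longlonglongrightarrow> 0"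
      using zh by (simp add: set_lebesgue_integral_def)
    then have "eventually (\<lambda>n. (LINT p:cone (real n)|lborel. score D k c p) > - G (- c)) sequentially"
      by (rule order_tendstoD) (use pos in auto)
    moreover have "eventually (\<lambda>n. - c \<le> real n) sequentially"
      using filterlim_real_sequentially by (simp add: filterlim_at_top)
    ultimately have "eventually (\<lambda>n::nat. False) sequentially"
    proof eventually_elim
      case (elim n)
      then show False using mono[of "real n"] le0[of "real n"] by (simp add: G_def)
    qed
    then show False by simp
  qed
  then have ub: "\<exists>t. \<forall>s\<ge>t. a s < c + e" if "e > 0" for e
    using anti that by (meson le_less_trans)
  show ?thesis
  proof (rule tendstoI)
    fix e :: real assume "e > 0"
    then obtain t where "\<forall>s\<ge>t. a s < c + e" using ub by blast
    then have "\<forall>s\<ge>t. dist (a s) c < e" using ge by (auto simp: dist_real_def)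
    then show "eventually (\<lambda>s. dist (a s) c < e) at_top"
      by (auto simp: eventually_at_top_linorder)
  qed
qed

section \<open>Coordinates in which the sign of the score is the sign of the first one\<close>

lemma
  assumes i: "set_integrable lborel A (score D k a)"
  shows score_sheared_integrable:
      "integrable lborel (\<lambda>(z, v). indicator A (z - a * v, v) * (D z * v powr k * exp (- ((z - a * v)\<^sup>2 + v\<^sup>2) / 2)))"
      (is "integrable _ ?S")
    and score_sheared_integral:
      "(\<integral>(z, v). indicator A (z - a * v, v) * (D z * v powr k * exp (- ((z - a * v)\<^sup>2 + v\<^sup>2) / 2)) \<partial>lborel)
        = (LINT p:A|lborel. score D k a p)"
proof -
  have S: "?S = (\<lambda>p. indicator A ((\<lambda>(x, y). (- a * y + 1 * x, y)) p) *\<^sub>R score D k a ((\<lambda>(x, y). (- a * y + 1 * x, y)) p))"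
    by (auto simp: score_def)
  have i': "integrable lborel (\<lambda>p. indicator A p *\<^sub>R score D k a p)"
    using i by (simp add: set_integrable_def)
  note t = shear_snd_measurable(2)[where h="\<lambda>y. - a * y" and c=1] lborel_shear_fst[where h="\<lambda>y. - a * y" and c=1] _ i'
  show "integrable lborel ?S"
    unfolding S by (rule integrable_lborel_transform[OF t]) auto
  show "(\<integral>p. ?S p \<partial>lborel) = (LINT p:A|lborel. score D k a p)"
    unfolding S set_lebesgue_integral_def
    by (subst integral_lborel_transform[OF t]) (auto simp: cong: if_cong)
qed

lemma balanced_cone_sheared:
  assumes "balanced D k a (cone t)"
  shows "integrable lborel (\<lambda>(z, v). if v > 0 \<and> z < (t + a) * v
           then D z * v powr k * exp (- ((z - a * v)\<^sup>2 + v\<^sup>2) / 2) else 0)"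
    (is "integrable _ ?S")
    and "(\<integral>(z, v). (if v > 0 \<and> z < (t + a) * v
           then D z * v powr k * exp (- ((z - a * v)\<^sup>2 + v\<^sup>2) / 2) else 0) \<partial>lborel) = 0"
proof -
  have S: "?S = (\<lambda>(z, v). indicator (cone t) (z - a * v, v) * (D z * v powr k * exp (- ((z - a * v)\<^sup>2 + v\<^sup>2) / 2)))"
    by (auto simp: cone_def indicator_def algebra_simps intro!: ext)
  show "integrable lborel ?S" "(\<integral>p. ?S p \<partial>lborel) = 0"
    using assms score_sheared_integrable[of "cone t" k a] score_sheared_integral[of "cone t" k a]
    unfolding S balanced_def by simp_all
qed

text \<open>With \<open>z = u + a v\<close> and \<open>x = q v\<close> the dependence on \<open>a\<close> is confined to the cross term of the quadratic
  form and to the slope of the cone, so that two cones can be compared pointwise.\<close>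

lemma balanced_cone_normalized:
  assumes b: "balanced D k a (cone t)"
  defines "q \<equiv> sqrt (1 + a\<^sup>2)"
  defines "N \<equiv> \<lambda>(z, x). if x > 0 \<and> z < (t + a) / q * x
     then D z * x powr k * exp (- (z\<^sup>2 + x\<^sup>2) / 2 + a / q * z * x) else 0"
  shows "integrable lborel N \<and> (\<integral>p. N p \<partial>lborel) = 0"
proof -
  have q: "q > 0" "q\<^sup>2 = 1 + a\<^sup>2" "q \<noteq> 0"
    unfolding q_def by (auto intro!: real_sqrt_gt_zero add_pos_nonneg simp: add_nonneg_eq_0_iff)
  let ?S = "\<lambda>(z, v). if v > 0 \<and> z < (t + a) * v
           then D z * v powr k * exp (- ((z - a * v)\<^sup>2 + v\<^sup>2) / 2) else 0"
  have "integrable lborel (\<lambda>p. ?S ((\<lambda>(x, y). (x, 0 + (1 / q) * y)) p)) \<and>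
      (\<integral>p. ?S ((\<lambda>(x, y). (x, 0 + (1 / q) * y)) p) \<partial>lborel) = 0"
    by (rule vanishing_lborel_transform[OF shear_snd_measurable(1)[where h="\<lambda>_. 0"] lborel_shear_snd[where h="\<lambda>_. 0"]])
      (use balanced_cone_sheared[OF b] q in auto)
  moreover have "?S ((\<lambda>(x, y). (x, 0 + (1 / q) * y)) p) = (1 / q) powr k * N p" for p
  proof -
    obtain z x where p: "p = (z, x)" by (cases p)
    have "(z - a * (x / q))\<^sup>2 + (x / q)\<^sup>2 = z\<^sup>2 - 2 * (a / q * z * x) + (1 + a\<^sup>2) * x\<^sup>2 / q\<^sup>2"
      using q(1) by (simp add: power2_diff power_mult_distrib power_divide algebra_simps add_divide_distrib)
    also have "\<dots> = z\<^sup>2 - 2 * (a / q * z * x) + x\<^sup>2"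
      unfolding q(2)[symmetric] using q(1) by (simp add: power2_eq_square)
    finally have e: "- ((z - a * (x / q))\<^sup>2 + (x / q)\<^sup>2) / 2 = - (z\<^sup>2 + x\<^sup>2) / 2 + a / q * z * x"
      by (simp only:) argo
    have "x > 0 \<Longrightarrow> (x / q) powr k = (1 / q) powr k * x powr k"
      using q by (simp add: powr_divide)
    then show ?thesis
      unfolding N_def p using q e by (auto simp: zero_less_divide_iff)
  qed
  ultimately have "integrable lborel (\<lambda>p. (1 / q) powr k * N p) \<and> (\<integral>p. (1 / q) powr k * N p \<partial>lborel) = 0"
    by (simp only:)
  then show ?thesis using q by auto
qed

text \<open>In normalized coordinates the claim compares cone slopes. If the first cone were wider,
  then, its cross term being larger as well, its integrand would dominate the second one pointwise:
  positive parts grow, and negative parts shrink because the factor exp (s z x) is smaller for z <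
  0. Both integrals vanish, a contradiction.\<close>

lemma balanced_cone_ratio_mono:
  assumes t: "t1 < t2" and b1: "balanced D k a1 (cone t1)" and b2: "balanced D k a2 (cone t2)"
    and a: "a2 < a1"
  shows "(t1 + a1) / sqrt (1 + a1\<^sup>2) \<le> (t2 + a2) / sqrt (1 + a2\<^sup>2)"
proof (rule ccontr)
  define q1 q2 where "q1 = sqrt (1 + a1\<^sup>2)" and "q2 = sqrt (1 + a2\<^sup>2)"
  assume "\<not> ?thesis"
  then have lt: "(t2 + a2) / q2 < (t1 + a1) / q1" by (simp add: q1_def q2_def)
  have q: "q1 > 0" "q2 > 0" by (auto simp: q1_def q2_def intro!: add_pos_nonneg)
  have pos: "(t2 + a2) / q2 > 0" "(t1 + a1) / q1 > 0"
    using balanced_cone_pos[OF b1] balanced_cone_pos[OF b2] q by auto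
  \<comment> \<open>a / sqrt (1 + a^2) is tanh (arsinh a), a composition of strictly increasing
    functions.\<close>
  have s: "a2 / q2 < a1 / q1"
  proof -
    have *: "tanh (arsinh x) = x / sqrt (1 + x\<^sup>2)" for x :: real
      by (simp add: tanh_def cosh_arsinh_real add.commute)
    have "arsinh a2 < arsinh a1" using a by simp
    then have "tanh (arsinh a2) < tanh (arsinh a1)" by simp
    then show ?thesis unfolding * q1_def q2_def .
  qed
  define N where "N s \<beta> = (\<lambda>(z, x). if x > 0 \<and> z < \<beta> * x
     then D z * x powr k * exp (- (z\<^sup>2 + x\<^sup>2) / 2 + s * z * x) else 0)" for s \<beta>
  have N1: "integrable lborel (N (a1 / q1) ((t1 + a1) / q1))"
      "(\<integral>p. N (a1 / q1) ((t1 + a1) / q1) p \<partial>lborel) = 0"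
    and N2: "integrable lborel (N (a2 / q2) ((t2 + a2) / q2))"
      "(\<integral>p. N (a2 / q2) ((t2 + a2) / q2) p \<partial>lborel) = 0"
    using balanced_cone_normalized[OF b1] balanced_cone_normalized[OF b2]
    unfolding N_def q1_def q2_def by auto
  let ?F = "\<lambda>p. N (a1 / q1) ((t1 + a1) / q1) p - N (a2 / q2) ((t2 + a2) / q2) p"
  let ?U = "{p :: real \<times> real. fst p < 0} \<inter> {p. 0 < snd p}"
  have ge: "?F p \<ge> 0" if "fst p \<noteq> 0" for p
  proof -
    obtain z x where p: "p = (z, x)" by (cases p)
    show ?thesis
    proof (cases "x > 0")
      case x: True
      show ?thesis
      proof (cases "z < 0")
        case z: True
        have zx: "a1 / q1 * z * x \<le> a2 / q2 * z * x"
          using s z x by (intro mult_right_mono mult_right_mono_neg) auto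
        have in1: "z < (t1 + a1) / q1 * x" "z < (t2 + a2) / q2 * x"
          using z x pos by (meson less_trans mult_pos_pos)+
        have "D z * x powr k \<le> 0"
          using D_neg[OF z] by (simp add: mult_nonpos_nonneg)
        then have "D z * x powr k * exp (- (z\<^sup>2 + x\<^sup>2) / 2 + a1 / q1 * z * x)
            \<ge> D z * x powr k * exp (- (z\<^sup>2 + x\<^sup>2) / 2 + a2 / q2 * z * x)"
          using zx by (intro mult_left_mono_neg) auto
        then show ?thesis using x in1 by (simp add: N_def p)
      next
        case False
        then have z: "z > 0" using that by (simp add: p)
        have zx: "a2 / q2 * z * x \<le> a1 / q1 * z * x"
          using s z x by (intro mult_right_mono) auto
        have "D z * x powr k \<ge> 0"
          using D_pos[OF z] by simp
        then have "D z * x powr k * exp (- (z\<^sup>2 + x\<^sup>2) / 2 + a2 / q2 * z * x)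
            \<le> D z * x powr k * exp (- (z\<^sup>2 + x\<^sup>2) / 2 + a1 / q1 * z * x)"
          using zx by (intro mult_left_mono) auto
        moreover have "(t2 + a2) / q2 * x \<le> (t1 + a1) / q1 * x"
          using lt x by (intro mult_right_mono) auto
        moreover have "0 \<le> D z * x powr k * exp (- (z\<^sup>2 + x\<^sup>2) / 2 + a1 / q1 * z * x)"
          using D_pos[OF z] by simp
        ultimately show ?thesis using x by (auto simp: N_def p)
      qed
    qed (simp add: N_def p)
  qed
  have gt: "?F p > 0" if "p \<in> ?U" for p
  proof -
    obtain z x where p: "p = (z, x)" by (cases p)
    have z: "z < 0" and x: "x > 0" using that by (auto simp: p)
    have zx: "a1 / q1 * z * x < a2 / q2 * z * x"
      using s z x by (intro mult_strict_right_mono mult_strict_right_mono_neg) auto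
    have in1: "z < (t1 + a1) / q1 * x" "z < (t2 + a2) / q2 * x"
      using z x pos by (meson less_trans mult_pos_pos)+
    have "D z * x powr k < 0"
      using D_neg[OF z] x by (simp add: mult_neg_pos)
    then have "D z * x powr k * exp (- (z\<^sup>2 + x\<^sup>2) / 2 + a1 / q1 * z * x)
        > D z * x powr k * exp (- (z\<^sup>2 + x\<^sup>2) / 2 + a2 / q2 * z * x)"
      using zx by (intro mult_strict_left_mono_neg) auto
    then show ?thesis using x in1 by (simp add: N_def p)
  qed
  have "0 < (\<integral>p. ?F p \<partial>lborel)"
  proof (rule integral_pos_if_pos_on_open)
    show "integrable lborel ?F" using N1 N2 by simp
    show "AE p in lborel. ?F p \<ge> 0"
      by (rule eventually_mono[OF AE_lborel_fst_notin_countable[of "{0}"] ge]) auto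
    show "open ?U" by (intro open_Int open_Collect_less continuous_intros)
    have "(-1, 1) \<in> ?U" by simp
    then show "?U \<noteq> {}" by blast
    show "AE p in lborel. p \<in> ?U \<longrightarrow> ?F p > 0" using gt by blast
  qed
  then show False using N1 N2 by simp
qed

end

section \<open>Product integrands, and tails in the second coordinate\<close>

lemma
  fixes f g :: "real \<Rightarrow> real"
  assumes f: "integrable lborel f" and g: "integrable lborel g"
  shows integrable_lborel_product: "integrable lborel (\<lambda>(x, y). f x * g y)"
    and integral_lborel_product: "(\<integral>(x, y). f x * g y \<partial>lborel) = (\<integral>x. f x \<partial>lborel) * (\<integral>y. g y \<partial>lborel)"
proof -
  have [measurable]: "f \<in> borel_measurable borel" "g \<in> borel_measurable borel"
    using f g by auto
  have i: "integrable (lborel \<Otimes>\<^sub>M lborel) (\<lambda>(x, y). f x * g y)"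
  proof (rule lborel_pair.Fubini_integrable)
    show "integrable lborel (\<lambda>x. \<integral>y. norm (case (x, y) of (x, y) \<Rightarrow> f x * g y) \<partial>lborel)"
      using f by (simp add: abs_mult)
    show "AE x in lborel. integrable lborel (\<lambda>y. case (x, y) of (x, y) \<Rightarrow> f x * g y)"
      using g by simp
  qed measurable
  then show "integrable lborel (\<lambda>(x, y). f x * g y)"
    unfolding lborel_prod .
  show "(\<integral>(x, y). f x * g y \<partial>lborel) = (\<integral>x. f x \<partial>lborel) * (\<integral>y. g y \<partial>lborel)"
    using lborel_pair.integral_fst[OF i] by (simp add: lborel_prod)
qed

text \<open>If the integral over \<open>m > \<mu>\<close> were positive, some
  section with \<open>m > \<mu>\<close> would have positive integral, and then so would almost every section with
  \<open>m \<le> \<mu>\<close>.\<close>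

lemma integral_tail_nonpos:
  fixes G :: "real \<times> real \<Rightarrow> real"
  assumes G: "integrable lborel G" "(\<integral>p. G p \<partial>lborel) = 0"
    and G0: "\<And>w m. m \<le> 0 \<Longrightarrow> G (w, m) = 0"
    and r: "\<And>m. m > 0 \<Longrightarrow> r m > (0 :: real)"
    and le: "\<And>w m1 m2. 0 < m1 \<Longrightarrow> m1 \<le> m2 \<Longrightarrow> w \<noteq> 0 \<Longrightarrow> r m1 * G (w, m2) \<le> r m2 * G (w, m1)"
    and \<mu>: "\<mu> \<ge> 0"
  shows "(\<integral>(w, m). indicator {\<mu><..} m * G (w, m) \<partial>lborel) \<le> 0"
proof (rule ccontr)
  assume neg: "\<not> ?thesis"
  define J where "J m = (\<integral>w. G (w, m) \<partial>lborel)" for m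
  have [measurable]: "G \<in> borel_measurable (borel \<Otimes>\<^sub>M borel)" using G(1) by (auto simp: borel_prod)
  have G': "integrable (lborel \<Otimes>\<^sub>M lborel) (\<lambda>(w, m). G (w, m))"
    using G(1) by (simp add: lborel_prod)
  have i: "integrable lborel (\<lambda>(w, m). indicator A m * G (w, m))" if [measurable]: "A \<in> sets borel" for A
  proof (rule Bochner_Integration.integrable_bound[OF G(1)])
    show "(\<lambda>(w, m). indicator A m * G (w, m)) \<in> borel_measurable lborel"
      by (simp add: split_beta' borel_prod[symmetric])
    show "AE p in lborel. norm (case p of (w, m) \<Rightarrow> indicator A m * G (w, m)) \<le> norm (G p)"
      by (intro always_eventually allI) (auto simp: indicator_def)
  qed
  have iJ: "integrable lborel (\<lambda>m. indicator A m * J m)" (is ?A)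
    and eJ: "(\<integral>(w, m). indicator A m * G (w, m) \<partial>lborel) = (\<integral>m. indicator A m * J m \<partial>lborel)" (is ?B)
    if [measurable]: "A \<in> sets borel" for A
  proof -
    have i': "integrable (lborel \<Otimes>\<^sub>M lborel) (\<lambda>(w, m). indicator A m * G (w, m))"
      using i[of A] unfolding lborel_prod by simp
    show ?A ?B
      using lborel_pair.integrable_snd[OF i'] lborel_pair.integral_snd[OF i']
      by (simp_all add: J_def lborel_prod)
  qed
  have ae: "AE m in lborel. integrable lborel (\<lambda>w. G (w, m))"
    using lborel_pair.AE_integrable_snd[OF G'] by simp
  have "(\<integral>m. indicator {\<mu><..} m * J m \<partial>lborel) > 0"
    using neg eJ[of "{\<mu><..}"] by simp
  then have "\<not> (AE m in lborel. indicator {\<mu><..} m * J m \<le> 0)"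
    using integral_nonneg_AE[where M=lborel and f="\<lambda>m. - (indicator {\<mu><..} m * J m)"] by auto
  with ae obtain m2 where m2: "integrable lborel (\<lambda>w. G (w, m2))" "indicator {\<mu><..} m2 * J m2 > 0"
    by (metis (mono_tags, lifting) eventually_mono linorder_not_le)
  have m2': "m2 > \<mu>"
  proof (rule ccontr)
    assume "\<not> m2 > \<mu>"
    then show False using m2(2) by simp
  qed
  with m2(2) have m2'': "J m2 > 0" by simp
  \<comment> \<open>Integrating \<open>le\<close> over w gives r m J m2 <= r m2 J m, which carries
    positivity from the section m2 down to the section m.\<close>
  have J: "J m \<ge> 0" if m: "0 < m" "m \<le> \<mu>" and im: "integrable lborel (\<lambda>w. G (w, m))" for m
  proof -
    have "r m * J m2 = (\<integral>w. r m * G (w, m2) \<partial>lborel)" by (simp add: J_def)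
    also have "\<dots> \<le> (\<integral>w. r m2 * G (w, m) \<partial>lborel)"
    proof (rule integral_mono_AE)
      show "AE w in lborel. r m * G (w, m2) \<le> r m2 * G (w, m)"
        using AE_lborel_singleton[of 0] by (rule eventually_mono) (use le m m2' in auto)
    qed (use im m2 in auto)
    also have "\<dots> = r m2 * J m" by (simp add: J_def)
    finally have "r m * J m2 \<le> r m2 * J m" .
    moreover have "r m * J m2 > 0" using r[of m] m m2'' by simp
    ultimately have "r m2 * J m > 0" by simp
    then show ?thesis using r[of m2] m2' \<mu> by (simp add: zero_less_mult_iff)
  qed
  have "0 \<le> (\<integral>m. indicator {..\<mu>} m * J m \<partial>lborel)"
  proof (rule integral_nonneg_AE)
    have J0: "J m = 0" if "m \<le> 0" for m using G0[OF that] by (simp add: J_def)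
    show "AE m in lborel. 0 \<le> indicator {..\<mu>} m * J m"
      using ae
    proof eventually_elim
      case (elim m)
      show ?case
      proof (cases "0 < m \<and> m \<le> \<mu>")
        case True
        then show ?thesis using J[OF _ _ elim] by simp
      next
        case False
        then have "m \<le> 0 \<or> m \<notin> {..\<mu>}" by auto
        then show ?thesis using J0 by auto
      qed
    qed
  qed
  moreover have "(\<integral>p. G p \<partial>lborel) = (\<integral>m. indicator {..\<mu>} m * J m \<partial>lborel) + (\<integral>m. indicator {\<mu><..} m * J m \<partial>lborel)"
  proof -
    have "(\<integral>p. G p \<partial>lborel) = (\<integral>m. indicator UNIV m * J m \<partial>lborel)"
      using eJ[of UNIV] by simp
    also have "\<dots> = (\<integral>m. indicator {..\<mu>} m * J m + indicator {\<mu><..} m * J m \<partial>lborel)"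
      by (intro Bochner_Integration.integral_cong) (auto simp: indicator_def)
    also have "\<dots> = (\<integral>m. indicator {..\<mu>} m * J m \<partial>lborel) + (\<integral>m. indicator {\<mu><..} m * J m \<partial>lborel)"
      by (intro Bochner_Integration.integral_add iJ) auto
    finally show ?thesis .
  qed
  ultimately show False
    using \<open>(\<integral>m. indicator {\<mu><..} m * J m \<partial>lborel) > 0\<close> G(2) by simp
qed

section \<open>Reflection bound for a t\<close>

context monotone_score
begin

text \<open>The coordinates \<open>z = u + a v\<close>, \<open>y = v - \<kappa> z\<close> diagonalise \<open>u\<^sup>2 + v\<^sup>2\<close>, so that \<open>z \<mapsto> - z\<close> is the reflection in
  the line where the score changes sign. If \<open>a t \<ge> 1 / 2\<close>, it maps the negative part of the cone into the
  positive part and increases \<open>v\<close>.\<close>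

lemma balanced_cone_product_lt:
  assumes b: "balanced D k a (cone t)" and k: "k \<ge> 0"
    and steep: "AE z in lborel. z > 0 \<longrightarrow> - D (- z) \<le> D z"
  shows "a * t < 1 / 2"
proof (rule ccontr)
  assume "\<not> a * t < 1 / 2"
  then have at: "a * t \<ge> 1 / 2" by simp
  have ta: "t + a > 0" by (rule balanced_cone_pos[OF b])
  have a: "a > 0"
  proof (rule ccontr)
    assume "\<not> a > 0"
    then have "a * t \<le> 0" using ta by (intro mult_nonpos_nonneg) auto
    then show False using at by simp
  qed
  \<comment> \<open>The value for which v = y + kappa z removes the cross term from (z - a v)^2 +
    v^2.\<close>
  define \<kappa> where "\<kappa> = a / (1 + a\<^sup>2)"
  have q: "1 + a\<^sup>2 > 0" by (simp add: add_pos_nonneg)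
  have \<kappa>: "\<kappa> > 0" using a q by (simp add: \<kappa>_def)
  \<comment> \<open>The point where a t >= 1 / 2 enters: 2 a t + 2 a^2 >= 1 + 2 a^2 > 1 +
    a^2.\<close>
  have bk: "2 * ((t + a) * \<kappa>) > 1"
  proof -
    have "1 + a\<^sup>2 < 2 * ((t + a) * a)" using at zero_less_power[OF a, of 2]
      by (simp add: power2_eq_square algebra_simps)
    then show ?thesis using q by (simp add: \<kappa>_def pos_less_divide_eq)
  qed
  define P where "P z y \<longleftrightarrow> y + \<kappa> * z > 0 \<and> z < (t + a) * (y + \<kappa> * z)" for z y
  define E where "E z y = exp (- (z\<^sup>2 / (1 + a\<^sup>2) + (1 + a\<^sup>2) * y\<^sup>2) / 2)" for z y
  define h where "h = (\<lambda>(z, y). if P z y then D z * (y + \<kappa> * z) powr k * E z y else 0)"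
  let ?S = "\<lambda>(z, v). if v > 0 \<and> z < (t + a) * v
           then D z * v powr k * exp (- ((z - a * v)\<^sup>2 + v\<^sup>2) / 2) else 0"
  have "integrable lborel (\<lambda>p. ?S ((\<lambda>(x, y). (x, \<kappa> * x + 1 * y)) p)) \<and>
      (\<integral>p. ?S ((\<lambda>(x, y). (x, \<kappa> * x + 1 * y)) p) \<partial>lborel) = 0"
    by (rule vanishing_lborel_transform[OF shear_snd_measurable(1)[where h="\<lambda>x. \<kappa> * x"] lborel_shear_snd[where h="\<lambda>x. \<kappa> * x"]])
      (use balanced_cone_sheared[OF b] in auto)
  moreover have "?S ((\<lambda>(x, y). (x, \<kappa> * x + 1 * y)) p) = h p" for p
  proof -
    obtain z y where p: "p = (z, y)" by (cases p)
    have "(z - a * (\<kappa> * z + y))\<^sup>2 + (\<kappa> * z + y)\<^sup>2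
      = z\<^sup>2 * ((1 - a * \<kappa>)\<^sup>2 + \<kappa>\<^sup>2) + 2 * z * y * (\<kappa> * (1 + a\<^sup>2) - a) + (1 + a\<^sup>2) * y\<^sup>2"
      by (simp add: power2_eq_square algebra_simps)
    also have "\<kappa> * (1 + a\<^sup>2) - a = 0" using q by (simp add: \<kappa>_def)
    also have "(1 - a * \<kappa>)\<^sup>2 + \<kappa>\<^sup>2 = 1 - 2 * (a * \<kappa>) + \<kappa> * (\<kappa> * (1 + a\<^sup>2))"
      by (simp add: power2_eq_square algebra_simps)
    also have "\<kappa> * (1 + a\<^sup>2) = a" using q by (simp add: \<kappa>_def)
    also have "1 - 2 * (a * \<kappa>) + \<kappa> * a = 1 / (1 + a\<^sup>2)"
      using q by (simp add: \<kappa>_def field_simps power2_eq_square)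
    finally have "(z - a * (\<kappa> * z + y))\<^sup>2 + (\<kappa> * z + y)\<^sup>2 = z\<^sup>2 / (1 + a\<^sup>2) + (1 + a\<^sup>2) * y\<^sup>2"
      by simp
    then show ?thesis
      by (simp add: p h_def P_def E_def add.commute)
  qed
  ultimately have h: "integrable lborel h \<and> (\<integral>p. h p \<partial>lborel) = 0"
    by (simp only:)
  then have h': "integrable lborel (\<lambda>p. h ((\<lambda>(x, y). (0 + (-1) * x, y)) p)) \<and>
      (\<integral>p. h ((\<lambda>(x, y). (0 + (-1) * x, y)) p) \<partial>lborel) = 0"
    by (intro vanishing_lborel_transform[OF shear_snd_measurable(2)[where h="\<lambda>x. 0"] lborel_shear_fst[where h="\<lambda>x. 0"]]) auto
  \<comment> \<open>Folding h with its mirror image keeps the integral zero but makes the integrand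
    nonnegative almost everywhere.\<close>
  let ?H = "\<lambda>p. h p + h ((\<lambda>(x, y). (0 + (-1) * x, y)) p)"
  have H: "?H (z, y) = h (z, y) + h (- z, y)" for z y by simp
  have E0: "E z y > 0" "E (- z) y = E z y" for z y by (simp_all add: E_def)
  have ge: "?H (z, y) \<ge> 0" if z: "z > 0" "- D (- z) \<le> D z" for z y
  proof (cases "P (- z) y")
    case True
    have kz: "\<kappa> * z > 0" using \<kappa> z by simp
    have 1: "y - \<kappa> * z > 0" using True by (simp add: P_def)
    then have 2: "y + \<kappa> * z > 0" "(y - \<kappa> * z) powr k \<le> (y + \<kappa> * z) powr k"
      using kz k by (auto intro!: powr_mono2)
    have "z < (2 * ((t + a) * \<kappa>)) * z" using bk z by simp
    also have "\<dots> = (t + a) * (\<kappa> * z + \<kappa> * z)" by (simp add: algebra_simps)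
    also have "\<dots> \<le> (t + a) * (y + \<kappa> * z)" using 1 ta by (intro mult_left_mono) auto
    finally have "P z y" using 2 by (simp add: P_def)
    have "- D (- z) * (y - \<kappa> * z) powr k \<le> D z * (y + \<kappa> * z) powr k"
      using z 2 D_neg[of "- z"] by (intro mult_mono) auto
    then have "- D (- z) * (y - \<kappa> * z) powr k * E z y \<le> D z * (y + \<kappa> * z) powr k * E z y"
      using E0 by (intro mult_right_mono) (auto intro: less_imp_le)
    then show ?thesis unfolding H using True \<open>P z y\<close> by (simp add: h_def E0)
  next
    case False
    then show ?thesis unfolding H using D_pos[of z] z E0(1)[of z y] by (simp add: h_def)
  qed
  have "0 < (\<integral>p. ?H p \<partial>lborel)"
  proof (rule integral_pos_if_pos_on_open)
    show "integrable lborel ?H" using h h' by (intro Bochner_Integration.integrable_add) auto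
    have steep': "AE p in (lborel :: (real \<times> real) measure). fst p > 0 \<longrightarrow> - D (- fst p) \<le> D (fst p)"
    proof -
      have m: "Measurable.pred (lborel \<Otimes>\<^sub>M (lborel :: real measure)) (\<lambda>p. fst p > 0 \<longrightarrow> - D (- fst p) \<le> D (fst p))"
        by measurable
      have "AE p in lborel \<Otimes>\<^sub>M (lborel :: real measure). fst p > 0 \<longrightarrow> - D (- fst p) \<le> D (fst p)"
        using steep m by (intro lborel_pair.AE_pair_measure) (auto simp: pred_def)
      then show ?thesis unfolding lborel_prod .
    qed
    have steep'': "AE p in (lborel :: (real \<times> real) measure). - fst p > 0 \<longrightarrow> - D (fst p) \<le> D (- fst p)"
    proof -
      have m: "Measurable.pred (borel :: (real \<times> real) measure) (\<lambda>p. fst p > 0 \<longrightarrow> - D (- fst p) \<le> D (fst p))"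
        unfolding borel_prod[symmetric] by measurable
      have "AE p in (lborel :: (real \<times> real) measure). fst ((\<lambda>(x, y). (0 + (-1) * x, y)) p) > 0
         \<longrightarrow> - D (- fst ((\<lambda>(x, y). (0 + (-1) * x, y)) p)) \<le> D (fst ((\<lambda>(x, y). (0 + (-1) * x, y)) p))"
        by (rule AE_lborel_transform[where P="\<lambda>p. fst p > 0 \<longrightarrow> - D (- fst p) \<le> D (fst p)",
              OF shear_snd_measurable(2)[where h="\<lambda>x. 0"] lborel_shear_fst[where h="\<lambda>x. 0"] _ m steep']) simp_all
      then show ?thesis by (simp add: split_beta')
    qed
    show "AE p in lborel. 0 \<le> ?H p"
      using steep' steep'' AE_lborel_fst_notin_countable[of "{0}", simplified]
    proof eventually_elim
      case (elim p)
      obtain z y where p: "p = (z, y)" by (cases p)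
      from elim show ?case
        using ge[of z y] ge[of "- z" y] unfolding p H by (cases "z > 0") (auto simp: add.commute)
    qed
    \<comment> \<open>Points with z > 0 inside the region whose mirror image lies outside, because y
      - kappa z < 0; nothing compensates the positive score there.\<close>
    let ?U = "{p. 0 < fst p} \<inter> {p. snd p < \<kappa> * fst p} \<inter> {p. 0 < snd p + \<kappa> * fst p} \<inter>
       {p. fst p < (t + a) * (snd p + \<kappa> * fst p)}"
    show "open ?U" by (intro open_Int open_Collect_less continuous_intros)
    \<comment> \<open>The witness (1, kappa - e) lies just below the line y = kappa z. The first
      bound on e keeps it at y >= 0, the second spends half of the slack in \<open>bk\<close>, so
      that it stays in the region.\<close>
    define e where "e = min \<kappa> ((2 * ((t + a) * \<kappa>) - 1) / (2 * (t + a)))"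
    have e: "e > 0" "e \<le> \<kappa>" "e * (2 * (t + a)) \<le> 2 * ((t + a) * \<kappa>) - 1"
      using \<kappa> bk ta by (auto simp: e_def min_def pos_divide_le_eq[symmetric] field_simps)
    have "(t + a) * e > 0" using e ta by simp
    then have "1 < (t + a) * (\<kappa> - e + \<kappa>)" using e(3) by (simp add: algebra_simps)
    then have "(1, \<kappa> - e) \<in> ?U" using e \<kappa> by simp
    then show "?U \<noteq> {}" by blast
    have "?H p > 0" if pU: "p \<in> ?U" for p
    proof -
      obtain z y where p: "p = (z, y)" by (cases p)
      have "P z y" "\<not> P (- z) y" "z > 0" "y + \<kappa> * z > 0" using pU by (auto simp: p P_def)
      then show ?thesis unfolding p H using D_pos[of z] E0 by (simp add: h_def)
    qed
    then show "AE p in lborel. p \<in> ?U \<longrightarrow> 0 < ?H p" by blast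
  qed
  also have "\<dots> = 0" using h h' by (subst Bochner_Integration.integral_add) auto
  finally show False by simp
qed

end

text \<open>On v > 0 the power v^k is at most 1 + v^N for an integer N >= k, and normal moments are
  finite.\<close>

lemma integrable_powr_gaussian:
  fixes c k :: real
  assumes c: "c > 0" and k: "k \<ge> 0"
  shows "integrable lborel (\<lambda>v. indicator {0<..} v * (v powr k * exp (- (c * v\<^sup>2) / 2)))"
proof -
  define \<sigma> where "\<sigma> = 1 / sqrt c"
  have \<sigma>: "\<sigma> > 0" "\<sigma>\<^sup>2 = 1 / c" using c by (auto simp: \<sigma>_def power_divide)
  define N where "N = nat \<lceil>k\<rceil>"
  have N: "k \<le> real N" using k by (simp add: N_def)
  define K where "K = sqrt (2 * pi * \<sigma>\<^sup>2)"
  have K: "K > 0" using \<sigma> c by (simp add: K_def)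
  have nd: "normal_density 0 \<sigma> v = exp (- (c * v\<^sup>2) / 2) / K" for v
    unfolding normal_density_def K_def[symmetric] by (simp add: \<sigma>)
  show ?thesis
  proof (rule Bochner_Integration.integrable_bound)
    show "integrable lborel (\<lambda>v. K * norm (normal_density 0 \<sigma> v * (v - 0) ^ 0) + K * norm (normal_density 0 \<sigma> v * (v - 0) ^ N))"
      by (intro Bochner_Integration.integrable_add integrable_mult_right integrable_norm integrable_normal_moment \<sigma>)
    show "AE v in lborel. norm (indicator {0<..} v * (v powr k * exp (- (c * v\<^sup>2) / 2)))
       \<le> norm (K * norm (normal_density 0 \<sigma> v * (v - 0) ^ 0) + K * norm (normal_density 0 \<sigma> v * (v - 0) ^ N))"
    proof (intro always_eventually allI)
      fix v :: real
      have "v powr k \<le> 1 + v ^ N" if "v > 0"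
      proof (cases "v \<le> 1")
        case True
        then have "v powr k \<le> 1" using that k by (simp add: powr_le1)
        then show ?thesis using that by (smt (verit) zero_le_power)
      next
        case False
        then have "v powr k \<le> v powr real N" using N by (intro powr_mono) auto
        then show ?thesis using that by (simp add: powr_realpow)
      qed
      then have "v > 0 \<Longrightarrow> v powr k * exp (- (c * v\<^sup>2) / 2) \<le> (1 + v ^ N) * exp (- (c * v\<^sup>2) / 2)"
        by (intro mult_right_mono) auto
      then show "norm (indicator {0<..} v * (v powr k * exp (- (c * v\<^sup>2) / 2)))
       \<le> norm (K * norm (normal_density 0 \<sigma> v * (v - 0) ^ 0) + K * norm (normal_density 0 \<sigma> v * (v - 0) ^ N))"
        using K by (cases "v > 0") (auto simp: nd abs_mult algebra_simps)
    qed
  qed measurable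
qed

section \<open>Shifted cones, and the half plane as a product\<close>

context monotone_score
begin

text \<open>The sign that makes raising an estimator harmless at every mu >= 0. With b = t + a one
  has v = (w + m) / b; the cone is m > 0 and its shift is m > mu, so the claim is a tail inequality
  in m.\<close>

lemma balanced_cone_shift_nonpos:
  assumes b: "balanced D k a (cone t)" and k: "k \<ge> 0" and at: "a * t < 1 / 2" and \<mu>: "\<mu> \<ge> 0"
  shows "(LINT p:{(u, v). v > 0 \<and> u < v * t - \<mu>}|lborel. score D k a p) \<le> 0"
proof -
  define b where "b = t + a"
  have b0: "b > 0" using balanced_cone_pos[OF b] by (simp add: b_def)
  define A where "A \<mu> = {(u, v). v > 0 \<and> u < v * t - (\<mu>::real)}" for \<mu>
  have A0: "A 0 = cone t" by (auto simp: A_def cone_def)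
  have [measurable]: "A \<mu> \<in> sets borel" for \<mu>
  proof -
    have "A \<mu> = {p. 0 < snd p} \<inter> {p. fst p < snd p * t - \<mu>}" by (auto simp: A_def)
    then show ?thesis by (auto intro!: borel_open open_Int open_Collect_less continuous_intros)
  qed
  have iA: "set_integrable lborel (A \<mu>) (score D k a)" if "\<mu> \<ge> 0" for \<mu>
    by (rule set_integrable_subset[of lborel "cone t"])
      (use b that in \<open>auto simp: balanced_def A_def[symmetric], auto simp: A_def cone_def\<close>)
  define G where "G \<mu> = (\<lambda>(w, m). if \<mu> < m \<and> w + m > 0 then
      D w * ((w + m) / b) powr k * exp (- ((w - a * ((w + m) / b))\<^sup>2 + ((w + m) / b)\<^sup>2) / 2) else 0)" for \<mu>
  let ?S = "\<lambda>\<mu>. \<lambda>(z, v). indicator (A \<mu>) (z - a * v, v) * (D z * v powr k * exp (- ((z - a * v)\<^sup>2 + v\<^sup>2) / 2))"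
  let ?T = "\<lambda>(x, y). (x, 1 / b * x + (1 / b) * y)"
  note T = shear_snd_measurable(1)[where h="\<lambda>x. 1 / b * x" and c="1 / b"]
    lborel_shear_snd[where h="\<lambda>x. 1 / b * x" and c="1 / b"]
  have SG: "?S \<mu> (?T p) = G \<mu> p" for p \<mu>
  proof -
    obtain w m where p: "p = (w, m)" by (cases p)
    have e: "?T p = (w, (w + m) / b)" by (simp add: p add_divide_distrib)
    have "w - a * V < V * t - \<mu> \<longleftrightarrow> w + \<mu> < V * b" for V
      by (auto simp: b_def algebra_simps)
    then have "w - a * ((w + m) / b) < (w + m) / b * t - \<mu> \<longleftrightarrow> w + \<mu> < ((w + m) / b) * b" .
    also have "\<dots> \<longleftrightarrow> \<mu> < m" using b0 by simp
    finally show ?thesis using b0 unfolding e unfolding p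
      by (auto simp: G_def A_def indicator_def zero_less_divide_iff)
  qed
  have iG: "integrable lborel (G \<mu>)" and eG: "(LINT p:A \<mu>|lborel. score D k a p) = 1 / b * (\<integral>p. G \<mu> p \<partial>lborel)"
    if "\<mu> \<ge> 0" for \<mu>
    using integrable_lborel_transform[OF T _ score_sheared_integrable[OF iA[OF that]]]
      integral_lborel_transform[OF T _ score_sheared_integrable[OF iA[OF that]]]
      score_sheared_integral[OF iA[OF that]] b0
    unfolding SG by auto
  define c1 where "c1 = ((1 - a / b)\<^sup>2 + 1 / b\<^sup>2) / 2"
  define c2 where "c2 = (1 + a\<^sup>2) / (2 * b\<^sup>2)"
  \<comment> \<open>Coefficient of w m in the exponent; a t < 1 makes it negative.\<close>
  define \<kappa> where "\<kappa> = (a * t - 1) / b\<^sup>2"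
  have \<kappa>: "\<kappa> < 0" using at b0 by (simp add: \<kappa>_def divide_neg_pos)
  \<comment> \<open>What remains of the weight after splitting off factors of w alone and of m
    alone.\<close>
  define P where "P w m = (if w + m > 0 then ((w + m) / b) powr k * exp (\<kappa> * w * m) else 0)" for w m
  have Q: "- ((w - a * ((w + m) / b))\<^sup>2 + ((w + m) / b)\<^sup>2) / 2 = - c1 * w\<^sup>2 + \<kappa> * w * m + - c2 * m\<^sup>2" for w m
  proof -
    have "(w - a * ((w + m) / b))\<^sup>2 + ((w + m) / b)\<^sup>2
      = ((1 - a / b)\<^sup>2 + 1 / b\<^sup>2) * w\<^sup>2 + 2 * ((1 + a\<^sup>2 - a * b) / b\<^sup>2) * w * m + (1 + a\<^sup>2) / b\<^sup>2 * m\<^sup>2"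
      using b0 by (simp add: power2_eq_square field_simps)
    moreover have "1 + a\<^sup>2 - a * b = - (a * t - 1)" by (simp add: b_def power2_eq_square algebra_simps)
    moreover have "(1 + a\<^sup>2) / b\<^sup>2 = 2 * c2" using b0 by (simp add: c2_def field_simps)
    moreover have "(1 - a / b)\<^sup>2 + 1 / b\<^sup>2 = 2 * c1" by (simp add: c1_def)
    moreover have "(- (a * t - 1)) / b\<^sup>2 = - \<kappa>" by (simp add: \<kappa>_def minus_divide_left)
    ultimately have "(w - a * ((w + m) / b))\<^sup>2 + ((w + m) / b)\<^sup>2 = 2 * c1 * w\<^sup>2 + 2 * (- \<kappa>) * w * m + 2 * c2 * m\<^sup>2"
      by (simp only:)
    then show ?thesis by (simp only:) argo
  qed
  have GP: "G 0 (w, m) = D w * exp (- c1 * w\<^sup>2) * (exp (- c2 * m\<^sup>2) * P w m)" if "m > 0" for w m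
    using that unfolding G_def P_def prod.case Q exp_add by (simp add: mult_ac)
  \<comment> \<open>For w > 0 both (w + m) / m and exp (kappa w m) decrease in m; for w < 0 both
    increase, which gives \<open>Pn\<close>.\<close>
  have Pp: "m1 powr k * P w m2 \<le> m2 powr k * P w m1" if w: "w > 0" and m: "0 < m1" "m1 \<le> m2" for w m1 m2
  proof -
    have "m1 * ((w + m2) / b) \<le> m2 * ((w + m1) / b)"
    proof -
      have "m1 * (w + m2) \<le> m2 * (w + m1)" using w m by (simp add: algebra_simps)
      then show ?thesis using b0 by (simp add: divide_right_mono)
    qed
    then have "(m1 * ((w + m2) / b)) powr k \<le> (m2 * ((w + m1) / b)) powr k"
      using w m b0 k by (intro powr_mono2) auto
    then have 1: "m1 powr k * ((w + m2) / b) powr k \<le> m2 powr k * ((w + m1) / b) powr k"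
      using powr_mult[of m1 "(w + m2) / b" k] powr_mult[of m2 "(w + m1) / b" k] w m b0 by simp
    have "\<kappa> * w * m2 \<le> \<kappa> * w * m1"
      using \<kappa> w m by (intro mult_left_mono_neg) (auto intro: mult_nonpos_nonneg)
    then have "(m1 powr k * ((w + m2) / b) powr k) * exp (\<kappa> * w * m2) \<le> (m2 powr k * ((w + m1) / b) powr k) * exp (\<kappa> * w * m1)"
      by (intro mult_mono[OF 1]) auto
    then show ?thesis using w m by (simp add: P_def mult.assoc)
  qed
  have Pn: "m2 powr k * P w m1 \<le> m1 powr k * P w m2" if w: "w < 0" and m: "0 < m1" "m1 \<le> m2" for w m1 m2
  proof (cases "w + m1 > 0")
    case True
    have "m2 * ((w + m1) / b) \<le> m1 * ((w + m2) / b)"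
    proof -
      have "m2 * (w + m1) \<le> m1 * (w + m2)" using w m by (simp add: algebra_simps)
      then show ?thesis using b0 by (simp add: divide_right_mono)
    qed
    then have "(m2 * ((w + m1) / b)) powr k \<le> (m1 * ((w + m2) / b)) powr k"
      using True m b0 k by (intro powr_mono2) auto
    then have 1: "m2 powr k * ((w + m1) / b) powr k \<le> m1 powr k * ((w + m2) / b) powr k"
      using powr_mult[of m1 "(w + m2) / b" k] powr_mult[of m2 "(w + m1) / b" k] True m b0 by simp
    have "\<kappa> * w * m1 \<le> \<kappa> * w * m2"
      using \<kappa> w m by (intro mult_left_mono) (auto intro: mult_nonpos_nonpos)
    then have "(m2 powr k * ((w + m1) / b) powr k) * exp (\<kappa> * w * m1) \<le> (m1 powr k * ((w + m2) / b) powr k) * exp (\<kappa> * w * m2)"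
      by (intro mult_mono[OF 1]) auto
    then show ?thesis using True m by (simp add: P_def mult.assoc)
  next
    case False
    then show ?thesis by (simp add: P_def)
  qed
  \<comment> \<open>The reference factor r is, up to a constant, the weight on the line w = 0, where
    the score changes sign.\<close>
  have "(\<integral>(w, m). indicator {\<mu><..} m * G 0 (w, m) \<partial>lborel) \<le> 0"
  proof (rule integral_tail_nonpos[where r="\<lambda>m. m powr k * exp (- c2 * m\<^sup>2)", OF iG])
    show "(\<integral>p. G 0 p \<partial>lborel) = 0"
      using eG[of 0] b b0 by (simp add: A0 balanced_def)
    fix w m1 m2 :: real assume m: "0 < m1" "m1 \<le> m2" and w: "w \<noteq> 0"
    define X where "X = D w * exp (- c1 * w\<^sup>2) * exp (- c2 * m1\<^sup>2) * exp (- c2 * m2\<^sup>2)"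
    have "X * (m1 powr k * P w m2) \<le> X * (m2 powr k * P w m1)"
    proof (cases "w > 0")
      case True
      then show ?thesis using Pp[OF True m] D_pos[of w] by (intro mult_left_mono) (auto simp: X_def)
    next
      case False
      then have "X \<le> 0" using w D_neg[of w] by (auto simp: X_def mult_le_0_iff)
      then show ?thesis using Pn[OF _ m, of w] False w by (intro mult_left_mono_neg) auto
    qed
    then show "m1 powr k * exp (- c2 * m1\<^sup>2) * G 0 (w, m2) \<le> m2 powr k * exp (- c2 * m2\<^sup>2) * G 0 (w, m1)"
      using m by (simp add: GP X_def mult_ac)
  qed (use \<mu> in \<open>auto simp: G_def\<close>)
  also have "(\<lambda>(w, m). indicator {\<mu><..} m * G 0 (w, m)) = G \<mu>"
    using \<mu> by (auto simp: G_def indicator_def)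
  finally show ?thesis
    using eG[OF \<mu>] b0 by (simp add: A_def divide_le_0_iff)
qed

text \<open>For a = 0 the score is a function of z times a positive weight in v. Balance therefore
  says that the z factor has integral zero, and this does not mention k.\<close>

lemma balanced_half_plane_factor:
  assumes b: "balanced D k 0 half_plane" and k: "k \<ge> 0"
  shows "integrable lborel (\<lambda>z. D z * exp (- z\<^sup>2 / 2))"
    and "k' \<ge> 0 \<Longrightarrow> balanced D k' 0 half_plane"
proof -
  define f where "f z = D z * exp (- z\<^sup>2 / 2)" for z
  define w where "w k v = indicator {0<..} v * (v powr k * exp (- (1 * v\<^sup>2) / 2))" for k v :: real
  have S: "indicator half_plane p *\<^sub>R score D k 0 p = (case p of (z, v) \<Rightarrow> f z * w k v)" for p k
    by (cases p) (simp add: f_def w_def score_def half_plane_def indicator_def exp_add[symmetric] add_divide_distrib)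
  have iw: "integrable lborel (w k)" if "k \<ge> 0" for k
    unfolding w_def using that by (intro integrable_powr_gaussian) auto
  have wpos: "w k v > 0" if "v > 0" for k v using that by (simp add: w_def)
  have i: "integrable lborel (\<lambda>(z, v). f z * w k v)" and z: "(\<integral>(z, v). f z * w k v \<partial>lborel) = 0"
    using b unfolding balanced_def set_integrable_def set_lebesgue_integral_def S by auto
  \<comment> \<open>One section at a height v in (0, 1), where the weight is positive, already gives
    integrability of the z factor.\<close>
  have "AE v in lborel. integrable lborel (\<lambda>z. f z * w k v)"
    by (rule lborel_pair.AE_integrable_snd) (use i in \<open>simp only: lborel_prod\<close>)
  moreover have "\<not> (AE v in (lborel :: real measure). v \<notin> {0<..<1})"
  proof
    assume "AE v in (lborel :: real measure). v \<notin> {0<..<1}"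
    then have "{0<..<1::real} \<in> null_sets lborel"
      by (subst (asm) AE_iff_null_sets[symmetric]) auto
    then show False by (simp add: null_sets_def)
  qed
  ultimately obtain v where v: "v \<in> {0<..<1}" "integrable lborel (\<lambda>z. f z * w k v)"
    by (metis (mono_tags, lifting) eventually_mono)
  then have i_f': "integrable lborel f"
    using wpos[of v k] by simp
  then show "integrable lborel (\<lambda>z. D z * exp (- z\<^sup>2 / 2))"
    by (simp add: f_def[abs_def])
  have "(\<integral>v. w k v \<partial>lborel) > 0"
    by (rule integral_pos_if_pos_on_open[where U="{0<..}"])
      (use wpos iw[OF k] in \<open>auto simp: w_def[abs_def] intro!: exI[of _ 1]\<close>)
  moreover have "(\<integral>z. f z \<partial>lborel) * (\<integral>v. w k v \<partial>lborel) = 0"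
    using integral_lborel_product[OF i_f' iw[OF k]] z by simp
  ultimately have z: "(\<integral>z. f z \<partial>lborel) = 0" by simp
  assume k': "k' \<ge> 0"
  show "balanced D k' 0 half_plane"
    unfolding balanced_def set_integrable_def set_lebesgue_integral_def S
    using integral_lborel_product[OF i_f' iw[OF k']] integrable_lborel_product[OF i_f' iw[OF k']] z by simp
qed

end

text \<open>The mean of v^l under the weight is written as a power of v0, which exhibits the point
  where the deviation from the mean changes sign.\<close>

lemma powr_gaussian_mean_deviation:
  assumes c: "c > (0::real)" and k: "k \<ge> 0" and l: "l > 0"
  obtains v0 where "v0 > 0"
    "integrable lborel (\<lambda>v. indicator {0<..} v * ((v powr l - v0 powr l) * v powr k * exp (- (c * v\<^sup>2) / 2)))"
    "(\<integral>v. indicator {0<..} v * ((v powr l - v0 powr l) * v powr k * exp (- (c * v\<^sup>2) / 2)) \<partial>lborel) = 0"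
proof -
  define w where "w k v = indicator {0<..} v * (v powr k * exp (- (c * v\<^sup>2) / 2))" for k v :: real
  have iw: "integrable lborel (w k)" if "k \<ge> 0" for k
    unfolding w_def using c that by (intro integrable_powr_gaussian) auto
  have pos: "(\<integral>v. w k v \<partial>lborel) > 0" if "k \<ge> 0" for k
    by (rule integral_pos_if_pos_on_open[where U="{0<..}"])
      (use iw[OF that] in \<open>auto simp: w_def[abs_def] intro!: exI[of _ 1]\<close>)
  define m where "m = (\<integral>v. w (k + l) v \<partial>lborel) / (\<integral>v. w k v \<partial>lborel)"
  have m: "m > 0" unfolding m_def using pos[of "k + l"] pos[of k] k l by simp
  define v0 where "v0 = m powr (1 / l)"
  have v0: "v0 > 0" "v0 powr l = m" using m l by (auto simp: v0_def powr_powr)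
  have eq: "indicator {0<..} v * ((v powr l - v0 powr l) * v powr k * exp (- (c * v\<^sup>2) / 2))
      = w (k + l) v - m * w k v" for v
    by (auto simp: w_def indicator_def powr_add v0(2) algebra_simps)
  have i: "integrable lborel (w (k + l))" "integrable lborel (\<lambda>v. m * w k v)"
    using iw k l by auto
  show ?thesis
  proof (rule that[OF v0(1)])
    show "integrable lborel (\<lambda>v. indicator {0<..} v * ((v powr l - v0 powr l) * v powr k * exp (- (c * v\<^sup>2) / 2)))"
      unfolding eq using i by (rule Bochner_Integration.integrable_diff)
    show "(\<integral>v. indicator {0<..} v * ((v powr l - v0 powr l) * v powr k * exp (- (c * v\<^sup>2) / 2)) \<partial>lborel) = 0"
      unfolding eq using Bochner_Integration.integral_diff[OF i] pos[OF k] by (simp add: m_def)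
  qed
qed

section \<open>Comparison of powers of v, and the slope bound\<close>

context monotone_score
begin

text \<open>\<open>v powr l\<close> is compared with the value \<open>m\<close> for which \<open>v powr l - m\<close> has mean zero given \<open>z = 0\<close>. Since the
  likelihood ratio \<open>h z\<close> is monotone in \<open>v\<close> in the direction of the sign of \<open>z\<close>, the conditional mean of
  \<open>v powr l - m\<close> has the sign of \<open>z\<close>.\<close>

lemma score_higher_power_nonneg:
  assumes b: "balanced D k a (cone t)" and k: "k \<ge> 0" and l: "l > 0" and a: "a \<ge> 0"
    and iD: "integrable lborel (\<lambda>z. D z * exp (- z\<^sup>2 / 2))"
    and i: "set_integrable lborel (cone t) (score D (k + l) a)"
  shows "0 \<le> (LINT p:cone t|lborel. score D (k + l) a p)"
proof -
  define b where "b = t + a"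
  have b0: "b > 0" using balanced_cone_pos[OF b] by (simp add: b_def)
  define c where "c = 1 + a\<^sup>2"
  have c: "c > 0" by (simp add: c_def add_pos_nonneg)
  obtain v0 where v0: "v0 > 0"
    "integrable lborel (\<lambda>v. indicator {0<..} v * ((v powr l - v0 powr l) * v powr k * exp (- (c * v\<^sup>2) / 2)))"
    "(\<integral>v. indicator {0<..} v * ((v powr l - v0 powr l) * v powr k * exp (- (c * v\<^sup>2) / 2)) \<partial>lborel) = 0"
    using powr_gaussian_mean_deviation[OF c k l] .
  define \<phi> where "\<phi> v = indicator {0<..} v * ((v powr l - v0 powr l) * v powr k * exp (- (c * v\<^sup>2) / 2))" for v
  define m where "m = v0 powr l"
  \<comment> \<open>Ratio of the weight at z to the weight at z = 0, with the cone as a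
    cut-off.\<close>
  define h where "h z v = (if z < b * v then exp (a * z * v) else 0)" for z v
  define F where "F k = (\<lambda>(z, v). indicator (cone t) (z - a * v, v) * (D z * v powr k * exp (- ((z - a * v)\<^sup>2 + v\<^sup>2) / 2)))" for k
  have iF: "integrable lborel (F k)" "integrable lborel (F (k + l))"
    and eF: "(\<integral>p. F k p \<partial>lborel) = 0" "(\<integral>p. F (k + l) p \<partial>lborel) = (LINT p:cone t|lborel. score D (k + l) a p)"
    unfolding F_def using b score_sheared_integrable score_sheared_integral i by (auto simp: balanced_def)
  have FF: "F (k + l) (z, v) - m * F k (z, v) = D z * exp (- z\<^sup>2 / 2) * (\<phi> v * h z v)" for z v
  proof -
    have e: "- ((z - a * v)\<^sup>2 + v\<^sup>2) / 2 = - z\<^sup>2 / 2 + - (c * v\<^sup>2) / 2 + a * z * v"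
      by (simp add: c_def power2_eq_square algebra_simps add_divide_distrib diff_divide_distrib)
    have "z - a * v < v * t \<longleftrightarrow> z < b * v" by (auto simp: b_def algebra_simps)
    then show ?thesis
      unfolding F_def prod.case e \<phi>_def h_def m_def exp_add
      by (auto simp: cone_def indicator_def powr_add algebra_simps)
  qed
  \<comment> \<open>Where h does not vanish, z < b v0; as a >= 0, this bounds the
    exponential.\<close>
  have ih: "integrable lborel (\<lambda>z. D z * exp (- z\<^sup>2 / 2) * h z v0)"
  proof (rule Bochner_Integration.integrable_bound)
    define K where "K = exp (a * (b * v0) * v0)"
    show "integrable lborel (\<lambda>z. K * norm (D z * exp (- z\<^sup>2 / 2)))"
      using iD by (intro integrable_mult_right integrable_norm)
    have "h z v0 \<le> K \<and> 0 \<le> h z v0" for z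
      using a v0(1) b0 by (auto simp: h_def K_def intro!: mult_right_mono mult_left_mono)
    moreover have "K > 0" by (simp add: K_def)
    ultimately show "AE z in lborel. norm (D z * exp (- z\<^sup>2 / 2) * h z v0) \<le> norm (K * norm (D z * exp (- z\<^sup>2 / 2)))"
      by (intro always_eventually allI) (auto simp: abs_mult mult.commute[of K] intro!: mult_left_mono)
    show "(\<lambda>z. D z * exp (- z\<^sup>2 / 2) * h z v0) \<in> borel_measurable lborel"
      unfolding h_def by measurable
  qed
  have i\<phi>: "integrable lborel \<phi>" and z\<phi>: "(\<integral>v. \<phi> v \<partial>lborel) = 0"
    using v0 unfolding \<phi>_def by auto
  \<comment> \<open>Since phi has mean zero, subtracting h at v0 leaves the integral unchanged. The
    difference h z v - h z v0 has the sign of z (v - v0), phi that of v - v0 and D that of z, so the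
    product is nonnegative.\<close>
  define C where "C = (\<lambda>(z, v). D z * exp (- z\<^sup>2 / 2) * h z v0 * \<phi> v)"
  have C: "integrable lborel C" "(\<integral>p. C p \<partial>lborel) = 0"
    unfolding C_def using integrable_lborel_product[OF ih i\<phi>] integral_lborel_product[OF ih i\<phi>] z\<phi> by simp_all
  have sgn: "0 \<le> F (k + l) p - m * F k p - C p" for p
  proof -
    obtain z v where p: "p = (z, v)" by (cases p)
    have eq: "F (k + l) p - m * F k p - C p = exp (- z\<^sup>2 / 2) * (D z * (\<phi> v * (h z v - h z v0)))"
      unfolding p FF by (simp add: C_def algebra_simps)
    have sphi: "\<phi> v \<ge> 0" if "v \<ge> v0"
    proof -
      have "v powr l \<ge> v0 powr l" using that v0 l by (intro powr_mono2) auto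
      then show ?thesis by (simp add: \<phi>_def)
    qed
    have sphi': "\<phi> v \<le> 0" if "v \<le> v0"
    proof (cases "v > 0")
      case True
      then have "v powr l \<le> v0 powr l" using that v0 l by (intro powr_mono2) auto
      then show ?thesis by (simp add: \<phi>_def mult_nonpos_nonneg mult_nonneg_nonpos)
    qed (simp add: \<phi>_def)
    have v_pos: "\<phi> v = 0" if "v \<le> 0" using that by (simp add: \<phi>_def)
    consider "v \<le> 0" | "z = 0" "v > 0" | "z > 0" "v > 0" | "z < 0" "v > 0" by linarith
    then have "D z * (\<phi> v * (h z v - h z v0)) \<ge> 0"
    proof cases
      case 1 then show ?thesis using v_pos by simp
    next
      case 2 then show ?thesis using b0 v0 by (simp add: h_def)
    next
      case 3
      have hm: "h z x \<le> h z y" if "x \<le> y" "0 < x" for x y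
      proof -
        have "b * x \<le> b * y" using that b0 by simp
        moreover have "a * z * x \<le> a * z * y" using that a 3 by (intro mult_left_mono) auto
        ultimately show ?thesis by (auto simp: h_def)
      qed
      have "\<phi> v * (h z v - h z v0) \<ge> 0"
        using hm[of v v0] hm[of v0 v] sphi sphi' 3 v0 by (cases "v \<le> v0") (auto intro: mult_nonpos_nonpos mult_nonneg_nonneg)
      then show ?thesis using D_pos[OF 3(1)] by simp
    next
      case 4
      have hm: "h z y \<le> h z x" if "x \<le> y" "0 < x" for x y
      proof -
        have "z < b * x" "z < b * y" using that b0 4 by (meson less_trans less_le_trans mult_pos_pos)+
        moreover have "a * z * y \<le> a * z * x" using that a 4 by (intro mult_left_mono_neg) (auto simp: mult_nonneg_nonpos)
        ultimately show ?thesis by (auto simp: h_def)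
      qed
      have "\<phi> v * (h z v - h z v0) \<le> 0"
        using hm[of v v0] hm[of v0 v] sphi sphi' 4 v0 by (cases "v \<le> v0") (auto intro: mult_nonpos_nonneg mult_nonneg_nonpos)
      then show ?thesis using D_neg[OF 4(1)] by (simp add: mult_nonpos_nonpos)
    qed
    then show ?thesis unfolding eq by simp
  qed
  have "0 \<le> (\<integral>p. F (k + l) p - m * F k p - C p \<partial>lborel)"
    by (rule Bochner_Integration.integral_nonneg) (use sgn in auto)
  also have "\<dots> = (\<integral>p. F (k + l) p \<partial>lborel) - m * (\<integral>p. F k p \<partial>lborel) - (\<integral>p. C p \<partial>lborel)"
    using iF C by simp
  finally show ?thesis using eF C by simp
qed

text \<open>At a the score with the higher power has nonnegative integral. If a < a', its integral
  at a' would be positive. Its integrability at a follows from that at 0 and at a', because 0 <=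
  a.\<close>

lemma balanced_cone_power_antimono:
  assumes b: "balanced D k a (cone t)" and b': "balanced D (k + l) a' (cone t)"
    and h: "balanced D k 0 half_plane" and k: "k \<ge> 0" and l: "l > 0"
  shows "a' \<le> a"
proof (rule ccontr)
  assume "\<not> a' \<le> a"
  then have lt: "a < a'" by simp
  have a0: "a \<ge> 0" by (rule balanced_cone_ge[OF b h])
  have h': "balanced D (k + l) 0 half_plane"
    by (rule balanced_half_plane_factor(2)[OF h k]) (use k l in auto)
  have i0: "set_integrable lborel (cone t) (score D (k + l) 0)"
    by (rule set_integrable_subset[of lborel half_plane])
      (use h' cone_subset_half_plane in \<open>auto simp: balanced_def\<close>)
  have i': "set_integrable lborel (cone t) (score D (k + l) a')"
    using b' by (simp add: balanced_def)
  have i: "set_integrable lborel (cone t) (score D (k + l) a)"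
    by (rule score_integrable_between[OF a0 _ _ _ i0 i']) (use lt cone_subset_half_plane in auto)
  have "{(u, v). v > 0 \<and> - a' * v < u \<and> u < - a * v} \<subseteq> cone t"
  proof
    fix p :: "real \<times> real" assume "p \<in> {(u, v). v > 0 \<and> - a' * v < u \<and> u < - a * v}"
    then obtain u v where uv: "p = (u, v)" "v > 0" "u < - a * v" by auto
    have "v * (t + a) > 0" using balanced_cone_pos[OF b] uv by simp
    then show "p \<in> cone t" using uv by (simp add: cone_def algebra_simps)
  qed
  then have "(LINT p:cone t|lborel. score D (k + l) a p) < (LINT p:cone t|lborel. score D (k + l) a' p)"
    by (intro score_integral_strict_mono[OF lt cone_borel cone_subset_half_plane i i'])
  moreover have "0 \<le> (LINT p:cone t|lborel. score D (k + l) a p)"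
    by (rule score_higher_power_nonneg[OF b k l a0 balanced_half_plane_factor(1)[OF h k] i])
  ultimately show False using b' by (simp add: balanced_def)
qed

text \<open>The monotonicity of \<open>t + a\<close> relative to \<open>sqrt (1 + a\<^sup>2)\<close> and the tangent inequality for
  \<open>sqrt (1 + a\<^sup>2)\<close> give the slope bound \<open>(1 + a\<^sup>2) / (1 - a t)\<close>.\<close>

lemma balanced_cone_lipschitz:
  assumes t: "t1 \<le> t2" and b1: "balanced D k a1 (cone t1)" and b2: "balanced D k a2 (cone t2)"
    and k: "k \<ge> 0" and steep: "AE z in lborel. z > 0 \<longrightarrow> - D (- z) \<le> D z"
  shows "a1 - a2 \<le> 2 * (1 + a1\<^sup>2) * (t2 - t1)"
proof -
  have le: "a2 \<le> a1" by (rule balanced_cone_antimono[OF t b1 b2])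
  show ?thesis
  proof (cases "t1 = t2 \<or> a1 = a2")
    case True
    then show ?thesis
    proof
      assume "t1 = t2"
      then have "a1 \<le> a2" using balanced_cone_antimono[of t2 t1, OF _ b2 b1] by simp
      then show ?thesis using \<open>t1 = t2\<close> by simp
    qed (use t in \<open>auto intro!: mult_nonneg_nonneg add_nonneg_nonneg\<close>)
  next
    case False
    then have lt: "t1 < t2" "a2 < a1" using t le by auto
    define q1 q2 where "q1 = sqrt (1 + a1\<^sup>2)" and "q2 = sqrt (1 + a2\<^sup>2)"
    have q: "q1 > 0" "q2 > 0" "q1\<^sup>2 = 1 + a1\<^sup>2" "q2\<^sup>2 = 1 + a2\<^sup>2"
      by (auto simp: q1_def q2_def intro!: add_pos_nonneg add_nonneg_nonneg)
    have r: "(t1 + a1) / q1 \<le> (t2 + a2) / q2"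
      using balanced_cone_ratio_mono[OF lt(1) b1 b2 lt(2)] by (simp add: q1_def q2_def)
    have p1: "t1 + a1 > 0" by (rule balanced_cone_pos[OF b1])
    \<comment> \<open>Cauchy-Schwarz for (1, a1) and (1, a2).\<close>
    have "q1 * q2 \<ge> 1 + a1 * a2"
    proof (rule power2_le_imp_le)
      show "(1 + a1 * a2)\<^sup>2 \<le> (q1 * q2)\<^sup>2"
        using zero_le_power2[of "a1 - a2"] unfolding power_mult_distrib q
        by (simp add: power2_eq_square algebra_simps)
      show "0 \<le> q1 * q2" using q by simp
    qed
    then have tang: "q2 / q1 \<ge> 1 - (a1 - a2) * a1 / (1 + a1\<^sup>2)"
    proof -
      assume *: "q1 * q2 \<ge> 1 + a1 * a2"
      have "1 + a1 * a2 = q1\<^sup>2 - (a1 - a2) * a1"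
        unfolding q(3) by (simp add: power2_eq_square algebra_simps)
      then have "1 - (a1 - a2) * a1 / (1 + a1\<^sup>2) = (1 + a1 * a2) / q1\<^sup>2"
        using q(1) by (simp add: q(3)[symmetric] diff_divide_distrib)
      also have "\<dots> \<le> (q1 * q2) / q1\<^sup>2" using * by (intro divide_right_mono) auto
      also have "\<dots> = q2 / q1" using q(1) by (simp add: power2_eq_square)
      finally show ?thesis .
    qed
    have "t2 + a2 \<ge> (t1 + a1) * (q2 / q1)"
      using r q by (simp add: pos_le_divide_eq)
    moreover have "(t1 + a1) * (q2 / q1) \<ge> (t1 + a1) * (1 - (a1 - a2) * a1 / (1 + a1\<^sup>2))"
      using tang p1 by (intro mult_left_mono) auto
    ultimately have "t2 - t1 \<ge> (a1 - a2) - (t1 + a1) * ((a1 - a2) * a1 / (1 + a1\<^sup>2))"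
      by (simp add: algebra_simps)
    also have "(a1 - a2) - (t1 + a1) * ((a1 - a2) * a1 / (1 + a1\<^sup>2))
        = (a1 - a2) * ((1 + a1\<^sup>2) - (t1 + a1) * a1) / (1 + a1\<^sup>2)"
    proof -
      have "X - Y * (X * Z / Q) = X * (Q - Y * Z) / Q" if "Q \<noteq> 0" for X Y Z Q :: real
        using that by (simp add: field_simps)
      then show ?thesis using q(1) unfolding q(3)[symmetric] by simp
    qed
    also have "(1 + a1\<^sup>2) - (t1 + a1) * a1 = 1 - a1 * t1"
      by (simp add: power2_eq_square algebra_simps)
    finally have "(a1 - a2) * (1 - a1 * t1) \<le> (t2 - t1) * (1 + a1\<^sup>2)"
      using q by (simp add: pos_divide_le_eq add_pos_nonneg)
    \<comment> \<open>The bound a1 t1 < 1 / 2 turns the slope bound (1 + a^2) / (1 - a t) into the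
      constant 2 (1 + a1^2).\<close>
    moreover have "(a1 - a2) * (1 / 2) \<le> (a1 - a2) * (1 - a1 * t1)"
      using balanced_cone_product_lt[OF b1 k steep] lt by (intro mult_left_mono) auto
    ultimately have "(a1 - a2) * (1 / 2) \<le> (t2 - t1) * (1 + a1\<^sup>2)"
      by (rule order_trans[rotated])
    then have "2 * ((a1 - a2) * (1 / 2)) \<le> 2 * ((t2 - t1) * (1 + a1\<^sup>2))"
      by (intro mult_left_mono) auto
    also have "2 * ((t2 - t1) * (1 + a1\<^sup>2)) = 2 * (1 + a1\<^sup>2) * (t2 - t1)"
      by (simp add: algebra_simps)
    finally show ?thesis by simp
  qed
qed

end

section \<open>Loss, first order conditions and class C\<close>

text \<open>The bowl shape gives signs only where the loss is differentiable. Such a point exists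
  between z and 0, and monotonicity carries the sign from there to z.\<close>

lemma monotone_score_right_slope:
  assumes cv: "convex_on UNIV \<rho>" and bowl: "strictly_bowl_shaped \<rho>"
  shows "monotone_score (right_slope \<rho>)"
proof
  show "mono (right_slope \<rho>)" by (rule mono_right_slope[OF cv])
  note m = monoD[OF mono_right_slope[OF cv]]
  note c = convex_countable_not_differentiable[OF cv]
  show "right_slope \<rho> z < 0" if z: "z < 0" for z
  proof -
    obtain w where w: "z < w" "w < 0" "\<rho> differentiable (at w)"
      using open_minus_countable[OF c, of "{z<..<0}"] z by auto
    have "right_slope \<rho> z \<le> right_slope \<rho> w" using w by (intro m) auto
    also have "\<dots> < 0" using w bowl right_slope_eq_deriv[OF cv w(3)] by (simp add: strictly_bowl_shaped_def)
    finally show ?thesis .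
  qed
  show "right_slope \<rho> z > 0" if z: "z > 0" for z
  proof -
    obtain w where w: "0 < w" "w < z" "\<rho> differentiable (at w)"
      using open_minus_countable[OF c, of "{0<..<z}"] z by auto
    have "0 < right_slope \<rho> w" using w bowl right_slope_eq_deriv[OF cv w(3)] by (simp add: strictly_bowl_shaped_def)
    also have "\<dots> \<le> right_slope \<rho> z" using w by (intro m) auto
    finally show ?thesis .
  qed
qed

lemma AE_deriv_eq_right_slope:
  assumes cv: "convex_on UNIV \<rho>"
  shows "AE p in lborel. deriv \<rho> (fst p + a * snd p) = right_slope \<rho> (fst p + a * snd p)"
  using AE_lborel_line_notin_countable[OF convex_countable_not_differentiable[OF cv], of a]
  by (rule eventually_mono) (simp add: right_slope_eq_deriv[OF cv])

lemma AE_right_slope_steeper: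
  assumes cv: "convex_on UNIV \<rho>" and st: "steeper_on_right \<rho>"
  shows "AE z in lborel. z > 0 \<longrightarrow> - right_slope \<rho> (- z) \<le> right_slope \<rho> z"
proof -
  let ?N = "{x. \<not> \<rho> differentiable (at x)}"
  have c: "countable ?N" by (rule convex_countable_not_differentiable[OF cv])
  have "AE z in lborel. z \<notin> ?N \<union> uminus ` ?N"
    by (intro AE_not_in countable_imp_null_set_lborel countable_Un countable_image c)
  then show ?thesis
  proof (rule eventually_mono, intro impI)
    fix z :: real assume z: "z \<notin> ?N \<union> uminus ` ?N" "z > 0"
    then have d: "\<rho> differentiable (at z)" "\<rho> differentiable (at (- z))"
      by (auto simp: image_iff)
    then have "\<bar>deriv \<rho> (- z)\<bar> \<le> deriv \<rho> z"
      using st z by (simp add: steeper_on_right_def)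
    then show "- right_slope \<rho> (- z) \<le> right_slope \<rho> z"
      using d by (simp add: right_slope_eq_deriv[OF cv])
  qed
qed

section \<open>First order conditions as balanced scores\<close>

definition radial_constant :: "nat \<Rightarrow> real" where
  "radial_constant n = 2 / (sqrt (2 * pi) * 2 powr (real n / 2) * Gamma (real n / 2))"

lemma radial_constant_pos: "n \<ge> 1 \<Longrightarrow> radial_constant n > 0"
  unfolding radial_constant_def by (intro divide_pos_pos mult_pos_pos Gamma_real_pos) auto

lemma radial_density_eq: "radial_density n t = radial_constant n * exp (- t / 2)"
  by (simp add: radial_density_def radial_constant_def)

text \<open>Bridge from conditions stated with \<open>deriv\<close>, which agrees with the right
  slope almost everywhere only, and with the normalising constant.\<close>

lemma (in monotone_score) balancedI_AE:
  assumes i: "set_integrable lborel A h" and z: "(LINT p:A|lborel. h p) = 0"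
    and K: "K \<noteq> 0" and [measurable]: "A \<in> sets borel"
    and ae: "AE p in lborel. p \<in> A \<longrightarrow> h p = K * score D k a p"
  shows "balanced D k a A"
proof -
  have ae': "AE p in lborel. indicator A p *\<^sub>R h p = K * (indicator A p *\<^sub>R score D k a p)"
    using ae by (rule eventually_mono) (auto simp: indicator_def)
  have i': "integrable lborel (\<lambda>p. indicator A p *\<^sub>R h p)"
    using i by (simp add: set_integrable_def)
  have "integrable lborel (\<lambda>p. K * (indicator A p *\<^sub>R score D k a p))"
    by (rule integrable_cong_AE_imp[OF i' _ ae']) measurable
  moreover have "(\<integral>p. K * (indicator A p *\<^sub>R score D k a p) \<partial>lborel) = 0"
    using integral_cong_AE[OF borel_measurable_integrable[OF i'] _ ae'] z
    by (simp add: set_lebesgue_integral_def)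
  ultimately show ?thesis
    using K by (simp add: balanced_def set_integrable_def set_lebesgue_integral_def)
qed

lemma bayes_correction_balanced:
  assumes n: "n \<ge> 1" and cv: "convex_on UNIV \<rho>" and bowl: "strictly_bowl_shaped \<rho>"
    and bc: "bayes_correction n \<rho> c0 l g"
  shows "balanced (right_slope \<rho>) (real n + l) (c0 + g y) (cone y)"
proof -
  interpret monotone_score "right_slope \<rho>" by (rule monotone_score_right_slope[OF cv bowl])
  let ?h = "\<lambda>(u, v). deriv \<rho> (u + c0 * v + g y * v) * v powr (real n + l) * radial_density n (u\<^sup>2 + v\<^sup>2)"
  have h: "set_integrable lborel (cone y) ?h" "(LINT z:cone y|lborel. ?h z) = 0"
    using bc by (auto simp: bayes_correction_def Let_def)
  show ?thesis
  proof (rule balancedI_AE[OF h, of "radial_constant n"])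
    show "radial_constant n \<noteq> 0" using radial_constant_pos[OF n] by simp
    show "AE p in lborel. p \<in> cone y \<longrightarrow> ?h p = radial_constant n * score (right_slope \<rho>) (real n + l) (c0 + g y) p"
      using AE_deriv_eq_right_slope[OF cv, of "c0 + g y"]
      by (rule eventually_mono) (auto simp: score_def radial_density_eq algebra_simps)
  qed measurable
qed

lemma joint_density_standard:
  "joint_density n 0 1 u v = (if v > 0 then v ^ (n - 1) * radial_density n (u\<^sup>2 + v\<^sup>2) else 0)"
  by (simp add: joint_density_def)

lemma joint_density_measurable [measurable]:
  "(\<lambda>(x, s). joint_density n \<mu> \<sigma> x s) \<in> borel_measurable borel"
  unfolding borel_prod[symmetric] joint_density_def radial_density_eq by measurable

lemma joint_density_nonneg: "n \<ge> 1 \<Longrightarrow> \<sigma> > 0 \<Longrightarrow> joint_density n \<mu> \<sigma> x s \<ge> 0"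
  using radial_constant_pos[of n] by (auto simp: joint_density_def radial_density_eq)

lemma mre_constant_balanced:
  assumes n: "n \<ge> 1" and cv: "convex_on UNIV \<rho>" and bowl: "strictly_bowl_shaped \<rho>"
    and mre: "mre_constant n \<rho> c0"
  shows "balanced (right_slope \<rho>) (real n) c0 half_plane"
proof -
  interpret monotone_score "right_slope \<rho>" by (rule monotone_score_right_slope[OF cv bowl])
  let ?f = "\<lambda>(x, s). s * deriv \<rho> (x + c0 * s)"
  let ?j = "\<lambda>(x, s). joint_density n 0 1 x s"
  have jl: "joint_law n 0 1 = density lborel (\<lambda>p. ennreal (?j p))"
    by (simp add: joint_law_def split_beta')
  have i: "integrable (joint_law n 0 1) ?f" and z: "(\<integral>p. ?f p \<partial>joint_law n 0 1) = 0"
    using mre by (auto simp: mre_constant_def)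
  have m: "?f \<in> borel_measurable lborel"
    using borel_measurable_integrable[OF i] by (simp add: joint_law_def)
  have j: "?j \<in> borel_measurable lborel" "AE p in lborel. 0 \<le> ?j p"
    using joint_density_nonneg[OF n, of 1] by (auto intro!: AE_I2)
  have i': "integrable lborel (\<lambda>p. ?j p * ?f p)" and z': "(\<integral>p. ?j p * ?f p \<partial>lborel) = 0"
    using i z integrable_real_density[OF j m] integral_real_density[OF j m] unfolding jl by simp_all
  have e: "?j p * ?f p = indicator half_plane p *\<^sub>R (?j p * ?f p)" for p
    by (cases p) (auto simp: half_plane_def joint_density_standard)
  show ?thesis
  proof (rule balancedI_AE[where h="\<lambda>p. ?j p * ?f p" and K="radial_constant n"])
    show "set_integrable lborel half_plane (\<lambda>p. ?j p * ?f p)"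
      unfolding set_integrable_def e[symmetric] by (rule i')
    show "(LINT p:half_plane|lborel. ?j p * ?f p) = 0"
      unfolding set_lebesgue_integral_def e[symmetric] by (rule z')
    show "radial_constant n \<noteq> 0" using radial_constant_pos[OF n] by simp
    show "AE p in lborel. p \<in> half_plane \<longrightarrow> ?j p * ?f p = radial_constant n * score (right_slope \<rho>) (real n) c0 p"
      using AE_deriv_eq_right_slope[OF cv, of c0]
    proof (rule eventually_mono, intro impI)
      fix p assume d: "deriv \<rho> (fst p + c0 * snd p) = right_slope \<rho> (fst p + c0 * snd p)" and p: "p \<in> half_plane"
      obtain u v where uv: "p = (u, v)" by (cases p)
      have v: "v > 0" using p by (simp add: uv half_plane_def)
      have "v powr real n = v ^ (n - 1) * v"
        using v n by (simp add: powr_realpow power_Suc2[symmetric] del: power_Suc)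
      then show "?j p * ?f p = radial_constant n * score (right_slope \<rho>) (real n) c0 p"
        using d v by (simp add: uv joint_density_standard score_def radial_density_eq)
    qed
  qed measurable
qed

section \<open>Bayes corrections belong to class C\<close>

lemma absolutely_continuous_fun_on_lipschitz:
  assumes L: "\<And>x y. A \<le> x \<Longrightarrow> x \<le> y \<Longrightarrow> y \<le> B \<Longrightarrow> \<bar>g y - g x\<bar> \<le> L * (y - x)"
  shows "absolutely_continuous_fun_on {A..B} g"
  unfolding absolutely_continuous_fun_on_def
proof (intro allI impI)
  fix \<epsilon> :: real assume e: "\<epsilon> > 0"
  show "\<exists>\<eta>>0. \<forall>(m::nat) a b.
        (\<forall>i<m. a i \<in> {A..B} \<and> b i \<in> {A..B} \<and> a i \<le> b i) \<and>
        (\<forall>i<m. \<forall>j<m. i \<noteq> j \<longrightarrow> {a i<..<b i} \<inter> {a j<..<b j} = {}) \<and>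
        (\<Sum>i<m. b i - a i) < \<eta>
        \<longrightarrow> (\<Sum>i<m. \<bar>g (b i) - g (a i)\<bar>) < \<epsilon>"
  proof (intro exI[of _ "\<epsilon> / (\<bar>L\<bar> + 1)"] conjI allI impI)
    show "\<epsilon> / (\<bar>L\<bar> + 1) > 0" using e by simp
    fix m :: nat and a b :: "nat \<Rightarrow> real"
    assume h: "(\<forall>i<m. a i \<in> {A..B} \<and> b i \<in> {A..B} \<and> a i \<le> b i) \<and>
        (\<forall>i<m. \<forall>j<m. i \<noteq> j \<longrightarrow> {a i<..<b i} \<inter> {a j<..<b j} = {}) \<and>
        (\<Sum>i<m. b i - a i) < \<epsilon> / (\<bar>L\<bar> + 1)"
    have "(\<Sum>i<m. \<bar>g (b i) - g (a i)\<bar>) \<le> (\<Sum>i<m. (\<bar>L\<bar> + 1) * (b i - a i))"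
    proof (rule sum_mono)
      fix i assume "i \<in> {..<m}"
      then have i: "A \<le> a i" "a i \<le> b i" "b i \<le> B" using h by auto
      have "\<bar>g (b i) - g (a i)\<bar> \<le> L * (b i - a i)" by (rule L[OF i])
      also have "\<dots> \<le> (\<bar>L\<bar> + 1) * (b i - a i)" using i by (intro mult_right_mono) auto
      finally show "\<bar>g (b i) - g (a i)\<bar> \<le> (\<bar>L\<bar> + 1) * (b i - a i)" .
    qed
    also have "\<dots> = (\<bar>L\<bar> + 1) * (\<Sum>i<m. b i - a i)" by (simp add: sum_distrib_left)
    also have "\<dots> < (\<bar>L\<bar> + 1) * (\<epsilon> / (\<bar>L\<bar> + 1))" using h by (intro mult_strict_left_mono) auto
    also have "\<dots> = \<epsilon>" by simp
    finally show "(\<Sum>i<m. \<bar>g (b i) - g (a i)\<bar>) < \<epsilon>" .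
  qed
qed

lemma absolutely_continuous_fun_on_imp_isCont:
  assumes "absolutely_continuous_fun g"
  shows "isCont g x"
proof -
  have ac: "absolutely_continuous_fun_on {x - 1..x + 1} g"
    using assms by (simp add: absolutely_continuous_fun_def)
  show ?thesis
    unfolding continuous_at_real_range real_norm_def
  proof (intro allI impI)
    fix e :: real assume "e > 0"
    with ac have "\<exists>d>0. \<forall>(m::nat) a b.
        (\<forall>i<m. a i \<in> {x - 1..x + 1} \<and> b i \<in> {x - 1..x + 1} \<and> a i \<le> b i) \<and>
        (\<forall>i<m. \<forall>j<m. i \<noteq> j \<longrightarrow> {a i<..<b i} \<inter> {a j<..<b j} = {}) \<and>
        (\<Sum>i<m. b i - a i) < d
        \<longrightarrow> (\<Sum>i<m. \<bar>g (b i) - g (a i)\<bar>) < e" (is "\<exists>d>0. ?P d")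
      unfolding absolutely_continuous_fun_on_def by (elim allE impE)
    then obtain d where d: "d > 0" and D: "?P d" by (elim exE conjE)
    show "\<exists>d>0. \<forall>x'. \<bar>x' - x\<bar> < d \<longrightarrow> \<bar>g x' - g x\<bar> < e"
    proof (intro exI[of _ "min d 1"] conjI allI impI)
      fix y assume y: "\<bar>y - x\<bar> < min d 1"
      have "(\<Sum>i<Suc 0. \<bar>g (max x y) - g (min x y)\<bar>) < e"
        by (rule D[THEN spec, THEN spec, THEN spec, THEN mp, of "Suc 0" "\<lambda>_. min x y" "\<lambda>_. max x y"]) (use y in auto)
      then show "\<bar>g y - g x\<bar> < e" by (auto simp: max_def min_def split: if_splits)
    qed (use d in auto)
  qed
qed

text \<open>The balance on the half plane bounds c0 + g from below by c0, and monotonicity bounds it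
  above on [A, B] by its value at A. So the slope bound is uniform on [A, B]; balance on the half
  plane also gives the limit.\<close>

lemma class_C_bayes_correction:
  assumes n: "n \<ge> 1" and l: "l \<ge> 0" and cv: "convex_on UNIV \<rho>" and bowl: "strictly_bowl_shaped \<rho>"
    and st: "steeper_on_right \<rho>" and bc: "bayes_correction n \<rho> c0 l g"
    and full: "balanced (right_slope \<rho>) (real n + l) c0 half_plane"
  shows "class_C_correction g"
proof -
  interpret monotone_score "right_slope \<rho>" by (rule monotone_score_right_slope[OF cv bowl])
  note b = bayes_correction_balanced[OF n cv bowl bc]
  have anti: "g y \<le> g x" if "x \<le> y" for x y
    using balanced_cone_antimono[OF that b b] by simp
  have "absolutely_continuous_fun_on {A..B} g" for A B
  proof (rule absolutely_continuous_fun_on_lipschitz)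
    fix x y assume xy: "A \<le> x" "x \<le> y" "y \<le> B"
    have "c0 \<le> c0 + g x" using balanced_cone_ge[OF b full] by simp
    moreover have "c0 + g x \<le> c0 + g A" using anti xy by simp
    ultimately have "\<bar>c0 + g x\<bar> \<le> \<bar>c0\<bar> + \<bar>c0 + g A\<bar>" by linarith
    then have "(c0 + g x)\<^sup>2 \<le> (\<bar>c0\<bar> + \<bar>c0 + g A\<bar>)\<^sup>2"
      by (metis abs_ge_zero power2_abs power_mono)
    have "\<bar>g y - g x\<bar> = (c0 + g x) - (c0 + g y)" using anti[OF xy(2)] by simp
    also have "\<dots> \<le> 2 * (1 + (c0 + g x)\<^sup>2) * (y - x)"
      by (rule balanced_cone_lipschitz[OF xy(2) b b _ AE_right_slope_steeper[OF cv st]]) (use l in simp)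
    also have "\<dots> \<le> 2 * (1 + (\<bar>c0\<bar> + \<bar>c0 + g A\<bar>)\<^sup>2) * (y - x)"
      using \<open>(c0 + g x)\<^sup>2 \<le> _\<close> xy by (intro mult_right_mono) auto
    finally show "\<bar>g y - g x\<bar> \<le> 2 * (1 + (\<bar>c0\<bar> + \<bar>c0 + g A\<bar>)\<^sup>2) * (y - x)" .
  qed
  moreover have "antimono g" using anti by (intro antimonoI)
  moreover have lim: "(g \<longlongrightarrow> 0) at_top"
  proof -
    have "((\<lambda>y. c0 + g y) \<longlongrightarrow> c0) at_top"
      by (rule balanced_limit[OF b full])
    from tendsto_diff[OF this tendsto_const[of c0]] show ?thesis by simp
  qed
  moreover have "\<not> (\<exists>k. \<forall>t. g t = k)"
  proof
    assume "\<exists>k. \<forall>t. g t = k"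
    then obtain k where k: "\<And>t. g t = k" by blast
    \<comment> \<open>A constant correction violates t + a > 0 at t = - (c0 + k).\<close>
    then have "- (c0 + k) + (c0 + k) > 0" using balanced_cone_pos[OF b[of "- (c0 + k)"]] by simp
    then show False by simp
  qed
  ultimately show ?thesis
    by (simp add: class_C_correction_def absolutely_continuous_fun_def)
qed

section \<open>Raising an estimator in steps\<close>

text \<open>The risk in u = (x - mu) / sigma and v = s / sigma. The parameters enter only through nu
  = mu / sigma, and X / S becomes (nu + u) / v.\<close>

definition normalized_risk :: "nat \<Rightarrow> (real \<Rightarrow> real) \<Rightarrow> real \<Rightarrow> real \<Rightarrow> (real \<Rightarrow> real) \<Rightarrow> ennreal" where
  "normalized_risk n \<rho> c \<nu> h =
     (\<integral>\<^sup>+(u, v). ennreal (\<rho> (u + c * v + h ((\<nu> + u) / v) * v) * joint_density n 0 1 u v) \<partial>lborel)"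

lemma loss_shifted_measurable:
  assumes [measurable]: "\<rho> \<in> borel_measurable borel" "h \<in> borel_measurable borel"
  shows "(\<lambda>(u, v). \<rho> (u + c * v + h ((\<nu> + u) / v) * v) * joint_density n 0 1 u v) \<in> borel_measurable borel"
  unfolding borel_prod[symmetric] joint_density_def radial_density_eq by measurable

lemma joint_density_rescale:
  assumes "n \<ge> 1" "\<sigma> > 0"
  shows "\<sigma>\<^sup>2 * joint_density n \<mu> \<sigma> (\<mu> + \<sigma> * u) (\<sigma> * v) = joint_density n 0 1 u v"
proof -
  obtain m where m: "n = Suc m" using assms(1) by (cases n) auto
  have "((\<mu> + \<sigma> * u - \<mu>)\<^sup>2 + (\<sigma> * v)\<^sup>2) / \<sigma>\<^sup>2 = u\<^sup>2 + v\<^sup>2"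
    using assms by (simp add: power_mult_distrib distrib_left[symmetric])
  then show ?thesis
    using assms by (simp add: joint_density_def m power_mult_distrib zero_less_mult_iff power2_eq_square)
qed

lemma risk_shifted_estimator:
  assumes n: "n \<ge> 1" and \<sigma>: "\<sigma> > 0" and \<rho>0: "\<And>t. \<rho> t \<ge> 0"
    and m[measurable]: "\<rho> \<in> borel_measurable borel" "h \<in> borel_measurable borel"
  shows "risk n \<rho> \<mu> \<sigma> (shifted_estimator c h) = normalized_risk n \<rho> c (\<mu> / \<sigma>) h"
proof -
  let ?\<delta> = "shifted_estimator c h"
  let ?j = "\<lambda>(x, s). ennreal (joint_density n \<mu> \<sigma> x s)"
  let ?l = "\<lambda>(x, s). ennreal (\<rho> ((?\<delta> x s - \<mu>) / \<sigma>))"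
  let ?T = "\<lambda>p. (\<mu>, 0) + \<sigma> *\<^sub>R (p :: real \<times> real)"
  have [measurable]: "?j \<in> borel_measurable borel"
    using measurable_compose[OF joint_density_measurable[of n \<mu> \<sigma>] measurable_ennreal] by (simp add: split_beta')
  have [measurable]: "?l \<in> borel_measurable borel"
    unfolding borel_prod[symmetric] shifted_estimator_def by measurable
  have "risk n \<rho> \<mu> \<sigma> ?\<delta> = (\<integral>\<^sup>+p. ?l p \<partial>density lborel ?j)"
    by (simp add: risk_def joint_law_def)
  also have "\<dots> = (\<integral>\<^sup>+p. ?j p * ?l p \<partial>lborel)"
    by (rule nn_integral_density) simp_all
  also have "\<dots> = ennreal \<bar>\<sigma>\<^sup>2\<bar> * (\<integral>\<^sup>+p. ?j (?T p) * ?l (?T p) \<partial>lborel)"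
    by (rule nn_integral_lborel_transform[where F="\<lambda>p. ?j p * ?l p"])
      (use lborel_affine[of \<sigma> "(\<mu>, 0) :: real \<times> real"] \<sigma> in \<open>simp_all add: power2_eq_square\<close>)
  also have "\<dots> = (\<integral>\<^sup>+p. ennreal \<bar>\<sigma>\<^sup>2\<bar> * (?j (?T p) * ?l (?T p)) \<partial>lborel)"
    by (rule nn_integral_cmult[symmetric]) measurable
  also have "\<dots> = normalized_risk n \<rho> c (\<mu> / \<sigma>) h"
    unfolding normalized_risk_def
  proof (rule nn_integral_cong)
    fix p :: "real \<times> real"
    obtain u v where p: "p = (u, v)" by (cases p)
    have "(?\<delta> (\<mu> + \<sigma> * u) (\<sigma> * v) - \<mu>) / \<sigma> = u + c * v + h ((\<mu> / \<sigma> + u) / v) * v"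
    proof -
      have "(\<mu> + \<sigma> * u) / (\<sigma> * v) = (\<mu> / \<sigma> + u) / v"
        using \<sigma> by (cases "v = 0") (simp_all add: field_simps)
      then show ?thesis using \<sigma> by (simp add: shifted_estimator_def field_simps)
    qed
    moreover have "ennreal \<bar>\<sigma>\<^sup>2\<bar> * (ennreal (joint_density n \<mu> \<sigma> (\<mu> + \<sigma> * u) (\<sigma> * v)) * ennreal L)
        = ennreal (L * joint_density n 0 1 u v)" if "L \<ge> 0" for L
      unfolding joint_density_rescale[OF n \<sigma>, of \<mu> u v, symmetric]
      using joint_density_nonneg[OF n \<sigma>] that
      by (simp add: ennreal_mult[symmetric] mult_ac)
    ultimately show "ennreal \<bar>\<sigma>\<^sup>2\<bar> * (?j (?T p) * ?l (?T p)) =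
       (case p of (u, v) \<Rightarrow> ennreal (\<rho> (u + c * v + h ((\<mu> / \<sigma> + u) / v) * v) * joint_density n 0 1 u v))"
      using \<rho>0 by (simp add: p)
  qed
  finally show ?thesis .
qed

text \<open>Convexity bounds the increase of the loss by the subgradient at the new value, which avoids
  differentiating under the integral.\<close>

lemma normalized_risk_raise:
  assumes n: "n \<ge> 1" and cv: "convex_on UNIV \<rho>" and bowl: "strictly_bowl_shaped \<rho>"
    and m[measurable]: "\<rho> \<in> borel_measurable borel" "h \<in> borel_measurable borel"
    and bal: "balanced (right_slope \<rho>) (real n) a (cone \<tau>)" and at: "a * \<tau> < 1 / 2" and \<nu>: "\<nu> \<ge> 0"
    and h: "\<And>y. y < \<tau> \<Longrightarrow> h y = \<gamma>0" and \<gamma>: "\<gamma>0 \<le> \<gamma>" "c + \<gamma> \<le> a"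
    and fin: "normalized_risk n \<rho> c \<nu> h < \<infinity>"
  shows "normalized_risk n \<rho> c \<nu> (\<lambda>y. if y < \<tau> then \<gamma> else h y) \<le> normalized_risk n \<rho> c \<nu> h"
proof -
  interpret monotone_score "right_slope \<rho>" by (rule monotone_score_right_slope[OF cv bowl])
  let ?D = "right_slope \<rho>"
  let ?h' = "\<lambda>y. if y < \<tau> then \<gamma> else h y"
  have \<rho>0: "\<rho> t \<ge> 0" for t using bowl by (simp add: strictly_bowl_shaped_def)
  have j0: "joint_density n 0 1 u v \<ge> 0" for u v by (rule joint_density_nonneg[OF n]) simp
  define A where "A = {(u, v). v > 0 \<and> u < v * \<tau> - \<nu>}"
  define L where "L h = (\<lambda>(u, v). \<rho> (u + c * v + h ((\<nu> + u) / v) * v) * joint_density n 0 1 u v)" for h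
  \<comment> \<open>Bound for the increase of the loss: the subgradient at the new value is at most
    the right slope at u + a v. The set A is where (nu + u) / v < tau and v > 0.\<close>
  define Q where "Q p = (\<gamma> - \<gamma>0) * radial_constant n * (indicator A p *\<^sub>R score ?D (real n) a p)" for p
  have nr: "normalized_risk n \<rho> c \<nu> h = (\<integral>\<^sup>+p. ennreal (L h p) \<partial>lborel)" for h
    by (simp add: normalized_risk_def L_def split_beta')
  have L0: "L h p \<ge> 0" for h p using \<rho>0 j0 by (simp add: L_def split_beta')
  have Lm: "L h \<in> borel_measurable lborel"
    unfolding L_def using loss_shifted_measurable[OF m] by simp
  have iL: "integrable lborel (L h)"
    by (rule integrableI_nonneg[OF Lm]) (use L0 fin in \<open>auto simp: nr\<close>)
  have A_m: "A \<in> sets borel"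
  proof -
    have "A = {p. 0 < snd p} \<inter> {p. fst p < snd p * \<tau> - \<nu>}" by (auto simp: A_def)
    then show ?thesis by (auto intro!: borel_open open_Int open_Collect_less continuous_intros)
  qed
  have sub: "A \<subseteq> cone \<tau>" using \<nu> by (auto simp: A_def cone_def)
  have iA: "set_integrable lborel A (score ?D (real n) a)"
    by (rule set_integrable_subset[of lborel "cone \<tau>"]) (use bal A_m sub in \<open>auto simp: balanced_def\<close>)
  have iQ: "integrable lborel Q"
    unfolding Q_def using iA by (intro integrable_mult_right) (simp add: set_integrable_def)
  have "(LINT p:A|lborel. score ?D (real n) a p) \<le> 0"
    unfolding A_def by (rule balanced_cone_shift_nonpos[OF bal _ at \<nu>]) simp
  then have Q0: "(\<integral>p. Q p \<partial>lborel) \<le> 0"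
    unfolding Q_def using \<gamma> radial_constant_pos[OF n]
    by (simp add: set_lebesgue_integral_def mult_nonneg_nonpos)
  have le: "L ?h' p \<le> L h p + Q p" for p
  proof -
    obtain u v where p: "p = (u, v)" by (cases p)
    show ?thesis
    proof (cases "v > 0 \<and> (\<nu> + u) / v < \<tau>")
      case True
      then have v: "v > 0" and y: "(\<nu> + u) / v < \<tau>" by auto
      have pA: "p \<in> A" using v y by (simp add: A_def p pos_divide_less_eq algebra_simps)
      have "\<rho> (u + c * v + \<gamma>0 * v) \<ge> \<rho> (u + c * v + \<gamma> * v) + ?D (u + c * v + \<gamma> * v) * ((u + c * v + \<gamma>0 * v) - (u + c * v + \<gamma> * v))"
        by (rule right_slope_subgradient[OF cv])
      then have "\<rho> (u + c * v + \<gamma> * v) \<le> \<rho> (u + c * v + \<gamma>0 * v) + ?D (u + c * v + \<gamma> * v) * ((\<gamma> - \<gamma>0) * v)"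
        by (simp add: algebra_simps)
      also have "?D (u + c * v + \<gamma> * v) * ((\<gamma> - \<gamma>0) * v) \<le> ?D (u + a * v) * ((\<gamma> - \<gamma>0) * v)"
      proof (rule mult_right_mono)
        have "(c + \<gamma>) * v \<le> a * v" using \<gamma> v by (intro mult_right_mono) auto
        then show "?D (u + c * v + \<gamma> * v) \<le> ?D (u + a * v)"
          by (intro monoD[OF mono_D]) (simp add: algebra_simps)
      qed (use \<gamma> v in simp)
      finally have "\<rho> (u + c * v + \<gamma> * v) * joint_density n 0 1 u v
          \<le> (\<rho> (u + c * v + \<gamma>0 * v) + ?D (u + a * v) * ((\<gamma> - \<gamma>0) * v)) * joint_density n 0 1 u v"
        using j0 by (intro mult_right_mono) auto
      moreover have "v powr real n = v * v ^ (n - 1)"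
        using v n by (simp add: powr_realpow power_Suc[symmetric] del: power_Suc)
      ultimately show ?thesis
        using v y pA by (simp add: L_def Q_def p h score_def joint_density_standard radial_density_eq algebra_simps)
    next
      case False
      show ?thesis
      proof (cases "v > 0")
        case True
        then have "p \<notin> A" using False by (simp add: A_def p pos_divide_less_eq algebra_simps)
        then show ?thesis using False True by (simp add: L_def Q_def p)
      next
        case False
        then show ?thesis by (simp add: L_def Q_def p A_def joint_density_standard)
      qed
    qed
  qed
  have "normalized_risk n \<rho> c \<nu> ?h' \<le> (\<integral>\<^sup>+p. ennreal (L h p + Q p) \<partial>lborel)"
    unfolding nr by (intro nn_integral_mono ennreal_leI le)
  also have "\<dots> = ennreal (\<integral>p. L h p + Q p \<partial>lborel)"
  proof (rule nn_integral_eq_integral)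
    show "integrable lborel (\<lambda>p. L h p + Q p)" using iL iQ by (rule Bochner_Integration.integrable_add)
    show "AE p in lborel. 0 \<le> L h p + Q p" using le L0 by (intro always_eventually allI) (meson order_trans)
  qed
  also have "(\<integral>p. L h p + Q p \<partial>lborel) = (\<integral>p. L h p \<partial>lborel) + (\<integral>p. Q p \<partial>lborel)"
    using iL iQ by (rule Bochner_Integration.integral_add)
  also have "ennreal \<dots> \<le> ennreal (\<integral>p. L h p \<partial>lborel)"
    using Q0 by (intro ennreal_leI) simp
  also have "\<dots> = normalized_risk n \<rho> c \<nu> h"
    unfolding nr using L0 by (intro nn_integral_eq_integral[symmetric] iL) auto
  finally show ?thesis .
qed

section \<open>Staircase approximation from the right\<close>

definition grid :: "nat \<Rightarrow> nat \<Rightarrow> real" where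
  "grid N j = real N - real j / real N"

text \<open>Each stage resets the whole half line left of a grid point, so the next stage again
  finds a constant there. The value is taken at the right end of a step; as g decreases, the stairs
  stay below g on y < N.\<close>

primrec stair :: "(real \<Rightarrow> real) \<Rightarrow> nat \<Rightarrow> nat \<Rightarrow> real \<Rightarrow> real" where
  "stair g N 0 = (\<lambda>y. 0)"
| "stair g N (Suc j) = (\<lambda>y. if y < grid N j then g (grid N j) else stair g N j y)"

lemma stair_measurable [measurable]: "stair g N j \<in> borel_measurable borel"
  by (induction j) simp_all

text \<open>The alternative i = j - 1 is the leftmost piece, which has no lower end.\<close>

lemma stair_value:
  assumes N: "N > 0"
  shows "(N \<le> y \<and> stair g N j y = 0) \<or> j = 0 \<or>
    (\<exists>i<j. y < grid N i \<and> (i = j - 1 \<or> grid N (Suc i) \<le> y) \<and> stair g N j y = g (grid N i))"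
proof (induction j)
  case (Suc j)
  show ?case
  proof (cases "y < grid N j")
    case True
    then show ?thesis by auto
  next
    case False
    then consider "j = 0" | "N \<le> y" "stair g N j y = 0" |
      i where "i < j" "y < grid N i" "i = j - 1 \<or> grid N (Suc i) \<le> y" "stair g N j y = g (grid N i)"
      using Suc by blast
    then show ?thesis
    proof cases
      case 1 then show ?thesis using False by (simp add: grid_def)
    next
      case 2 then show ?thesis using False by simp
    next
      case 3
      then have "grid N (Suc i) \<le> y" using False by (cases "i = j - 1") auto
      then show ?thesis using 3 False by (intro disjI2 exI[of _ i]) auto
    qed
  qed
qed simp

text \<open>With M = N + 1, the 2 M^2 + 1 stages use grid points from M down to - M. So any y with
  |y| < M lies in a step of width 1 / M, and its value is g at the right end of that step.\<close>

lemma stair_tendsto: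
  assumes ct: "isCont g y"
  shows "(\<lambda>N. stair g (Suc N) (Suc (2 * Suc N * Suc N)) y) \<longlonglongrightarrow> g y"
proof -
  have "\<exists>z. y < z \<and> z \<le> y + 1 / real (Suc N) \<and> stair g (Suc N) (Suc (2 * Suc N * Suc N)) y = g z"
    if N: "\<bar>y\<bar> < real (Suc N)" for N
  proof -
    let ?M = "Suc N" and ?J = "Suc (2 * Suc N * Suc N)"
    obtain i where i: "i < ?J" "y < grid ?M i" "i = ?J - 1 \<or> grid ?M (Suc i) \<le> y" "stair g ?M ?J y = g (grid ?M i)"
      using stair_value[of ?M y g ?J] N by (auto simp del: stair.simps)
    have "i \<noteq> ?J - 1"
    proof
      assume "i = ?J - 1"
      then have "grid ?M i = - real ?M" unfolding grid_def by (simp add: field_simps)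
      then show False using i(2) N by linarith
    qed
    then have "grid ?M (Suc i) \<le> y" using i(3) by simp
    moreover have "grid ?M (Suc i) = grid ?M i - 1 / real ?M"
      by (simp add: grid_def add_divide_distrib)
    ultimately show ?thesis using i by (intro exI[of _ "grid ?M i"]) auto
  qed
  then obtain z where z: "\<And>N. \<bar>y\<bar> < real (Suc N) \<Longrightarrow> y < z N \<and> z N \<le> y + 1 / real (Suc N)
      \<and> stair g (Suc N) (Suc (2 * Suc N * Suc N)) y = g (z N)"
    by metis
  have ev: "eventually (\<lambda>N. \<bar>y\<bar> < real (Suc N)) sequentially"
    using filterlim_compose[OF filterlim_real_sequentially filterlim_Suc]
    by (simp only: filterlim_at_top_dense)
  have "z \<longlonglongrightarrow> y"
  proof (rule tendsto_sandwich)
    show "eventually (\<lambda>N. y \<le> z N) sequentially" using ev by (rule eventually_mono) (use z in force)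
    show "eventually (\<lambda>N. z N \<le> y + 1 / real (Suc N)) sequentially" using ev by (rule eventually_mono) (use z in blast)
    show "(\<lambda>N. y + 1 / real (Suc N)) \<longlonglongrightarrow> y"
      using tendsto_add[OF tendsto_const[of y] LIMSEQ_Suc[OF lim_inverse_n']] by simp
  qed simp
  then have "(\<lambda>N. g (z N)) \<longlonglongrightarrow> g y" by (rule isCont_tendsto_compose[OF ct])
  then show ?thesis
    by (rule Lim_transform_eventually) (use ev in \<open>rule eventually_mono\<close>, use z in \<open>simp del: stair.simps\<close>)
qed

lemma normalized_risk_stair:
  assumes n: "n \<ge> 1" and cv: "convex_on UNIV \<rho>" and bowl: "strictly_bowl_shaped \<rho>"
    and m[measurable]: "\<rho> \<in> borel_measurable borel"
    and bal: "\<And>\<tau>. balanced (right_slope \<rho>) (real n) (c + b \<tau>) (cone \<tau>)"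
    and lt: "\<And>\<tau>. (c + b \<tau>) * \<tau> < 1 / 2"
    and \<nu>: "\<nu> \<ge> 0" and g: "antimono g" "\<And>y. 0 \<le> g y" "\<And>y. g y \<le> b y"
    and fin: "normalized_risk n \<rho> c \<nu> (\<lambda>_. 0) < \<infinity>" and N: "N > 0"
  shows "normalized_risk n \<rho> c \<nu> (stair g N j) \<le> normalized_risk n \<rho> c \<nu> (\<lambda>_. 0)"
proof (induction j)
  case (Suc j)
  \<comment> \<open>The value on the leftmost piece before the next stage, 0 at the start.\<close>
  define \<gamma>0 where "\<gamma>0 = (case j of 0 \<Rightarrow> 0 | Suc i \<Rightarrow> g (grid N i))"
  have gl: "grid N (Suc i) \<le> grid N i" for i
    using N by (simp add: grid_def divide_right_mono)
  have "normalized_risk n \<rho> c \<nu> (stair g N (Suc j)) \<le> normalized_risk n \<rho> c \<nu> (stair g N j)"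
    unfolding stair.simps
  proof (rule normalized_risk_raise[OF n cv bowl m stair_measurable bal lt \<nu>])
    show "stair g N j y = \<gamma>0" if "y < grid N j" for y
      using that gl by (cases j) (auto simp: \<gamma>0_def dest: less_le_trans)
    show "\<gamma>0 \<le> g (grid N j)"
      using g antimonoD[OF g(1) gl] by (cases j) (auto simp: \<gamma>0_def)
    show "c + g (grid N j) \<le> c + b (grid N j)" using g by simp
    show "normalized_risk n \<rho> c \<nu> (stair g N j) < \<infinity>" using Suc fin by (rule le_less_trans)
  qed
  then show ?case using Suc by (rule order_trans)
qed simp

lemma normalized_risk_class_C:
  assumes n: "n \<ge> 1" and cv: "convex_on UNIV \<rho>" and bowl: "strictly_bowl_shaped \<rho>"
    and bal: "\<And>\<tau>. balanced (right_slope \<rho>) (real n) (c + b \<tau>) (cone \<tau>)"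
    and lt: "\<And>\<tau>. (c + b \<tau>) * \<tau> < 1 / 2"
    and \<nu>: "\<nu> \<ge> 0" and g: "class_C_correction g" "\<And>y. g y \<le> b y"
    and fin: "normalized_risk n \<rho> c \<nu> (\<lambda>_. 0) < \<infinity>"
  shows "normalized_risk n \<rho> c \<nu> g \<le> normalized_risk n \<rho> c \<nu> (\<lambda>_. 0)"
proof -
  have anti: "antimono g" and lim: "(g \<longlongrightarrow> 0) at_top" and ac: "absolutely_continuous_fun g"
    using g by (auto simp: class_C_correction_def)
  \<comment> \<open>Makes the first stage, from 0 to the value of g at the rightmost grid point, a
    raise too.\<close>
  have g0: "0 \<le> g y" for y
  proof (rule tendsto_upperbound[OF lim])
    show "eventually (\<lambda>t. g t \<le> g y) at_top"
      using eventually_ge_at_top[of y] by (rule eventually_mono) (rule antimonoD[OF anti])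
  qed simp
  have c\<rho>: "continuous_on UNIV \<rho>" by (rule convex_on_continuous[OF open_UNIV cv])
  then have m: "\<rho> \<in> borel_measurable borel" by (rule borel_measurable_continuous_onI)
  have c\<rho>': "isCont \<rho> x" for x using c\<rho> by (simp add: continuous_on_eq_continuous_at)
  define s where "s N = stair g (Suc N) (Suc (2 * Suc N * Suc N))" for N
  let ?L = "\<lambda>h. \<lambda>(u, v). ennreal (\<rho> (u + c * v + h ((\<nu> + u) / v) * v) * joint_density n 0 1 u v)"
  have lims: "(\<lambda>N. ?L (s N) p) \<longlonglongrightarrow> ?L g p" for p
  proof -
    obtain u v where p: "p = (u, v)" by (cases p)
    have "(\<lambda>N. s N ((\<nu> + u) / v)) \<longlonglongrightarrow> g ((\<nu> + u) / v)"
      unfolding s_def by (rule stair_tendsto[OF absolutely_continuous_fun_on_imp_isCont[OF ac]])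
    then have "(\<lambda>N. u + c * v + s N ((\<nu> + u) / v) * v) \<longlonglongrightarrow> u + c * v + g ((\<nu> + u) / v) * v"
      by (intro tendsto_intros)
    then have "(\<lambda>N. \<rho> (u + c * v + s N ((\<nu> + u) / v) * v)) \<longlonglongrightarrow> \<rho> (u + c * v + g ((\<nu> + u) / v) * v)"
      by (rule isCont_tendsto_compose[OF c\<rho>'])
    then show ?thesis unfolding p prod.case by (intro tendsto_intros)
  qed
  \<comment> \<open>Fatou asks for no common integrable majorant of the staircase losses.\<close>
  have "normalized_risk n \<rho> c \<nu> g = (\<integral>\<^sup>+p. liminf (\<lambda>N. ?L (s N) p) \<partial>lborel)"
    unfolding normalized_risk_def
    by (intro nn_integral_cong) (use lim_imp_Liminf[OF _ lims] in simp)
  also have "\<dots> \<le> liminf (\<lambda>N. \<integral>\<^sup>+p. ?L (s N) p \<partial>lborel)"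
  proof (rule nn_integral_liminf)
    fix N
    show "?L (s N) \<in> borel_measurable lborel"
      using measurable_compose[OF loss_shifted_measurable[OF m stair_measurable] measurable_ennreal]
      by (simp add: s_def split_beta' del: stair.simps)
  qed
  also have "\<dots> \<le> normalized_risk n \<rho> c \<nu> (\<lambda>_. 0)"
  proof (rule Liminf_le)
    show "eventually (\<lambda>N. (\<integral>\<^sup>+p. ?L (s N) p \<partial>lborel) \<le> normalized_risk n \<rho> c \<nu> (\<lambda>_. 0)) sequentially"
      unfolding normalized_risk_def[symmetric] s_def
      by (intro always_eventually allI normalized_risk_stair[OF n cv bowl m bal lt \<nu> anti g0 g(2) fin]) simp
  qed simp
  finally show ?thesis .
qed

section \<open>Posterior loss\<close>

text \<open>The map v to s / v is decreasing, so the increasing map v to - s / v is used after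
  reflecting sigma. Compact intervals exhaust the half line.\<close>

lemma nn_integral_reciprocal_substitution:
  fixes \<Phi> :: "real \<Rightarrow> ennreal"
  assumes \<Phi>[measurable]: "\<Phi> \<in> borel_measurable borel" and s: "s > 0"
  shows "(\<integral>\<^sup>+\<sigma>. \<Phi> \<sigma> * indicator {0<..} \<sigma> \<partial>lborel) =
    (\<integral>\<^sup>+v. \<Phi> (s / v) * ennreal (s / v\<^sup>2) * indicator {0<..} v \<partial>lborel)"
proof -
  \<comment> \<open>The shift by two gives a N < 1 < b N from the start.\<close>
  define a where "a N = 1 / real (Suc (Suc N))" for N
  define b where "b N = real (Suc (Suc N))" for N
  have ab: "0 < a N" "a N < b N" for N
  proof -
    have "a N < 1" "1 < b N" by (auto simp: a_def b_def)
    then show "a N < b N" by linarith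
  qed (simp add: a_def)
  let ?M1 = "density lborel (\<lambda>y. \<Phi> (- y))"
  let ?M2 = "density lborel (\<lambda>v. \<Phi> (s / v) * ennreal (s / v\<^sup>2))"
  have eq: "emeasure ?M1 {- s / a N..- s / b N} = emeasure ?M2 {a N..b N}" for N
  proof -
    have "(\<integral>\<^sup>+y. \<Phi> (- y) * indicator {- s / a N..- s / b N} y \<partial>lborel) =
        (\<integral>\<^sup>+v. \<Phi> (- (- s / v)) * ennreal (s / v\<^sup>2) * indicator {a N..b N} v \<partial>lborel)"
    proof (rule nn_integral_substitution_aux[where g="\<lambda>v. - s / v"])
      fix v assume "v \<in> {a N..b N}"
      then have v: "v > 0" using ab[of N] by auto
      then show "((\<lambda>v. - s / v) has_real_derivative s / v\<^sup>2) (at v)"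
        by (auto intro!: derivative_eq_intros simp: power2_eq_square)
      show "0 \<le> s / v\<^sup>2" using s by simp
    next
      show "continuous_on {a N..b N} (\<lambda>v. s / v\<^sup>2)"
        using ab[of N] by (auto intro!: continuous_intros)
    qed (use ab in auto)
    then show ?thesis by (simp add: emeasure_density)
  qed
  have U2: "(\<Union>N. {a N..b N}) = {0<..}"
  proof (intro equalityI subsetI)
    fix v :: real assume "v \<in> {0<..}"
    then have v: "v > 0" by simp
    obtain N where "max v (1 / v) < real N" using reals_Archimedean2 by blast
    then have "v \<le> b N" "1 / v \<le> b N" by (auto simp: b_def)
    then have "a N \<le> v" using v by (simp add: a_def b_def field_simps)
    then show "v \<in> (\<Union>N. {a N..b N})" using \<open>v \<le> b N\<close> by auto
  qed (use ab in \<open>auto intro: less_le_trans\<close>)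
  have U1: "(\<Union>N. {- s / a N..- s / b N}) = {..<0}"
  proof (intro equalityI subsetI)
    fix y :: real assume "y \<in> (\<Union>N. {- s / a N..- s / b N})"
    then obtain N where "y \<le> - s / b N" by auto
    moreover have "- s / b N < 0" using s ab[of N] by (simp add: divide_neg_pos)
    ultimately show "y \<in> {..<0}" by simp
  next
    fix y :: real assume "y \<in> {..<0}"
    then have y: "y < 0" by simp
    then have "- s / y \<in> {0<..}" using divide_pos_neg[OF s y] by simp
    then obtain N where N: "a N \<le> - s / y" "- s / y \<le> b N" unfolding U2[symmetric] by auto
    have "- s / a N \<le> y" "y \<le> - s / b N"
      using N y s ab[of N] by (auto simp: field_simps)
    then show "y \<in> (\<Union>N. {- s / a N..- s / b N})" by auto
  qed
  have le: "a (Suc N) \<le> a N" "b N \<le> b (Suc N)" for N by (auto simp: a_def b_def field_simps)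
  have inc2: "incseq (\<lambda>N. {a N..b N})"
    by (rule incseq_SucI) (use le in \<open>auto intro: order_trans\<close>)
  have inc1: "incseq (\<lambda>N. {- s / a N..- s / b N})"
  proof (rule incseq_SucI)
    fix N
    have "s / a N \<le> s / a (Suc N)" "s / b (Suc N) \<le> s / b N"
      using le[of N] ab[of N] ab[of "Suc N"] s by (auto intro!: divide_left_mono mult_pos_pos)
    then show "{- s / a N..- s / b N} \<subseteq> {- s / a (Suc N)..- s / b (Suc N)}" by auto
  qed
  have "(\<integral>\<^sup>+\<sigma>. \<Phi> \<sigma> * indicator {0<..} \<sigma> \<partial>lborel) = (\<integral>\<^sup>+y. \<Phi> (- y) * indicator {0<..} (- y) \<partial>lborel)"
    by (subst nn_integral_real_affine[where c="-1" and t=0]) simp_all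
  also have "\<dots> = emeasure ?M1 {..<0}"
    by (subst emeasure_density) (auto intro!: nn_integral_cong simp: indicator_def)
  also have "\<dots> = (SUP N. emeasure ?M1 {- s / a N..- s / b N})"
    unfolding U1[symmetric] by (rule SUP_emeasure_incseq[symmetric]) (use inc1 in auto)
  also have "\<dots> = (SUP N. emeasure ?M2 {a N..b N})" unfolding eq ..
  also have "\<dots> = emeasure ?M2 {0<..}"
    unfolding U2[symmetric] by (rule SUP_emeasure_incseq) (use inc2 in auto)
  also have "\<dots> = (\<integral>\<^sup>+v. \<Phi> (s / v) * ennreal (s / v\<^sup>2) * indicator {0<..} v \<partial>lborel)"
    by (simp add: emeasure_density)
  finally show ?thesis .
qed

text \<open>Here mu = x - sigma u and sigma = s / v; the factors s / v and s / v^2 are the two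
  Jacobians. The excluded u corresponds to mu = 0, which the prior contains but the open cone does
  not.\<close>

lemma posterior_integrand_substitution:
  fixes n :: nat and l :: real
  assumes n: "n \<ge> 1" and s: "s > 0" and v: "v > 0" and u: "u \<noteq> v * (x / s)"
  shows "s / v * (s / v\<^sup>2) * (\<rho> ((x + c0 * s + g * s - (x - s / v * u)) / (s / v))
      * joint_density n (x - s / v * u) (s / v) x s * prior_density l (x - s / v * u) (s / v))
    = s powr (- (l + 1)) * (if u < v * (x / s)
        then \<rho> (u + c0 * v + g * v) * radial_density n (u\<^sup>2 + v\<^sup>2) * v powr (real n + l - 1) else 0)"
proof -
  have arg: "(x + c0 * s + g * s - (x - s / v * u)) / (s / v) = u + c0 * v + g * v"
    using s v by (simp add: field_simps)
  have rad: "((x - (x - s / v * u))\<^sup>2 + s\<^sup>2) / (s / v)\<^sup>2 = u\<^sup>2 + v\<^sup>2"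
  proof -
    have "(x - (x - s / v * u))\<^sup>2 + s\<^sup>2 = (s / v)\<^sup>2 * (u\<^sup>2 + v\<^sup>2)"
      using v by (simp add: power_mult_distrib power_divide distrib_left)
    then show ?thesis using s v by simp
  qed
  have "0 \<le> x - s / v * u \<longleftrightarrow> u < v * (x / s)"
    using s v u by (auto simp: field_simps)
  then have prior: "prior_density l (x - s / v * u) (s / v) = (if u < v * (x / s) then (s / v) powr (- (l + 1)) else 0)"
    using s v unfolding prior_density_def by simp
  have jd: "joint_density n (x - s / v * u) (s / v) x s = s ^ (n - 1) / (s / v) ^ (n + 1) * radial_density n (u\<^sup>2 + v\<^sup>2)"
    unfolding joint_density_def rad using s by simp
  have const: "s / v * (s / v\<^sup>2) * (s ^ (n - 1) / (s / v) ^ (n + 1) * (s / v) powr (- (l + 1)))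
      = s powr (- (l + 1)) * v powr (real n + l - 1)"
  proof -
    have "n + 1 = (n - 1) + 2" using n by simp
    then have e: "(s / v) ^ (n + 1) = s ^ (n - 1) * s\<^sup>2 / v ^ (n + 1)"
      by (metis power_add power_divide)
    have k: "s / v * (s / v\<^sup>2) * (S / (S * s\<^sup>2 / V)) = V / v ^ 3" if "S \<noteq> 0" "V \<noteq> 0" for S V
      using s v that by (simp add: field_simps power2_eq_square power3_eq_cube)
    have "s / v * (s / v\<^sup>2) * (s ^ (n - 1) / (s / v) ^ (n + 1)) = v ^ (n + 1) / v ^ 3"
      unfolding e by (rule k) (use s v in auto)
    also have "v ^ (n + 1) = v powr real (n + 1)" using v by (intro powr_realpow[symmetric])
    also have "v ^ 3 = v powr 3" using v by simp
    also have "v powr real (n + 1) / v powr 3 = v powr (real (n + 1) - 3)" by (rule powr_diff[symmetric])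
    finally have 1: "s / v * (s / v\<^sup>2) * (s ^ (n - 1) / (s / v) ^ (n + 1)) = v powr (real (n + 1) - 3)" .
    have 2: "(s / v) powr (- (l + 1)) = v powr (l + 1) * s powr (- (l + 1))"
      using powr_divide[of s v "- (l + 1)"] powr_minus_divide[of v "l + 1"] s v by simp
    have "real (n + 1) - 3 + (l + 1) = real n + l - 1" by simp
    then have 3: "v powr (real (n + 1) - 3) * v powr (l + 1) = v powr (real n + l - 1)"
      by (simp only: powr_add[symmetric])
    show ?thesis
      unfolding mult.assoc[symmetric, of _ _ "(s / v) powr _"] 1 2 mult.assoc[symmetric] 3 by (rule mult.commute)
  qed
  show ?thesis
  proof (cases "u < v * (x / s)")
    case True
    have *: "A * (L * (B * R) * P) = A * (B * P) * (L * R)" for A L B R P :: real by simp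
    show ?thesis
      unfolding arg jd prior if_P[OF True] * const by (simp only: mult_ac)
  next
    case False
    show ?thesis
      unfolding prior if_not_P[OF False] by simp
  qed
qed

lemma posterior_loss_eq_reduced:
  assumes n: "n \<ge> 1" and s: "s > 0" and \<rho>0: "\<And>t. \<rho> t \<ge> 0" and m[measurable]: "\<rho> \<in> borel_measurable borel"
  shows "posterior_loss n \<rho> l x s (x + c0 * s + g * s) =
    ennreal (s powr (- (l + 1))) * reduced_posterior_loss n \<rho> c0 l (x / s) g"
proof -
  let ?d = "x + c0 * s + g * s" and ?C = "ennreal (s powr (- (l + 1)))"
  define F where "F = (\<lambda>(\<mu>, \<sigma>). ennreal (\<rho> ((?d - \<mu>) / \<sigma>) * joint_density n \<mu> \<sigma> x s * prior_density l \<mu> \<sigma>))"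
  define R where "R = (\<lambda>p. (case p of (u, v) \<Rightarrow>
     ennreal (\<rho> (u + c0 * v + g * v) * radial_density n (u\<^sup>2 + v\<^sup>2) * v powr (real n + l - 1))) * indicator (cone (x / s)) p)"
  have [measurable]: "F \<in> borel_measurable (borel \<Otimes>\<^sub>M borel)"
    unfolding F_def joint_density_def radial_density_eq prior_density_def by measurable
  have [measurable]: "cone (x / s) \<in> sets (borel \<Otimes>\<^sub>M borel)"
    unfolding borel_prod by (rule cone_borel)
  have [measurable]: "R \<in> borel_measurable (borel \<Otimes>\<^sub>M borel)"
    unfolding R_def radial_density_eq by measurable
  \<comment> \<open>The inner integral after mu = x - sigma u, whose Jacobian is sigma.\<close>
  define \<Phi> where "\<Phi> \<sigma> = ennreal \<sigma> * (\<integral>\<^sup>+u. F (x - \<sigma> * u, \<sigma>) \<partial>lborel)" for \<sigma>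
  have [measurable]: "\<Phi> \<in> borel_measurable borel"
    unfolding \<Phi>_def by measurable
  have "posterior_loss n \<rho> l x s ?d = (\<integral>\<^sup>+p. F p \<partial>(lborel \<Otimes>\<^sub>M lborel))"
    by (simp add: posterior_loss_def F_def lborel_prod)
  also have "\<dots> = (\<integral>\<^sup>+\<sigma>. \<integral>\<^sup>+\<mu>. F (\<mu>, \<sigma>) \<partial>lborel \<partial>lborel)"
    by (rule lborel_pair.nn_integral_snd[symmetric, simplified]) measurable
  also have "\<dots> = (\<integral>\<^sup>+\<sigma>. \<Phi> \<sigma> * indicator {0<..} \<sigma> \<partial>lborel)"
  proof (rule nn_integral_cong)
    fix \<sigma> :: real
    show "(\<integral>\<^sup>+\<mu>. F (\<mu>, \<sigma>) \<partial>lborel) = \<Phi> \<sigma> * indicator {0<..} \<sigma>"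
    proof (cases "\<sigma> > 0")
      case True
      then show ?thesis
        by (subst nn_integral_real_affine[where c="- \<sigma>" and t=x]) (auto simp: \<Phi>_def)
    next
      case False
      then have "F (\<mu>, \<sigma>) = 0" for \<mu> by (simp add: F_def prior_density_def)
      then show ?thesis using False by simp
    qed
  qed
  also have "\<dots> = (\<integral>\<^sup>+v. \<Phi> (s / v) * ennreal (s / v\<^sup>2) * indicator {0<..} v \<partial>lborel)"
    by (rule nn_integral_reciprocal_substitution[OF _ s]) measurable
  also have "\<dots> = (\<integral>\<^sup>+v. ?C * (\<integral>\<^sup>+u. R (u, v) \<partial>lborel) \<partial>lborel)"
  proof (rule nn_integral_cong)
    fix v :: real
    show "\<Phi> (s / v) * ennreal (s / v\<^sup>2) * indicator {0<..} v = ?C * (\<integral>\<^sup>+u. R (u, v) \<partial>lborel)"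
    proof (cases "v > 0")
      case v: True
      have "ennreal (s / v * (s / v\<^sup>2)) = ennreal (s / v) * ennreal (s / v\<^sup>2)"
        using s v by (intro ennreal_mult) auto
      then have "\<Phi> (s / v) * ennreal (s / v\<^sup>2) = ennreal (s / v * (s / v\<^sup>2)) * (\<integral>\<^sup>+u. F (x - s / v * u, s / v) \<partial>lborel)"
        by (simp only: \<Phi>_def mult_ac)
      also have "\<dots> = (\<integral>\<^sup>+u. ennreal (s / v * (s / v\<^sup>2)) * F (x - s / v * u, s / v) \<partial>lborel)"
        by (rule nn_integral_cmult[symmetric]) measurable
      also have "\<dots> = (\<integral>\<^sup>+u. ?C * R (u, v) \<partial>lborel)"
      proof (rule nn_integral_cong_AE)
        have "AE u in lborel. u \<noteq> v * (x / s)" by (rule AE_lborel_singleton)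
        then show "AE u in lborel. ennreal (s / v * (s / v\<^sup>2)) * F (x - s / v * u, s / v) = ?C * R (u, v)"
        proof (rule eventually_mono)
          fix u assume u: "u \<noteq> v * (x / s)"
          have F0: "0 \<le> \<rho> ((?d - (x - s / v * u)) / (s / v)) * joint_density n (x - s / v * u) (s / v) x s * prior_density l (x - s / v * u) (s / v)"
            using \<rho>0 s v by (intro mult_nonneg_nonneg joint_density_nonneg[OF n]) (auto simp: prior_density_def)
          have "ennreal (s / v * (s / v\<^sup>2)) * F (x - s / v * u, s / v)
            = ennreal (s / v * (s / v\<^sup>2) * (\<rho> ((?d - (x - s / v * u)) / (s / v))
      * joint_density n (x - s / v * u) (s / v) x s * prior_density l (x - s / v * u) (s / v)))"
            unfolding F_def prod.case using s v F0 by (intro ennreal_mult[symmetric]) auto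
          also have "\<dots> = ?C * R (u, v)"
            unfolding posterior_integrand_substitution[OF n s v u]
            using v \<rho>0 radial_constant_pos[OF n]
            by (subst ennreal_mult) (auto simp: R_def cone_def indicator_def radial_density_eq)
          finally show "ennreal (s / v * (s / v\<^sup>2)) * F (x - s / v * u, s / v) = ?C * R (u, v)" .
        qed
      qed
      also have "\<dots> = ?C * (\<integral>\<^sup>+u. R (u, v) \<partial>lborel)"
        by (rule nn_integral_cmult) measurable
      finally show ?thesis using v by simp
    next
      case False
      then have "R (u, v) = 0" for u by (simp add: R_def cone_def)
      then show ?thesis using False by simp
    qed
  qed
  also have "\<dots> = ?C * (\<integral>\<^sup>+v. \<integral>\<^sup>+u. R (u, v) \<partial>lborel \<partial>lborel)"
    by (rule nn_integral_cmult) measurable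
  also have "(\<integral>\<^sup>+v. \<integral>\<^sup>+u. R (u, v) \<partial>lborel \<partial>lborel) = (\<integral>\<^sup>+p. R p \<partial>(lborel \<Otimes>\<^sub>M lborel))"
    by (rule lborel_pair.nn_integral_snd[simplified]) measurable
  also have "\<dots> = reduced_posterior_loss n \<rho> c0 l (x / s) g"
    by (simp add: reduced_posterior_loss_def R_def lborel_prod)
  finally show ?thesis .
qed

text \<open>Two unique minimisers of proportional functions coincide.\<close>

lemma generalized_bayes_eq_shifted_estimator:
  assumes n: "n \<ge> 1" and \<rho>0: "\<And>t. \<rho> t \<ge> 0" and m: "\<rho> \<in> borel_measurable borel"
    and gb: "generalized_bayes n \<rho> l \<delta>" and bc: "bayes_correction n \<rho> c0 l g" and s: "s > 0"
  shows "\<delta> x s = shifted_estimator c0 g x s"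
proof (rule ccontr)
  assume ne: "\<delta> x s \<noteq> shifted_estimator c0 g x s"
  define g' where "g' = (\<delta> x s - x - c0 * s) / s"
  have d: "\<delta> x s = x + c0 * s + g' * s" using s by (simp add: g'_def)
  have "posterior_loss n \<rho> l x s (\<delta> x s) < posterior_loss n \<rho> l x s (shifted_estimator c0 g x s)"
    using gb s ne by (auto simp: generalized_bayes_def unique_minimizer_def)
  moreover have "reduced_posterior_loss n \<rho> c0 l (x / s) (g (x / s)) \<le> reduced_posterior_loss n \<rho> c0 l (x / s) g'"
    using bc by (cases "g' = g (x / s)") (auto simp: bayes_correction_def unique_minimizer_def less_imp_le)
  then have "ennreal (s powr (- (l + 1))) * reduced_posterior_loss n \<rho> c0 l (x / s) (g (x / s))
      \<le> ennreal (s powr (- (l + 1))) * reduced_posterior_loss n \<rho> c0 l (x / s) g'"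
    by (rule mult_left_mono) simp
  ultimately show False
    unfolding d shifted_estimator_def posterior_loss_eq_reduced[OF n s \<rho>0 m] by (simp add: leD)
qed

section \<open>Even losses, and assembly of the theorem\<close>

lemma even_imp_steeper_on_right:
  assumes bowl: "strictly_bowl_shaped \<rho>" and even: "\<And>t. \<rho> (- t) = \<rho> t"
  shows "steeper_on_right \<rho>"
  unfolding steeper_on_right_def
proof (intro allI impI)
  fix u :: real assume u: "0 \<le> u" "\<rho> differentiable (at u)" "\<rho> differentiable (at (- u))"
  have "DERIV \<rho> (- u) :> deriv \<rho> (- u)"
    using u(3) DERIV_deriv_iff_real_differentiable by blast
  then have "DERIV (\<lambda>t. \<rho> (- t)) u :> - deriv \<rho> (- u)"
    by (simp add: DERIV_mirror)
  then have "DERIV \<rho> u :> - deriv \<rho> (- u)" by (simp add: even)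
  then have "deriv \<rho> u = - deriv \<rho> (- u)" by (rule DERIV_imp_deriv)
  \<comment> \<open>At u = 0 the bowl shape says nothing, but the equation just obtained forces the
    derivative to vanish.\<close>
  moreover have "deriv \<rho> u > 0 \<or> u = 0"
    using bowl u by (auto simp: strictly_bowl_shaped_def)
  ultimately show "\<bar>deriv \<rho> (- u)\<bar> \<le> deriv \<rho> u" by auto
qed

text \<open>Bayes estimators are determined for s > 0 only, and the joint law lives there.\<close>

lemma risk_cong:
  assumes "\<And>x s. s > 0 \<Longrightarrow> \<delta> x s = \<delta>' x s"
  shows "risk n \<rho> \<mu> \<sigma> \<delta> = risk n \<rho> \<mu> \<sigma> \<delta>'"
proof -
  let ?j = "\<lambda>(x, s). ennreal (joint_density n \<mu> \<sigma> x s)"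
  have j: "?j \<in> borel_measurable lborel"
    using measurable_compose[OF joint_density_measurable[of n \<mu> \<sigma>] measurable_ennreal] by (simp add: split_beta')
  have "AE p in joint_law n \<mu> \<sigma>. snd p > 0"
    unfolding joint_law_def AE_density[OF j]
    by (intro AE_I2) (auto simp: joint_density_def split: if_splits)
  then show ?thesis
    unfolding risk_def
    by (intro nn_integral_cong_AE) (elim eventually_mono, simp add: split_beta' assms)
qed

text \<open>\<open>\<nu>\<close> is free because a zero correction ignores X / S; this is the
  constancy of the risk.\<close>

lemma risk_mre_eq_normalized_risk:
  assumes "n \<ge> 1" "\<sigma> > 0" "\<And>t. \<rho> t \<ge> 0" "\<rho> \<in> borel_measurable borel"
  shows "risk n \<rho> \<mu> \<sigma> (\<lambda>x s. x + c * s) = normalized_risk n \<rho> c \<nu> (\<lambda>_. 0)"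
proof -
  have "(\<lambda>x s. x + c * s) = shifted_estimator c (\<lambda>_. 0)"
    by (simp add: shifted_estimator_def fun_eq_iff)
  then show ?thesis
    using risk_shifted_estimator[OF assms, of "\<lambda>_. 0" \<mu> c] by (simp add: normalized_risk_def)
qed

text \<open>Reflecting u shows that c0 and - c0 have the same risk, so uniqueness leaves only
  0.\<close>

lemma mre_constant_even:
  assumes n: "n \<ge> 1" and \<rho>0: "\<And>t. \<rho> t \<ge> 0" and m: "\<rho> \<in> borel_measurable borel"
    and even: "\<And>t. \<rho> (- t) = \<rho> t" and mre: "mre_constant n \<rho> c0"
  shows "c0 = 0"
proof (rule ccontr)
  assume "c0 \<noteq> 0"
  then have "risk n \<rho> 0 1 (\<lambda>x s. x + c0 * s) < risk n \<rho> 0 1 (\<lambda>x s. x + - c0 * s)"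
    using mre unfolding mre_constant_def unique_minimizer_def by (metis neg_equal_zero)
  moreover have "normalized_risk n \<rho> c0 0 (\<lambda>_. 0) = normalized_risk n \<rho> (- c0) 0 (\<lambda>_. 0)"
  proof -
    let ?L = "\<lambda>c. \<lambda>(u, v). ennreal (\<rho> (u + c * v + 0 * v) * joint_density n 0 1 u v)"
    let ?T = "\<lambda>(x, y). (0 + (-1) * x, y :: real)"
    have "?L c0 \<in> borel_measurable borel"
      using measurable_compose[OF loss_shifted_measurable[OF m borel_measurable_const[of 0]] measurable_ennreal]
      by (simp add: split_beta')
    then have "(\<integral>\<^sup>+p. ?L c0 p \<partial>lborel) = ennreal \<bar>-1\<bar> * (\<integral>\<^sup>+p. ?L c0 (?T p) \<partial>lborel)"
      by (intro nn_integral_lborel_transform[OF shear_snd_measurable(2)[where h="\<lambda>_. 0"] lborel_shear_fst[where h="\<lambda>_. 0"]]) simp_all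
    also have "(\<integral>\<^sup>+p. ?L c0 (?T p) \<partial>lborel) = (\<integral>\<^sup>+p. ?L (- c0) p \<partial>lborel)"
    proof (rule nn_integral_cong)
      fix p :: "real \<times> real"
      obtain u v where p: "p = (u, v)" by (cases p)
      have "\<rho> (- u + c0 * v) = \<rho> (u - c0 * v)" using even[of "u - c0 * v"] by simp
      then show "?L c0 (?T p) = ?L (- c0) p" by (simp add: p joint_density_standard)
    qed
    finally show ?thesis by (simp add: normalized_risk_def)
  qed
  moreover have "risk n \<rho> 0 1 (\<lambda>x s. x + c * s) = normalized_risk n \<rho> c 0 (\<lambda>_. 0)" for c
    by (rule risk_mre_eq_normalized_risk[OF n zero_less_one \<rho>0 m])
  ultimately show False by (simp only: less_irrefl)
qed

theorem theorem2:
  fixes n :: nat and \<rho> :: "real \<Rightarrow> real" and c0 :: real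
    and g\<pi>0 :: "real \<Rightarrow> real" and \<delta>\<pi>0 :: "real \<Rightarrow> real \<Rightarrow> real"
  assumes n: "n \<ge> 1"
    and ac: "absolutely_continuous_fun \<rho>"
    and bowl: "strictly_bowl_shaped \<rho>"
    and convex: "convex_on UNIV \<rho>"
    and mre: "mre_constant n \<rho> c0"
    and bayes: "generalized_bayes n \<rho> 0 \<delta>\<pi>0"
    and corr: "bayes_correction n \<rho> c0 0 g\<pi>0"
  shows
    "(steeper_on_right \<rho> \<longrightarrow>
        (\<forall>g. class_C_correction g \<and> (\<forall>y. g y \<le> g\<pi>0 y) \<longrightarrow>
           minimax n \<rho> c0 (shifted_estimator c0 g)))
     \<and> (steeper_on_right \<rho> \<longrightarrow>
          class_C_correction g\<pi>0 \<and>
          (\<forall>x. \<forall>s>0. \<delta>\<pi>0 x s = shifted_estimator c0 g\<pi>0 x s) \<and>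
          minimax n \<rho> c0 \<delta>\<pi>0)
     \<and> ((\<forall>t. \<rho> (- t) = \<rho> t) \<longrightarrow>
          (\<forall>l>0. \<forall>g\<pi>l \<delta>\<pi>l.
             generalized_bayes n \<rho> l \<delta>\<pi>l \<and> bayes_correction n \<rho> c0 l g\<pi>l \<longrightarrow>
             class_C_correction g\<pi>l \<and> (\<forall>y. g\<pi>l y \<le> g\<pi>0 y) \<and>
             (\<forall>x. \<forall>s>0. \<delta>\<pi>l x s = shifted_estimator c0 g\<pi>l x s) \<and>
             minimax n \<rho> c0 \<delta>\<pi>l))"
proof -
  interpret monotone_score "right_slope \<rho>" by (rule monotone_score_right_slope[OF convex bowl])
  have \<rho>0: "\<rho> t \<ge> 0" for t using bowl by (simp add: strictly_bowl_shaped_def)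
  have m: "\<rho> \<in> borel_measurable borel"
    by (rule borel_measurable_continuous_onI[OF convex_on_continuous[OF open_UNIV convex]])
  have full: "balanced (right_slope \<rho>) (real n) c0 half_plane"
    by (rule mre_constant_balanced[OF n convex bowl mre])
  have bal: "balanced (right_slope \<rho>) (real n) (c0 + g\<pi>0 y) (cone y)" for y
    using bayes_correction_balanced[OF n convex bowl corr] by simp
  \<comment> \<open>Finiteness at mu = 0, sigma = 1 spreads to every nu because this risk is
    constant.\<close>
  have fin: "normalized_risk n \<rho> c0 \<nu> (\<lambda>_. 0) < \<infinity>" for \<nu>
    using mre risk_mre_eq_normalized_risk[OF n zero_less_one \<rho>0 m, of 0 c0 \<nu>]
    by (simp add: mre_constant_def unique_minimizer_def)
  have mm: "minimax n \<rho> c0 \<delta>"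
    if st: "steeper_on_right \<rho>" and g: "class_C_correction g" "\<And>y. g y \<le> g\<pi>0 y"
      and \<delta>: "\<And>x s. s > 0 \<Longrightarrow> \<delta> x s = shifted_estimator c0 g x s" for g \<delta>
    unfolding minimax_def
  proof (intro allI impI)
    fix \<mu> \<sigma> :: real assume \<mu>: "0 \<le> \<mu>" and \<sigma>: "0 < \<sigma>"
    have "absolutely_continuous_fun g" using g by (simp add: class_C_correction_def)
    then have gm: "g \<in> borel_measurable borel"
      by (intro borel_measurable_continuous_onI continuous_at_imp_continuous_on ballI
          absolutely_continuous_fun_on_imp_isCont)
    have "risk n \<rho> \<mu> \<sigma> \<delta> = risk n \<rho> \<mu> \<sigma> (shifted_estimator c0 g)" by (rule risk_cong[OF \<delta>])
    also have "\<dots> = normalized_risk n \<rho> c0 (\<mu> / \<sigma>) g"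
      by (rule risk_shifted_estimator[OF n \<sigma> \<rho>0 m gm])
    also have "\<dots> \<le> normalized_risk n \<rho> c0 (\<mu> / \<sigma>) (\<lambda>_. 0)"
    proof (rule normalized_risk_class_C[OF n convex bowl bal _ _ g fin])
      show "(c0 + g\<pi>0 \<tau>) * \<tau> < 1 / 2" for \<tau>
        by (rule balanced_cone_product_lt[OF bal _ AE_right_slope_steeper[OF convex st]]) simp
      show "0 \<le> \<mu> / \<sigma>" using \<mu> \<sigma> by simp
    qed
    also have "\<dots> = risk n \<rho> \<mu> \<sigma> (\<lambda>x s. x + c0 * s)"
      by (rule risk_mre_eq_normalized_risk[OF n \<sigma> \<rho>0 m, symmetric])
    finally show "risk n \<rho> \<mu> \<sigma> \<delta> \<le> risk n \<rho> \<mu> \<sigma> (\<lambda>x s. x + c0 * s)" .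
  qed
  have est0: "\<delta>\<pi>0 x s = shifted_estimator c0 g\<pi>0 x s" if "s > 0" for x s
    by (rule generalized_bayes_eq_shifted_estimator[OF n \<rho>0 m bayes corr that])
  have C0: "class_C_correction g\<pi>0" if "steeper_on_right \<rho>"
    by (rule class_C_bayes_correction[OF n order_refl convex bowl that corr]) (use full in simp)
  show ?thesis
  proof (intro conjI impI allI)
    fix g assume "steeper_on_right \<rho>" "class_C_correction g \<and> (\<forall>y. g y \<le> g\<pi>0 y)"
    then show "minimax n \<rho> c0 (shifted_estimator c0 g)" by (intro mm) auto
  next
    fix x s :: real assume "s > 0"
    then show "\<delta>\<pi>0 x s = shifted_estimator c0 g\<pi>0 x s" by (rule est0)
  next
    assume st: "steeper_on_right \<rho>"
    then show "class_C_correction g\<pi>0" by (rule C0)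
    with st show "minimax n \<rho> c0 \<delta>\<pi>0" by (rule mm) (use est0 in auto)
  next
    fix l :: real and g\<pi>l \<delta>\<pi>l
    assume "\<forall>t. \<rho> (- t) = \<rho> t" and l: "l > 0"
      and bl: "generalized_bayes n \<rho> l \<delta>\<pi>l \<and> bayes_correction n \<rho> c0 l g\<pi>l"
    then have even: "\<rho> (- t) = \<rho> t" for t by simp
    have st: "steeper_on_right \<rho>" by (rule even_imp_steeper_on_right[OF bowl even])
    have c0: "c0 = 0" by (rule mre_constant_even[OF n \<rho>0 m even mre])
    have full0: "balanced (right_slope \<rho>) (real n) 0 half_plane" using full c0 by simp
    \<comment> \<open>Since c0 = 0, balance on the half plane passes from the power n to n + l, so
      the corrections for l > 0 have limit 0 as well.\<close>
    have fulll: "balanced (right_slope \<rho>) (real n + l) c0 half_plane"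
      unfolding c0 by (rule balanced_half_plane_factor(2)[OF full0]) (use l in auto)
    show Cl: "class_C_correction g\<pi>l"
      by (rule class_C_bayes_correction[OF n _ convex bowl st _ fulll]) (use l bl in auto)
    show le: "g\<pi>l y \<le> g\<pi>0 y" for y
    proof -
      have "balanced (right_slope \<rho>) (real n + l) (c0 + g\<pi>l y) (cone y)"
        using bayes_correction_balanced[OF n convex bowl] bl by blast
      then have "c0 + g\<pi>l y \<le> c0 + g\<pi>0 y"
        by (rule balanced_cone_power_antimono[OF bal _ full0 _ l]) simp
      then show ?thesis by simp
    qed
    show est: "\<delta>\<pi>l x s = shifted_estimator c0 g\<pi>l x s" if "s > 0" for x s
      using generalized_bayes_eq_shifted_estimator[OF n \<rho>0 m _ _ that] bl by blast
    show "minimax n \<rho> c0 \<delta>\<pi>l" by (rule mm[OF st Cl le est])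
  qed
qed

end
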